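(* Let $(P^{\downarrow}_k)_{k\ge1}$ be a random decreasing sequence of ranked frequencies, i.e. $1\ge P^{\downarrow}_1\ge P^{\downarrow}_2\ge\cdots\ge0$ and $\sum_{k}P^{\downarrow}_k\le 1$, subject to the regularity condition $$\mathbb P\big(0<P^{\downarrow}_2,\ P^{\downarrow}_1+P^{\downarrow}_2<1\big)>0\quad\text{and}\quad\mathbb P(P^{\downarrow}_1=1)=0 .$$ For $P^{\downarrow}_J$ a size-biased pick from $(P^{\downarrow}_k)$, let $(Q^{\downarrow}_k)$ be derived from $(P^{\downarrow}_k)$ by deletion of $P^{\downarrow}_J$ and renormalization. Then the random variable $P^{\downarrow}_J$ is independent of the sequence $(Q^{\downarrow}_k)$ if and only if either the distribution of $(P^{\downarrow}_k)$ is $\mathrm{PD}(\alpha,\theta)$ for some $(\alpha,\theta)$, or $P^{\downarrow}_k=1/M$ for all $1\le k\le M$, for some integer $M\ge3$. In the former case the distribution of $(Q^{\downarrow}_k)$ is $\mathrm{PD}(\alpha,\theta+\alpha)$, whereas in the latter case the deletion and renormalization simply decrements $M$ by one (i.e. $Q^{\downarrow}_k=1/(M-1)$ for $1\le k\le M-1$).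
   Context: Size-biased pick: for a sequence of non-negative random variables $(X_i)_{i\ge1}$ with $\sum_iX_i\le1$ and a random index $J\in\{1,2,\ldots,\infty\}$ with $$\mathbb P(J=j\mid (X_i)_{i\in\mathbb N})=X_j\qquad(1\le j<\infty),$$ the size-biased pick $X_J$ has value $X_j$ if $J=j<\infty$ and $X_J=0$ if $J=\infty$. The sequence $(Y_i)$ derived from $(X_i)$ by deletion of $X_J$ and renormalization is obtained by deleting the $J$th term, closing up the gap if $J\ne\infty$, and dividing each remaining term by $1-X_J$; by convention $(Y_i)=(X_i)$ if $X_J=0$, and $(Y_i)$ is the zero sequence if $X_J=1$. $\mathrm{PD}(\alpha,\theta)$, the two-parameter Poisson–Dirichlet distribution, is defined for $(\alpha,\theta)$ either with $0\le\alpha<1$, $\theta>-\alpha$, or with $\alpha<0$ and $\theta=-M\alpha$ for some positive integer $M$. It is the distribution of the decreasing rearrangement of the sequence $P_i=W_i\prod_{j=1}^{i-1}(1-W_j)$, where the $W_i$ are independent and $W_i$ has the beta$(1-\alpha,\theta+i\alpha)$ distribution, with density proportional to $u^{-\alpha}(1-u)^{\theta+i\alpha-1}$ on $(0,1)$; in the case $\alpha<0$, $\theta=-M\alpha$, this is used for $1\le i<M$ and $W_M=1$ (so $P_i=0$ for $i>M$). *)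

theory Defs
  imports "HOL-Probability.Probability"
begin

text \<open>
  Sequences are indexed from 0: the \<open>i\<close>-th term of a sequence \<open>x\<close> is \<open>x (i - 1)\<close>.
  A random sequence is a random element of the countable product of real lines.
\<close>

abbreviation seq_borel :: "(nat \<Rightarrow> real) measure" where
  "seq_borel \<equiv> (\<Pi>\<^sub>M i\<in>UNIV. borel)"

definition ranked_frequencies :: "(nat \<Rightarrow> real) set" where
  "ranked_frequencies =
     {p. decseq p \<and> p 0 \<le> 1 \<and> (\<forall>k. 0 \<le> p k) \<and> summable p \<and> (\<Sum>k. p k) \<le> 1}"

text \<open>
  Independence of two random variables as in \<^const>\<open>prob_space.indep_var\<close>, which is restricted
  to random variables with values in the same type (lemma \<open>indep_random_variables_eq_indep_var\<close>).
\<close>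

definition indep_random_variables ::
  "'a measure \<Rightarrow> 'b measure \<Rightarrow> ('a \<Rightarrow> 'b) \<Rightarrow> 'c measure \<Rightarrow> ('a \<Rightarrow> 'c) \<Rightarrow> bool" where
  "indep_random_variables M A X B Y \<longleftrightarrow>
     X \<in> M \<rightarrow>\<^sub>M A \<and> Y \<in> M \<rightarrow>\<^sub>M B \<and>
     prob_space.indep_set M (sigma_sets (space M) {X -` S \<inter> space M |S. S \<in> sets A})
       (sigma_sets (space M) {Y -` S \<inter> space M |S. S \<in> sets B})"

lemma (in prob_space) indep_random_variables_eq_indep_var:
  "indep_random_variables M A X B Y \<longleftrightarrow> indep_var A X B Y"
  unfolding indep_random_variables_def indep_var_eq by blast


subsection \<open>Size-biased picks, deletion and renormalization\<close>

definition size_biased_index ::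
  "'a measure \<Rightarrow> ('a \<Rightarrow> nat \<Rightarrow> real) \<Rightarrow> ('a \<Rightarrow> enat) \<Rightarrow> bool" where
  "size_biased_index M X J \<longleftrightarrow>
     J \<in> M \<rightarrow>\<^sub>M count_space UNIV \<and>
     (\<forall>j. AE \<omega> in M.
        real_cond_exp M (vimage_algebra (space M) X seq_borel)
          (indicator {\<omega> \<in> space M. J \<omega> = enat j}) \<omega> = X \<omega> j)"

definition pick :: "(nat \<Rightarrow> real) \<Rightarrow> enat \<Rightarrow> real" where
  "pick x J = (case J of enat j \<Rightarrow> x j | \<infinity> \<Rightarrow> 0)"

definition delete_renormalize :: "(nat \<Rightarrow> real) \<Rightarrow> enat \<Rightarrow> nat \<Rightarrow> real" where
  "delete_renormalize x J =
     (case J of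
        \<infinity> \<Rightarrow> x
      | enat j \<Rightarrow>
          if x j = 0 then x
          else if x j = 1 then (\<lambda>k. 0)
          else (\<lambda>k. (if k < j then x k else x (Suc k)) / (1 - x j)))"


subsection \<open>The two-parameter Poisson--Dirichlet distribution\<close>

text \<open>
  The term at position \<open>k\<close> of the decreasing rearrangement is the largest \<open>t\<close> such that
  at least \<open>k + 1\<close> terms of the sequence are \<open>\<ge> t\<close>. For a nonnegative sequence tending
  to 0 this lists the positive terms in decreasing order with their multiplicities, followed by
  zeros if there are only finitely many of them (lemmas \<open>decseq_decreasing_rearrangement\<close>
  and \<open>card_decreasing_rearrangement\<close>).
\<close>

definition decreasing_rearrangement :: "(nat \<Rightarrow> real) \<Rightarrow> nat \<Rightarrow> real" where
  "decreasing_rearrangement x k = (SUP A\<in>{A. finite A \<and> card A = Suc k}. Min (x ` A))"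

definition stick_breaking :: "(nat \<Rightarrow> real) \<Rightarrow> nat \<Rightarrow> real" where
  "stick_breaking w k = w k * (\<Prod>j<k. 1 - w j)"

definition beta_distribution :: "real \<Rightarrow> real \<Rightarrow> real measure" where
  "beta_distribution a b =
     density lborel
       (\<lambda>u. ennreal (u powr (a - 1) * (1 - u) powr (b - 1) / Beta a b * indicator {0<..<1} u))"

definition PD_parameters :: "real \<Rightarrow> real \<Rightarrow> bool" where
  "PD_parameters \<alpha> \<theta> \<longleftrightarrow>
     (0 \<le> \<alpha> \<and> \<alpha> < 1 \<and> - \<alpha> < \<theta>) \<or>
     (\<alpha> < 0 \<and> (\<exists>m::nat. 1 \<le> m \<and> \<theta> = - real m * \<alpha>))"

text \<open>
  For \<open>\<alpha> < 0\<close> and \<open>\<theta> = - m \<alpha>\<close> the number \<open>\<theta> + i \<alpha>\<close> is positive exactly when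
  \<open>i < m\<close>, so the factors with \<open>1 \<le> i < m\<close> are beta distributed and the \<open>m\<close>-th factor
  is 1; the later factors, also put equal to 1, have no effect on the products. For
  \<open>0 \<le> \<alpha> < 1\<close> and \<open>\<theta> > - \<alpha>\<close> every factor is beta distributed.
\<close>

definition PD_factor :: "real \<Rightarrow> real \<Rightarrow> nat \<Rightarrow> real measure" where
  "PD_factor \<alpha> \<theta> k =
     (if 0 < \<theta> + real (Suc k) * \<alpha>
      then beta_distribution (1 - \<alpha>) (\<theta> + real (Suc k) * \<alpha>)
      else return borel 1)"

definition PD :: "real \<Rightarrow> real \<Rightarrow> (nat \<Rightarrow> real) measure" where
  "PD \<alpha> \<theta> =
     distr (\<Pi>\<^sub>M k\<in>UNIV. PD_factor \<alpha> \<theta> k) seq_borel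
       (\<lambda>w. decreasing_rearrangement (stick_breaking w))"

definition has_PD_distribution ::
  "'a measure \<Rightarrow> ('a \<Rightarrow> nat \<Rightarrow> real) \<Rightarrow> real \<Rightarrow> real \<Rightarrow> bool" where
  "has_PD_distribution M X \<alpha> \<theta> \<longleftrightarrow> PD_parameters \<alpha> \<theta> \<and> distr M seq_borel X = PD \<alpha> \<theta>"


subsection \<open>Basic properties of the definitions\<close>

lemma ex_card_Suc: "\<exists>A::nat set. finite A \<and> card A = Suc k"
  by (rule exI[of _ "{..k}"]) simp

lemma decreasing_rearrangement_bdd:
  assumes "bdd_above (range x)"
  shows "bdd_above ((\<lambda>A. Min (x ` A)) ` {A. finite A \<and> card A = Suc k})"
proof -
  obtain B where B: "\<And>i. x i \<le> B" using assms by (auto simp: bdd_above_def)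
  have "Min (x ` A) \<le> B" if A: "finite A" "card A = Suc k" for A
  proof -
    obtain a where "a \<in> A" using A by fastforce
    then have "Min (x ` A) \<le> x a" using A by simp
    then show ?thesis using B[of a] by simp
  qed
  then show ?thesis by (auto simp: bdd_above_def)
qed

lemma decreasing_rearrangement_ge_iff:
  assumes nonneg: "\<And>i. 0 \<le> x i" and lim: "x \<longlonglongrightarrow> 0" and t: "0 < t"
  shows "t \<le> decreasing_rearrangement x k \<longleftrightarrow> k < card {i. t \<le> x i}"
proof -
  have fin: "finite {i. s \<le> x i}" if "0 < s" for s
  proof -
    have "\<forall>\<^sub>F i in sequentially. x i < s" using order_tendstoD(2)[OF lim that] .
    then obtain N where "\<And>i. i \<ge> N \<Longrightarrow> x i < s" by (auto simp: eventually_sequentially)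
    then have "{i. s \<le> x i} \<subseteq> {..<N}" by (metis (mono_tags) lessThan_iff linorder_not_le mem_Collect_eq subsetI)
    then show ?thesis using finite_subset by blast
  qed
  have "Bseq x" using lim convergentI convergent_imp_Bseq by blast
  then have "bdd_above (range x)" by (rule Bseq_bdd_above)
  note bdd = decreasing_rearrangement_bdd[OF this, of k]
  show ?thesis
  proof
    assume "k < card {i. t \<le> x i}"
    then obtain A where A: "A \<subseteq> {i. t \<le> x i}" "card A = Suc k" "finite A"
      by (metis Suc_leI obtain_subset_with_card_n)
    then have "A \<noteq> {}" by auto
    then have "t \<le> Min (x ` A)" using A by auto
    also have "\<dots> \<le> decreasing_rearrangement x k"
      unfolding decreasing_rearrangement_def using A by (intro cSUP_upper bdd) auto
    finally show "t \<le> decreasing_rearrangement x k" .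
  next
    assume le: "t \<le> decreasing_rearrangement x k"
    show "k < card {i. t \<le> x i}"
    proof (rule ccontr)
      assume neg: "\<not> k < card {i. t \<le> x i}"
      define S where "S = insert (t/2) (x ` {i. t/2 \<le> x i \<and> x i < t})"
      have finS: "finite S" unfolding S_def using fin[of "t/2"] t
        by (auto intro!: finite_imageI intro: finite_subset[rotated])
      have "Min (x ` A) \<le> Max S" if A: "finite A" "card A = Suc k" for A
      proof -
        have "\<not> A \<subseteq> {i. t \<le> x i}"
          using card_mono[OF fin[OF t], of A] A neg by auto
        then obtain a where a: "a \<in> A" "x a < t" by (auto simp: subset_eq not_le)
        have "x a \<le> Max S"
        proof (cases "t/2 \<le> x a")
          case True
          then have "x a \<in> S" using a by (auto simp: S_def)
          then show ?thesis using finS by simp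
        next
          case False
          moreover have "t/2 \<in> S" by (simp add: S_def)
          then have "t/2 \<le> Max S" using finS by (rule Max_ge[rotated])
          ultimately show ?thesis by simp
        qed
        moreover have "Min (x ` A) \<le> x a" using A a by simp
        ultimately show ?thesis by simp
      qed
      then have "decreasing_rearrangement x k \<le> Max S"
        unfolding decreasing_rearrangement_def using ex_card_Suc by (intro cSUP_least) auto
      moreover have "Max S < t" using finS t by (subst Max_less_iff) (auto simp: S_def)
      ultimately show False using le by simp
    qed
  qed
qed

lemma decreasing_rearrangement_nonneg:
  assumes nonneg: "\<And>i. 0 \<le> x i" and lim: "x \<longlonglongrightarrow> 0"
  shows "0 \<le> decreasing_rearrangement x k"
proof -
  have "Bseq x" using lim convergentI convergent_imp_Bseq by blast
  then have "bdd_above (range x)" by (rule Bseq_bdd_above)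
  note bdd = decreasing_rearrangement_bdd[OF this, of k]
  have "0 \<le> Min (x ` {..k})" using nonneg by (subst Min_ge_iff) auto
  also have "\<dots> \<le> decreasing_rearrangement x k"
    unfolding decreasing_rearrangement_def by (intro cSUP_upper bdd) auto
  finally show ?thesis .
qed

lemma decseq_decreasing_rearrangement:
  assumes "\<And>i. 0 \<le> x i" and "x \<longlonglongrightarrow> 0"
  shows "decseq (decreasing_rearrangement x)"
proof (rule decseq_SucI)
  fix k
  show "decreasing_rearrangement x (Suc k) \<le> decreasing_rearrangement x k"
  proof (cases "0 < decreasing_rearrangement x (Suc k)")
    case True
    then have "Suc k < card {i. decreasing_rearrangement x (Suc k) \<le> x i}"
      using decreasing_rearrangement_ge_iff[OF assms True] by blast
    then show ?thesis using decreasing_rearrangement_ge_iff[OF assms True, of k] by simp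
  next
    case False
    then show ?thesis using decreasing_rearrangement_nonneg[OF assms, of k] by simp
  qed
qed

lemma card_decreasing_rearrangement:
  assumes "\<And>i. 0 \<le> x i" and "x \<longlonglongrightarrow> 0" and "0 < t"
  shows "card {k. t \<le> decreasing_rearrangement x k} = card {i. t \<le> x i}"
  by (simp add: decreasing_rearrangement_ge_iff[OF assms] flip: lessThan_def)

lemma measurable_decreasing_rearrangement [measurable]:
  "decreasing_rearrangement \<in> seq_borel \<rightarrow>\<^sub>M seq_borel"
proof (rule measurable_PiM_single')
  fix k :: nat
  define I where "I = {A::nat set. finite A \<and> card A = Suc k}"
  have I: "countable I"
    by (rule countable_subset[OF _ countable_Collect_finite]) (auto simp: I_def)
  have Min: "(\<lambda>x. Min (x ` A)) \<in> borel_measurable seq_borel" if "A \<in> I" for A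
  proof -
    have "finite A" "A \<noteq> {}" using that by (auto simp: I_def)
    then show ?thesis
    proof (induction A rule: finite_ne_induct)
      case (insert a A)
      note [measurable] = insert.IH
      have "(\<lambda>x::nat \<Rightarrow> real. Min (x ` insert a A)) = (\<lambda>x. min (x a) (Min (x ` A)))"
        using insert by (intro ext) simp
      then show ?case by simp
    qed simp
  qed
  let ?b = "\<lambda>x::nat\<Rightarrow>real. \<exists>n::nat. \<forall>A\<in>I. Min (x ` A) \<le> real n"
  have b: "?b x \<longleftrightarrow> bdd_above ((\<lambda>A. Min (x ` A)) ` I)" for x
    by (auto simp: bdd_above_def) (meson order_trans real_arch_simple)
  have bm [measurable]: "Measurable.pred seq_borel ?b"
  proof (rule pred_intros_countable(2))
    fix n
    have "I \<noteq> {}" using ex_card_Suc[of k] by (auto simp: I_def)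
    then have r: "range (from_nat_into I) = I" using I by (rule range_from_nat_into)
    have "Measurable.pred seq_borel (\<lambda>x. Min (x ` from_nat_into I i) \<le> real n)" for i
    proof -
      have "from_nat_into I i \<in> I" using r by blast
      note [measurable] = Min[OF this]
      show ?thesis by measurable
    qed
    then have "Measurable.pred seq_borel (\<lambda>x. \<forall>i. Min (x ` from_nat_into I i) \<le> real n)"
      by (rule pred_intros_countable(1))
    also have "(\<lambda>x. \<forall>i. Min (x ` from_nat_into I i) \<le> real n) =
        (\<lambda>x::nat \<Rightarrow> real. \<forall>A\<in>range (from_nat_into I). Min (x ` A) \<le> real n)"
      by simp
    finally show "Measurable.pred seq_borel (\<lambda>x. \<forall>A\<in>I. Min (x ` A) \<le> real n)"
      unfolding r .
  qed
  have "(\<lambda>x. SUP A\<in>I. if ?b x then Min (x ` A) else 0) \<in> borel_measurable seq_borel"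
  proof (rule borel_measurable_cSUP[OF I])
    show "(\<lambda>x. if ?b x then Min (x ` A) else 0) \<in> borel_measurable seq_borel" if "A \<in> I" for A
      by (intro measurable_If bm[unfolded pred_def] Min that) simp
    show "bdd_above ((\<lambda>A. if ?b x then Min (x ` A) else 0) ` I)" for x
      by (cases "?b x") (auto simp: b)
  qed
  then have "(\<lambda>x. if ?b x then (SUP A\<in>I. if ?b x then Min (x ` A) else 0)
      else (LEAST z::real. False)) \<in> borel_measurable seq_borel"
    by (intro measurable_If bm[unfolded pred_def]) simp_all
  also have "(\<lambda>x. if ?b x then (SUP A\<in>I. if ?b x then Min (x ` A) else 0)
      else (LEAST z::real. False)) = (\<lambda>x. decreasing_rearrangement x k)"
  proof
    fix x :: "nat \<Rightarrow> real"
    have "Sup Y = (LEAST z::real. False)" if "\<not> bdd_above Y" for Y :: "real set"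
      using that unfolding Sup_real_def bdd_above_def by metis
    then show "(if ?b x then (SUP A\<in>I. if ?b x then Min (x ` A) else 0)
      else (LEAST z::real. False)) = decreasing_rearrangement x k"
      using b[of x] by (auto simp: decreasing_rearrangement_def I_def)
  qed
  finally show "(\<lambda>x. decreasing_rearrangement x k) \<in> borel_measurable seq_borel" .
qed (simp add: space_PiM)

lemma measurable_stick_breaking [measurable]: "stick_breaking \<in> seq_borel \<rightarrow>\<^sub>M seq_borel"
  unfolding stick_breaking_def[abs_def]
  by (rule measurable_PiM_single') (auto simp: space_PiM)

lemma prob_space_beta_distribution:
  assumes "0 < a" "0 < b"
  shows "prob_space (beta_distribution a b)"
proof
  have pos: "0 < Beta a b" using assms by (simp add: Beta_def Gamma_real_pos)
  have "((\<lambda>u. u powr (a - 1) * (1 - u) powr (b - 1)) has_integral Beta a b) {0<..<1}"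
    using has_integral_Beta_real[OF assms] by (simp add: has_integral_Icc_iff_Ioo)
  from has_integral_divide[OF this, of "Beta a b"]
  have "((\<lambda>u. u powr (a - 1) * (1 - u) powr (b - 1) / Beta a b) has_integral 1) {0<..<1}"
    by (simp only: divide_self[OF pos[THEN less_imp_neq, symmetric]])
  moreover have "(\<lambda>u. u powr (a - 1) * (1 - u) powr (b - 1) / Beta a b * indicator {0<..<1} u) =
      (\<lambda>u. if u \<in> {0<..<1} then u powr (a - 1) * (1 - u) powr (b - 1) / Beta a b else 0)"
    by (auto simp: fun_eq_iff indicator_def)
  ultimately have "((\<lambda>u. u powr (a - 1) * (1 - u) powr (b - 1) / Beta a b * indicator {0<..<1} u)
      has_integral 1) UNIV"
    by (simp only: has_integral_restrict_UNIV)
  then have "(\<integral>\<^sup>+u. ennreal (u powr (a - 1) * (1 - u) powr (b - 1) / Beta a b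
      * indicator {0<..<1} u) \<partial>lborel) = ennreal 1"
    using pos by (intro nn_integral_has_integral_lborel) simp_all
  then show "emeasure (beta_distribution a b) (space (beta_distribution a b)) = 1"
    by (simp add: beta_distribution_def emeasure_density)
qed

lemma sets_PD_factor [measurable_cong, simp]: "sets (PD_factor \<alpha> \<theta> k) = sets borel"
  by (simp add: PD_factor_def beta_distribution_def)

lemma prob_space_PD:
  assumes "PD_parameters \<alpha> \<theta>"
  shows "prob_space (PD \<alpha> \<theta>)"
proof -
  have "\<alpha> < 1" using assms by (auto simp: PD_parameters_def)
  then have "prob_space (PD_factor \<alpha> \<theta> k)" for k
    by (auto simp: PD_factor_def intro!: prob_space_beta_distribution prob_space_return)
  then have "prob_space (\<Pi>\<^sub>M k\<in>UNIV. PD_factor \<alpha> \<theta> k)"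
    by (intro prob_space_PiM)
  then show ?thesis unfolding PD_def
    by (rule prob_space.prob_space_distr) measurable
qed

end

theory Submission
  imports Defs
begin

text \<open>
  The law of a ranked sequence is determined by the expectations \<open>p(n\<^sub>1,\<dots>,n\<^sub>k)\<close> of the sums of
  \<open>P i\<^sub>1 ^ n\<^sub>1 * \<dots> * P i\<^sub>k ^ n\<^sub>k\<close> over distinct indices, which are symmetric in the exponents. Let
  \<open>p'\<close> be the same function for \<open>Q\<close>, and let \<open>a(r,s)\<close> be the expectation of \<open>X ^ r (1 - X) ^ s\<close> for
  the size-biased pick \<open>X\<close>, on the event that it is positive. Independence of \<open>X\<close> and \<open>Q\<close> means
  \<open>p(r+1,n\<^sub>1,\<dots>,n\<^sub>k) = a(r,n\<^sub>1+\<dots>+n\<^sub>k) p'(n\<^sub>1,\<dots>,n\<^sub>k)\<close>.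

  For \<open>k = 1\<close> the symmetry of \<open>p\<close> and the additivity \<open>a(r,s) = a(r+1,s) + a(r,s+1)\<close> form a linear
  system whose solutions are determined by \<open>p'(1)\<close>, \<open>p'(2)\<close>, \<open>p'(3)\<close> up to a factor. If
  \<open>p'(1) p'(3) > p'(2)\<^sup>2\<close>, then \<open>a\<close> is the moment function of a beta distribution, and the addition
  rule \<open>p(n\<^sub>1,\<dots>,n\<^sub>k) = p(n\<^sub>1+1,\<dots>,n\<^sub>k) + \<dots> + p(n\<^sub>1,\<dots>,n\<^sub>k+1) + p(n\<^sub>1,\<dots>,n\<^sub>k,1)\<close> forces the
  Ewens--Pitman formula, that is, a Poisson--Dirichlet law; in the case of equality all positive
  frequencies coincide. Conversely, the Ewens--Pitman formula factorizes in the same way, which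
  gives the joint law of \<open>X\<close> and \<open>Q\<close>.
\<close>

section \<open>Power sums and sums over distinct indices\<close>

text \<open>Distinct sums do not see the order of the terms, so neither ranking nor closing the gap
  has to be followed term by term: both preserve all power sums, and these fix the distinct sums.
  They live in \<open>ennreal\<close>, where sums and integrals may be exchanged freely; bounds by 1
  give the passage to reals. A power of \<open>1 - X\<close> compensates the renormalization, which
  is why mixed moments \<open>a(r,s)\<close> occur instead of plain moments of the pick. The
  obstacle in the forward direction is that the frequencies may sum to less than 1. Then possibly
  nothing is picked, and the addition rule has an extra dust term; independence must exclude dust
  before the rule is available in the stated form. The symmetric system involves only
  \<open>a(r,s)\<close> with \<open>s > 0\<close>, since a second exponent must be positive. The
  values \<open>a(r,0)\<close> come back by summing increments, because they tend to 0 when the pick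
  is almost surely below 1. Regularity enters through a third positive frequency, which makes
  \<open>p'(n)\<close> strictly decreasing and thereby the system uniquely solvable.\<close>

definition power_sum :: "nat \<Rightarrow> (nat \<Rightarrow> ennreal) \<Rightarrow> ennreal" where
  "power_sum m y = (\<Sum>i. y i ^ m)"

text \<open>The sum of \<open>y i\<^sub>1 ^ n\<^sub>1 * \<dots> * y i\<^sub>k ^ n\<^sub>k\<close> over pairwise distinct indices: setting the chosen
  term to 0 excludes it from the inner sums, as all exponents are positive.\<close>

fun distinct_sum :: "nat list \<Rightarrow> (nat \<Rightarrow> ennreal) \<Rightarrow> ennreal" where
  "distinct_sum [] y = 1"
| "distinct_sum (n # ns) y = (\<Sum>i. y i ^ n * distinct_sum ns (y(i := 0)))"

lemma suminf_swap_ennreal: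
  fixes f :: "nat \<Rightarrow> nat \<Rightarrow> ennreal"
  shows "(\<Sum>i. \<Sum>j. f i j) = (\<Sum>j. \<Sum>i. f i j)"
proof -
  have "(\<Sum>i. \<Sum>j. f i j) = (\<Sum>i. \<integral>\<^sup>+j. f i j \<partial>count_space UNIV)"
    by (simp add: nn_integral_count_space_nat)
  also have "\<dots> = (\<integral>\<^sup>+j. (\<Sum>i. f i j) \<partial>count_space UNIV)"
    by (simp add: nn_integral_suminf)
  finally show ?thesis by (simp add: nn_integral_count_space_nat)
qed

lemma suminf_split_at_ennreal:
  fixes f :: "nat \<Rightarrow> ennreal"
  shows "(\<Sum>i. f i) = f j + (\<Sum>i. if i = j then 0 else f i)"
proof -
  have "(\<Sum>i. f i) = (\<Sum>i. (if i = j then f i else 0) + (if i = j then 0 else f i))"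
    by (intro suminf_cong) simp
  also have "\<dots> = (\<Sum>i. if i = j then f i else 0) + (\<Sum>i. if i = j then 0 else f i)"
    by (rule suminf_add[symmetric]) auto
  also have "(\<Sum>i. if i = j then f i else 0) = f j"
    using suminf_finite[of "{j}" "\<lambda>i. if i = j then f i else 0"] by simp
  finally show ?thesis .
qed

lemma power_sum_fun_upd:
  assumes "0 < m"
  shows "power_sum m y = y i ^ m + power_sum m (y(i := 0))"
  unfolding power_sum_def suminf_split_at_ennreal[of "\<lambda>k. y k ^ m" i]
  using assms by (intro arg_cong2[of _ _ _ _ "(+)"] refl suminf_cong) (simp add: zero_power)

text \<open>After exchanging the two sums only the diagonal could differ; it vanishes on both sides
  because both exponents are positive.\<close>

lemma distinct_sum_swap:
  assumes "0 < n" "0 < m"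
  shows "distinct_sum (n # m # ns) y = distinct_sum (m # n # ns) y"
proof -
  have "distinct_sum (n # m # ns) y =
      (\<Sum>i. \<Sum>j. y i ^ n * (y(i := 0)) j ^ m * distinct_sum ns (y(i := 0, j := 0)))"
    by (simp add: mult.assoc)
  also have "\<dots> = (\<Sum>j. \<Sum>i. y i ^ n * (y(i := 0)) j ^ m * distinct_sum ns (y(i := 0, j := 0)))"
    by (rule suminf_swap_ennreal)
  also have "\<dots> = (\<Sum>j. \<Sum>i. y j ^ m * ((y(j := 0)) i ^ n * distinct_sum ns (y(j := 0, i := 0))))"
  proof (intro suminf_cong)
    fix j i
    show "y i ^ n * (y(i := 0)) j ^ m * distinct_sum ns (y(i := 0, j := 0)) =
      y j ^ m * ((y(j := 0)) i ^ n * distinct_sum ns (y(j := 0, i := 0)))"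
      by (cases "i = j") (use assms in \<open>auto simp: zero_power mult_ac fun_upd_twist\<close>)
  qed
  finally show ?thesis by simp
qed

text \<open>The index of the power sum either differs from all chosen indices or coincides with
  exactly one of them, whose exponent then grows by \<open>m\<close>.\<close>

lemma power_sum_mult_distinct_sum:
  assumes "0 < m" "\<forall>n\<in>set ns. 0 < n"
  shows "power_sum m y * distinct_sum ns y =
    distinct_sum (m # ns) y + (\<Sum>j<length ns. distinct_sum (ns[j := ns ! j + m]) y)"
  using assms(2)
proof (induction ns arbitrary: y)
  case Nil
  show ?case by (simp add: power_sum_def)
next
  case (Cons n ns)
  have "power_sum m y * distinct_sum (n # ns) y =
      (\<Sum>i. power_sum m y * (y i ^ n * distinct_sum ns (y(i := 0))))" by simp
  also have "\<dots> = (\<Sum>i. y i ^ (n + m) * distinct_sum ns (y(i := 0)) +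
      (y i ^ n * distinct_sum (m # ns) (y(i := 0)) +
       (\<Sum>j<length ns. y i ^ n * distinct_sum (ns[j := ns ! j + m]) (y(i := 0)))))"
    (is "_ = (\<Sum>i. ?A i + (?B i + ?C i))")
  proof (intro suminf_cong)
    fix i
    have "power_sum m y * (y i ^ n * distinct_sum ns (y(i := 0))) =
      ?A i + y i ^ n * (power_sum m (y(i := 0)) * distinct_sum ns (y(i := 0)))"
      by (subst power_sum_fun_upd[OF assms(1), of y i])
        (simp add: distrib_left distrib_right power_add mult_ac)
    then show "power_sum m y * (y i ^ n * distinct_sum ns (y(i := 0))) = ?A i + (?B i + ?C i)"
      using Cons by (simp add: distrib_left sum_distrib_left del: distinct_sum.simps fun_upd_apply)
  qed
  also have "\<dots> = (\<Sum>i. ?A i) + ((\<Sum>i. ?B i) + (\<Sum>i. ?C i))"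
    by (subst suminf_add[symmetric], simp, simp)+ simp
  also have "(\<Sum>i. ?C i) = (\<Sum>j<length ns. distinct_sum (n # ns[j := ns ! j + m]) y)"
    by (subst suminf_sum) auto
  also have "(\<Sum>i. ?B i) = distinct_sum (m # n # ns) y"
    using distinct_sum_swap[of n m ns y] assms(1) Cons.prems by simp
  also have "(\<Sum>i. ?A i) = distinct_sum ((n + m) # ns) y" by simp
  finally show ?case
    by (simp add: sum.lessThan_Suc_shift add_ac del: distinct_sum.simps sum.lessThan_Suc)
qed

lemma ennreal_add_right_cancelD:
  fixes a b c :: ennreal
  assumes "c \<noteq> top" "a + c = b + c"
  shows "a = b"
  using assms by (metis ennreal_add_diff_cancel_right)

lemma power_sum_le_1:
  assumes "(\<Sum>i. y i) \<le> 1" "0 < m"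
  shows "power_sum m y \<le> 1"
proof -
  have y: "y i \<le> 1" for i
    using suminf_split_at_ennreal[of y i] assms(1) le_add_same_cancel1
    by (metis add.commute add_increasing2 dual_order.trans le_iff_add)
  have "y i ^ m \<le> y i" for i
  proof -
    have "y i ^ m = y i * y i ^ (m - 1)" using assms(2) by (simp flip: power_Suc)
    also have "\<dots> \<le> y i * 1" using y by (intro mult_left_mono power_le_one) auto
    finally show ?thesis by simp
  qed
  then have "power_sum m y \<le> (\<Sum>i. y i)" unfolding power_sum_def by (intro suminf_le) auto
  then show ?thesis using assms by simp
qed

lemma suminf_fun_upd_le:
  fixes y :: "nat \<Rightarrow> ennreal"
  shows "(\<Sum>i. (y(k := 0)) i) \<le> (\<Sum>i. y i)"
  by (intro suminf_le) auto

lemma distinct_sum_le_1: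
  assumes "(\<Sum>i. y i) \<le> 1" "\<forall>n\<in>set ns. 0 < n"
  shows "distinct_sum ns y \<le> 1"
  using assms
proof (induction ns arbitrary: y)
  case (Cons n ns)
  have "distinct_sum (n # ns) y \<le> (\<Sum>i. y i ^ n * 1)"
    unfolding distinct_sum.simps using Cons.prems
    by (intro suminf_le mult_left_mono Cons.IH order_trans[OF suminf_fun_upd_le]) auto
  also have "\<dots> \<le> 1" using power_sum_le_1[of y n] Cons.prems by (simp add: power_sum_def)
  finally show ?case .
qed simp

text \<open>Newton-type recursion: \<open>power_sum_mult_distinct_sum\<close> expresses \<^const>\<open>distinct_sum\<close> through
  power sums, so rearrangements and insertions of zeros do not change it.\<close>

lemma distinct_sum_cong_power_sum:
  assumes "\<And>m. 0 < m \<Longrightarrow> power_sum m y = power_sum m z" "(\<Sum>i. y i) \<le> 1"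
    and "\<forall>n\<in>set ns. 0 < n"
  shows "distinct_sum ns y = distinct_sum ns z"
  using assms(3)
proof (induction "length ns" arbitrary: ns)
  case (Suc l)
  then obtain n ms where ns: "ns = n # ms" "length ms = l" by (cases ns) auto
  have *: "distinct_sum ks y = distinct_sum ks z"
    if "length ks = l" "\<forall>n\<in>set ks. 0 < n" for ks using Suc.hyps(1) that by simp
  have pos: "\<forall>n\<in>set ms. 0 < n" "0 < n" using Suc.prems ns by auto
  have upd: "\<forall>k\<in>set (ms[j := ms ! j + n]). 0 < k" for j
    using pos set_update_subset_insert[of ms j "ms ! j + n"] by auto
  have eq: "distinct_sum (n # ms) y + (\<Sum>j<length ms. distinct_sum (ms[j := ms ! j + n]) y) =
    distinct_sum (n # ms) z + (\<Sum>j<length ms. distinct_sum (ms[j := ms ! j + n]) z)"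
    using * ns pos assms(1)[of n]
    by (subst (1 2) power_sum_mult_distinct_sum[symmetric]) auto
  have sum: "(\<Sum>j<length ms. distinct_sum (ms[j := ms ! j + n]) y) =
     (\<Sum>j<length ms. distinct_sum (ms[j := ms ! j + n]) z)"
    using * upd ns by (intro sum.cong) auto
  \<comment> \<open>Only finiteness matters here: in \<open>ennreal\<close> a summand can be
    cancelled only if it is not infinite.\<close>
  have "(\<Sum>j<length ms. distinct_sum (ms[j := ms ! j + n]) z) \<le> (\<Sum>j<length ms. 1)"
    unfolding sum[symmetric] by (intro sum_mono distinct_sum_le_1 assms(2) upd)
  then have "(\<Sum>j<length ms. distinct_sum (ms[j := ms ! j + n]) z) \<noteq> top"
    by (metis ennreal_of_nat_eq_real_of_nat ennreal_neq_top neq_top_trans sum_constant mult.right_neutral)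
  then show ?case using eq unfolding sum ns(1) by (rule ennreal_add_right_cancelD)
qed simp

lemma distinct_sum_scale:
  "distinct_sum ns (\<lambda>i. c * y i) = c ^ sum_list ns * distinct_sum ns y"
proof (induction ns arbitrary: y)
  case (Cons n ns)
  have "(\<lambda>k. c * y k)(i := 0) = (\<lambda>k. c * (y(i := 0)) k)" for i by auto
  then show ?case using Cons
    by (simp add: power_mult_distrib power_add mult_ac del: fun_upd_apply flip: ennreal_suminf_cmult)
qed simp

lemma power_sum_delete:
  assumes "0 < m"
  shows "power_sum m (\<lambda>k. if k < j then y k else y (Suc k)) = power_sum m (y(j := 0))"
proof -
  let ?g = "\<lambda>k. (if k < j then y k else y (Suc k)) ^ m" and ?h = "\<lambda>k. (y(j := 0)) k ^ m"
  have g: "(\<Sum>k. ?g k) = (\<Sum>k. ?g (k + j)) + (\<Sum>k<j. ?g k)"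
    by (rule suminf_offset) simp
  have h: "(\<Sum>k. ?h k) = (\<Sum>k. ?h (k + Suc j)) + (\<Sum>k<Suc j. ?h k)"
    by (rule suminf_offset) simp
  show ?thesis unfolding power_sum_def g h using assms by (auto simp: zero_power intro!: arg_cong2[of _ _ _ _ "(+)"] sum.cong)
qed

text \<open>Closing the gap and overwriting the term by 0 yield the same power sums. Deletion can
  therefore be modelled by \<open>y(j := 0)\<close>, which needs no reindexing.\<close>

lemma distinct_sum_delete:
  assumes "(\<Sum>i. y i) \<le> 1" and "\<forall>n\<in>set ns. 0 < n"
  shows "distinct_sum ns (\<lambda>k. if k < j then y k else y (Suc k)) = distinct_sum ns (y(j := 0))"
  using assms suminf_fun_upd_le[of y j]
  by (intro distinct_sum_cong_power_sum[symmetric]) (auto simp: power_sum_delete intro: order_trans)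

section \<open>Singling out one entry of the exponent list\<close>

definition remove_nth :: "nat \<Rightarrow> 'a list \<Rightarrow> 'a list" where
  "remove_nth j xs = take j xs @ drop (Suc j) xs"

lemma remove_nth_simps [simp]:
  "remove_nth 0 (x # xs) = xs" "remove_nth (Suc j) (x # xs) = x # remove_nth j xs"
  by (simp_all add: remove_nth_def)

text \<open>Position \<open>k\<close> is used by none of the distinct indices or by exactly one of
  them, the one with exponent \<open>ns ! j\<close>.\<close>

lemma distinct_sum_split:
  assumes "\<forall>n\<in>set ns. 0 < n"
  shows "distinct_sum ns y = distinct_sum ns (y(k := 0)) +
    (\<Sum>j<length ns. y k ^ (ns ! j) * distinct_sum (remove_nth j ns) (y(k := 0)))"
  using assms
proof (induction ns arbitrary: y)
  case (Cons n ns)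
  let ?z = "y(k := 0)"
  have n: "0 < n" using Cons.prems by simp
  have "distinct_sum (n # ns) y = y k ^ n * distinct_sum ns ?z +
     (\<Sum>i. if i = k then 0 else y i ^ n * distinct_sum ns (y(i := 0)))"
    unfolding distinct_sum.simps by (rule suminf_split_at_ennreal)
  also have "(\<Sum>i. if i = k then 0 else y i ^ n * distinct_sum ns (y(i := 0))) =
    (\<Sum>i. ?z i ^ n * distinct_sum ns (?z(i := 0)) +
      (\<Sum>j<length ns. y k ^ (ns ! j) * (?z i ^ n * distinct_sum (remove_nth j ns) (?z(i := 0)))))"
  proof (intro suminf_cong)
    fix i
    show "(if i = k then 0 else y i ^ n * distinct_sum ns (y(i := 0))) =
       ?z i ^ n * distinct_sum ns (?z(i := 0)) +
      (\<Sum>j<length ns. y k ^ (ns ! j) * (?z i ^ n * distinct_sum (remove_nth j ns) (?z(i := 0))))"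
    proof (cases "i = k")
      case False
      have "distinct_sum ns (y(i := 0)) = distinct_sum ns (?z(i := 0)) +
        (\<Sum>j<length ns. y k ^ (ns ! j) * distinct_sum (remove_nth j ns) (?z(i := 0)))"
        using Cons.IH[of "y(i := 0)"] Cons.prems False by (simp add: fun_upd_twist del: fun_upd_apply) simp
      then show ?thesis using False by (simp add: distrib_left sum_distrib_left mult.left_commute[of "y i ^ n"] del: fun_upd_apply) simp
    qed (use n in \<open>simp add: zero_power\<close>)
  qed
  also have "\<dots> = distinct_sum (n # ns) ?z +
      (\<Sum>j<length ns. y k ^ (ns ! j) * distinct_sum (n # remove_nth j ns) ?z)"
    by (subst suminf_add[symmetric], simp, simp, subst suminf_sum) (auto simp del: fun_upd_apply)
  finally show ?case
    by (simp add: sum.lessThan_Suc_shift add_ac del: distinct_sum.simps sum.lessThan_Suc fun_upd_apply)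
qed simp

text \<open>Only exchanges of neighbours are available, so the chosen exponent is carried to the
  front one exchange at a time.\<close>

lemma distinct_sum_move:
  assumes "\<forall>n\<in>set ns. 0 < n" "j < length ns"
  shows "distinct_sum ns y = distinct_sum (ns ! j # remove_nth j ns) y"
  using assms
proof (induction ns arbitrary: j y)
  case (Cons n ns)
  show ?case
  proof (cases j)
    case (Suc i)
    have i: "i < length ns" "0 < n" "0 < ns ! i" using Cons.prems by (auto simp: Suc)
    have IH: "distinct_sum ns z = distinct_sum (ns ! i # remove_nth i ns) z" for z
      using Cons.prems by (intro Cons.IH i(1)) simp
    have "distinct_sum (n # ns) y = distinct_sum (n # ns ! i # remove_nth i ns) y"
      unfolding distinct_sum.simps(2)[of n] IH ..
    also have "\<dots> = distinct_sum (ns ! i # n # remove_nth i ns) y"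
      using i by (intro distinct_sum_swap)
    finally show ?thesis by (simp add: Suc)
  qed simp
qed simp

text \<open>The indices \<open>ks\<close> supply one positive summand; being distinct, they survive
  when the earlier ones are overwritten by 0.\<close>

lemma distinct_sum_pos:
  assumes "distinct ks" "length ks = length ns" "\<And>i. i \<in> set ks \<Longrightarrow> 0 < y i"
  shows "0 < distinct_sum ns y"
  using assms
proof (induction ns arbitrary: ks y)
  case (Cons n ns)
  then obtain i js where ijs: "ks = i # js" by (cases ks) auto
  have "0 < distinct_sum ns (y(i := 0))"
    using Cons.prems ijs by (intro Cons.IH[of js]) auto
  moreover have "0 < y i ^ n"
    proof -
    have "y i \<noteq> 0" using Cons.prems(3)[of i] ijs by auto
    then have "y i ^ n \<noteq> 0" by (rule power_not_zero)
    then show ?thesis by (metis not_gr_zero)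
  qed
  ultimately have "0 < y i ^ n * distinct_sum ns (y(i := 0))" by (subst ennreal_zero_less_mult_iff) blast
  also have "\<dots> \<le> distinct_sum (n # ns) y"
    unfolding distinct_sum.simps suminf_split_at_ennreal[of "\<lambda>i. y i ^ n * distinct_sum ns (y(i := 0))" i]
    by (rule add_increasing2) (rule zero_le, rule order_refl)
  finally show ?case .
qed simp

section \<open>Moment determinacy on the unit interval and the unit cube\<close>

lemma integrable_power_mult_power:
  fixes N :: "real measure"
  assumes "finite_measure N" and [measurable_cong]: "sets N = sets borel" and "AE x in N. x \<in> {0..1}"
  shows "integrable N (\<lambda>x. x ^ r * (1 - x) ^ s)"
proof -
  interpret finite_measure N by fact
  have "AE x in N. norm (x ^ r * (1 - x) ^ s) \<le> 1"
    using assms(3) by eventually_elim (auto simp: abs_mult power_abs intro!: mult_le_one power_le_one)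
  then show ?thesis by (intro integrable_const_bound[of _ 1]) auto
qed

text \<open>Factors \<open>1 - x\<close> are multiplied out one at a time, which leaves only
  integrals of powers.\<close>

lemma power_integrals_eq_imp_Bernstein_integrals_eq:
  assumes fin: "finite_measure N1" "finite_measure N2"
    and sets [measurable_cong]: "sets N1 = sets borel" "sets N2 = sets borel"
    and AE: "AE x in N1. x \<in> {0..1}" "AE x in N2. x \<in> {0..1::real}"
    and eq: "\<And>n. (\<integral>x. x ^ n \<partial>N1) = (\<integral>x. x ^ n \<partial>N2)"
  shows "(\<integral>x. x ^ r * (1 - x) ^ s \<partial>N1) = (\<integral>x. x ^ r * (1 - x) ^ s \<partial>N2)"
proof -
  note int = integrable_power_mult_power
  note i1 = int[OF fin(1) sets(1) AE(1)] and i2 = int[OF fin(2) sets(2) AE(2)]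
  show ?thesis
  proof (induction s arbitrary: r)
    case (Suc s)
    have *: "(\<lambda>x::real. x ^ r * (1 - x) ^ Suc s) = (\<lambda>x. x ^ r * (1 - x) ^ s - x ^ Suc r * (1 - x) ^ s)"
      by (auto simp: algebra_simps)
    show ?case unfolding * Bochner_Integration.integral_diff[OF i1 i1]
      Bochner_Integration.integral_diff[OF i2 i2] Suc ..
  qed (use eq in simp)
qed

text \<open>Bernstein polynomials approximate continuous functions, which in turn approximate the
  indicators of half-lines.\<close>

lemma finite_measure_eqI_moments:
  fixes N1 N2 :: "real measure"
  assumes fin: "finite_measure N1" "finite_measure N2"
    and sets [measurable_cong, simp]: "sets N1 = sets borel" "sets N2 = sets borel"
    and AE: "AE x in N1. x \<in> {0..1}" "AE x in N2. x \<in> {0..1}"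
    and eq: "\<And>n. (\<integral>\<^sup>+x. ennreal x ^ n \<partial>N1) = (\<integral>\<^sup>+x. ennreal x ^ n \<partial>N2)"
  shows "N1 = N2"
proof -
  interpret N1: finite_measure N1 by fact
  interpret N2: finite_measure N2 by fact
  have real: "(\<integral>x. x ^ n \<partial>N) = enn2real (\<integral>\<^sup>+x. ennreal x ^ n \<partial>N)"
    if "AE x in N. x \<in> {0..1::real}" and [measurable_cong]: "sets N = sets borel" for N n
  proof -
    have "(\<integral>\<^sup>+x. ennreal (x ^ n) \<partial>N) = (\<integral>\<^sup>+x. ennreal x ^ n \<partial>N)"
      using that(1) by (intro nn_integral_cong_AE) (auto elim!: eventually_mono simp: ennreal_power)
    then show ?thesis
      using that(1) by (subst integral_eq_nn_integral) (auto elim!: eventually_mono)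
  qed
  have bern: "(\<integral>x. x ^ r * (1 - x) ^ s \<partial>N1) = (\<integral>x. x ^ r * (1 - x) ^ s \<partial>N2)" for r s
    by (rule power_integrals_eq_imp_Bernstein_integrals_eq[OF fin sets AE])
       (simp add: real[OF AE(1) sets(1)] real[OF AE(2) sets(2)] eq)
  note ibern = integrable_power_mult_power
  have cont: "(\<integral>x. f x \<partial>N1) = (\<integral>x. f x \<partial>N2)"
    if f: "continuous_on UNIV f" "\<And>x. \<bar>f x\<bar> \<le> 1" for f :: "real \<Rightarrow> real"
  proof -
    have [measurable]: "f \<in> borel_measurable borel" using f(1) by (rule borel_measurable_continuous_onI)
    have intf: "integrable N1 f" "integrable N2 f"
      using f(2) by (auto intro!: N1.integrable_const_bound[of _ 1] N2.integrable_const_bound[of _ 1])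
    have "\<bar>(\<integral>x. f x \<partial>N1) - (\<integral>x. f x \<partial>N2)\<bar> \<le> e * (measure N1 (space N1) + measure N2 (space N2))"
      if e: "0 < e" for e
    proof -
      obtain n where n: "\<And>x. x \<in> {0..1} \<Longrightarrow> \<bar>f x - (\<Sum>k\<le>n. f(k/n) * Bernstein n k x)\<bar> < e"
        using Bernstein_Weierstrass[OF continuous_on_subset[OF f(1) subset_UNIV] e] by blast
      define B where "B x = (\<Sum>k\<le>n. f(k/n) * Bernstein n k x)" for x
      have B_eq: "B x = (\<Sum>k\<le>n. f(k/n) * (real (n choose k) * (x ^ k * (1 - x) ^ (n - k))))" for x
        by (simp add: B_def Bernstein_def mult.assoc)
      have iB: "integrable N1 B" "integrable N2 B"
        unfolding B_eq[abs_def] using ibern[OF fin(1) sets(1) AE(1)] ibern[OF fin(2) sets(2) AE(2)]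
        by auto
      have B: "(\<integral>x. B x \<partial>N1) = (\<integral>x. B x \<partial>N2)"
        unfolding B_eq[abs_def]
        using ibern[OF fin(1) sets(1) AE(1)] ibern[OF fin(2) sets(2) AE(2)] bern by simp
      have *: "\<bar>(\<integral>x. f x \<partial>N) - (\<integral>x. B x \<partial>N)\<bar> \<le> e * measure N (space N)"
        if "finite_measure N" and [measurable_cong]: "sets N = sets borel"
          and "AE x in N. x \<in> {0..1::real}" "integrable N f" "integrable N B" for N
      proof -
        interpret finite_measure N by fact
        have "\<bar>(\<integral>x. f x - B x \<partial>N)\<bar> \<le> (\<integral>x. \<bar>f x - B x\<bar> \<partial>N)" by (rule integral_abs_bound)
        also have "\<dots> \<le> (\<integral>x. e \<partial>N)"
        proof (intro integral_mono_AE integrable_abs Bochner_Integration.integrable_diff that(4,5))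
          show "AE x in N. \<bar>f x - B x\<bar> \<le> e"
            using that(3) by eventually_elim (use n in \<open>auto simp: B_def less_imp_le\<close>)
        qed simp
        finally show ?thesis using that(4,5) by (simp add: mult.commute)
      qed
      show ?thesis
        using *[OF fin(1) sets(1) AE(1) intf(1) iB(1)] *[OF fin(2) sets(2) AE(2) intf(2) iB(2)] B
        by (simp add: distrib_left)
    qed
    note bound = this
    show ?thesis
    proof (rule ccontr)
      assume ne: "(\<integral>x. f x \<partial>N1) \<noteq> (\<integral>x. f x \<partial>N2)"
      let ?d = "\<bar>(\<integral>x. f x \<partial>N1) - (\<integral>x. f x \<partial>N2)\<bar>" and ?K = "measure N1 (space N1) + measure N2 (space N2)"
      have d: "0 < ?d" using ne by simp
      have K: "0 \<le> ?K" by simp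
      \<comment> \<open>The tolerance is chosen so that the bound says \<open>?d\<close> is less
        than itself; the summand 1 avoids division by 0 if both measures vanish.\<close>
      have "?d \<le> ?d / (2 * (?K + 1)) * ?K"
        by (rule bound) (use d K in \<open>auto intro!: divide_pos_pos add_nonneg_pos\<close>)
      also have "\<dots> = ?d * (?K / (2 * (?K + 1)))" by simp
      also have "\<dots> < ?d * 1"
        using d K by (intro mult_strict_left_mono) (auto simp: divide_less_eq add_nonneg_pos not_less)
      finally show False by simp
    qed
  qed
  show ?thesis
  proof (rule measure_eqI_lessThan)
    show "emeasure N1 {a<..} < \<infinity>" for a by (simp add: N1.emeasure_eq_measure)
    fix a
    define f where "f n x = min 1 (max 0 (real n * (x - a)))" for n x
    have f: "continuous_on UNIV (f n)" "\<bar>f n x\<bar> \<le> 1" for n x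
      unfolding f_def by (auto intro!: continuous_intros)
    have [measurable]: "f n \<in> borel_measurable borel" for n
      using f(1) by (rule borel_measurable_continuous_onI)
    have lim: "(\<lambda>n. f n x) \<longlonglongrightarrow> indicator {a<..} x" for x
    proof (cases "a < x")
      case True
      have "\<forall>\<^sub>F n in sequentially. f n x = 1"
      proof -
        obtain m where m: "1 / (x - a) < real m" using reals_Archimedean2 by blast
        have "f n x = 1" if "m \<le> n" for n
        proof -
          have "1 / (x - a) < real n" using m that by linarith
          then have "1 < real n * (x - a)" using True by (simp add: divide_less_eq)
          then show ?thesis by (simp add: f_def)
        qed
        then show ?thesis by (auto simp: eventually_sequentially)
      qed
      then show ?thesis using True by (simp add: tendsto_eventually)
    next
      case False
      then have "real n * (x - a) \<le> 0" for n by (intro mult_nonneg_nonpos) auto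
    then have "f n x = 0" for n by (simp add: f_def max_absorb1)
      then show ?thesis using False by simp
    qed
    have "(\<lambda>n. \<integral>x. f n x \<partial>N1) \<longlonglongrightarrow> (\<integral>x. indicator {a<..} x \<partial>N1)"
      using lim f(2) by (intro integral_dominated_convergence[where w="\<lambda>_. 1"]) auto
    moreover have "(\<lambda>n. \<integral>x. f n x \<partial>N2) \<longlonglongrightarrow> (\<integral>x. indicator {a<..} x \<partial>N2)"
      using lim f(2) by (intro integral_dominated_convergence[where w="\<lambda>_. 1"]) auto
    ultimately have "(\<integral>x. indicator {a<..} x \<partial>N1) = (\<integral>x. indicator {a<..} x \<partial>N2 :: real)"
      using cont[OF f] by (simp add: LIMSEQ_unique)
    then show "emeasure N1 {a<..} = emeasure N2 {a<..}"
      by (simp add: N1.emeasure_eq_measure N2.emeasure_eq_measure sets_eq_imp_space_eq[OF sets(1)] sets_eq_imp_space_eq[OF sets(2)])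
  qed auto
qed

text \<open>One coordinate at a time, the powers in the mixed moments are replaced by indicators.\<close>

lemma mixed_moments_with_indicators_eq:
  fixes N1 N2 :: "(nat \<Rightarrow> real) measure"
  assumes fin: "finite_measure N1" "finite_measure N2"
    and sets [measurable_cong, simp]: "sets N1 = sets seq_borel" "sets N2 = sets seq_borel"
    and AE: "AE x in N1. \<forall>i. x i \<in> {0..1}" "AE x in N2. \<forall>i. x i \<in> {0..1}"
    and eq: "\<And>ks. (\<integral>\<^sup>+x. (\<Prod>i\<leftarrow>ks. ennreal (x i)) \<partial>N1) = (\<integral>\<^sup>+x. (\<Prod>i\<leftarrow>ks. ennreal (x i)) \<partial>N2)"
    and J: "finite J" and A: "\<And>i. i \<in> J \<Longrightarrow> A i \<in> sets borel"
  shows "(\<integral>\<^sup>+x. (\<Prod>i\<in>J. indicator (A i) (x i)) * (\<Prod>i\<leftarrow>ks. ennreal (x i)) \<partial>N1) =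
    (\<integral>\<^sup>+x. (\<Prod>i\<in>J. indicator (A i) (x i)) * (\<Prod>i\<leftarrow>ks. ennreal (x i)) \<partial>N2)"
  using J A
proof (induction J arbitrary: ks)
  case empty
  show ?case using eq by simp
next
  case (insert k J)
  have [measurable]: "A i \<in> sets borel" if "i \<in> insert k J" for i using insert.prems that by auto
  define g where "g ks x = (\<Prod>i\<in>J. indicator (A i) (x i)) * (\<Prod>i\<leftarrow>ks. ennreal (x i))" for ks x
  have pm [measurable]: "(\<lambda>x. \<Prod>i\<leftarrow>ks. ennreal (x i)) \<in> borel_measurable seq_borel" for ks
    by (induction ks) auto
  have im: "(\<lambda>x. \<Prod>i\<in>J. indicator (A i) (x i) :: ennreal) \<in> borel_measurable seq_borel"
    using insert.hyps(1) by (intro borel_measurable_prod_ennreal) auto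
  have g [measurable]: "g ks \<in> borel_measurable seq_borel" for ks
    unfolding g_def[abs_def] using im by measurable
  have IH: "(\<integral>\<^sup>+x. g ks x \<partial>N1) = (\<integral>\<^sup>+x. g ks x \<partial>N2)" for ks
    using insert.IH insert.prems unfolding g_def by auto
  \<comment> \<open>Weighting by \<open>g ks\<close> and projecting to coordinate \<open>k\<close>
    leaves a moment problem on the unit interval. Its \<open>n\<close>-th moment only adds
    \<open>n\<close> copies of \<open>k\<close> to the list, which is why the induction hypothesis
    is needed for all lists.\<close>
  define D where "D N = distr (density N (g ks)) borel (\<lambda>x. x k)" for N
  have prod_le: "(\<Prod>i\<leftarrow>ks. ennreal (x i)) \<le> 1" if "\<forall>i. x i \<in> {0..1}" for ks x
    using that by (induction ks) (auto intro!: mult_le_one)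
  have ind_le: "(\<Prod>i\<in>J. indicator (A i) (x i) :: ennreal) \<le> 1" for x
    by (intro prod_le_1) (auto simp: indicator_def)
  have g_le: "g ks x \<le> 1" if "\<forall>i. x i \<in> {0..1}" for x
    unfolding g_def by (intro mult_le_one prod_le that ind_le) auto
  have prem: "finite_measure (D N)" "sets (D N) = sets borel" "AE x in D N. x \<in> {0..1}"
      "(\<integral>\<^sup>+x. ennreal x ^ n \<partial>D N) = (\<integral>\<^sup>+x. g (replicate n k @ ks) x \<partial>N)"
      "(\<integral>\<^sup>+x. indicator (A k) x \<partial>D N) = (\<integral>\<^sup>+x. indicator (A k) (x k) * g ks x \<partial>N)"
    if "finite_measure N" and [measurable_cong, simp]: "sets N = sets seq_borel"
      and AEN: "AE x in N. \<forall>i. x i \<in> {0..1}" for N n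
  proof -
    interpret finite_measure N by fact
    have "emeasure (D N) (space (D N)) = (\<integral>\<^sup>+x. 1 \<partial>D N)" by simp
    also have "\<dots> = (\<integral>\<^sup>+x. g ks x \<partial>N)"
      unfolding D_def by (subst nn_integral_distr, simp, simp, subst nn_integral_density) auto
    also have "\<dots> \<le> (\<integral>\<^sup>+x. 1 \<partial>N)"
      using AEN g_le by (intro nn_integral_mono_AE) (auto elim!: eventually_mono)
    also have "\<dots> < \<infinity>" by (simp add: emeasure_eq_measure)
    finally show "finite_measure (D N)" by (auto intro!: finite_measureI)
    show "sets (D N) = sets borel" by (simp add: D_def)
    show "AE x in D N. x \<in> {0..1}"
    proof -
      have "AE x in N. 0 < g ks x \<longrightarrow> x k \<in> {0..1}" using AEN by eventually_elim blast
      then have "AE x in density N (g ks). x k \<in> {0..1}" by (subst AE_density) auto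
      then show ?thesis unfolding D_def by (subst AE_distr_iff) (auto simp del: atLeastAtMost_iff)
    qed
    have "(\<integral>\<^sup>+x. ennreal x ^ n \<partial>D N) = (\<integral>\<^sup>+x. g ks x * ennreal (x k) ^ n \<partial>N)"
      by (simp add: D_def nn_integral_distr nn_integral_density)
    also have "\<dots> = (\<integral>\<^sup>+x. g (replicate n k @ ks) x \<partial>N)"
    proof (intro nn_integral_cong)
      fix x
      have "(\<Prod>i\<leftarrow>replicate n k @ ks. ennreal (x i)) = ennreal (x k) ^ n * (\<Prod>i\<leftarrow>ks. ennreal (x i))"
        by (induction n) (auto simp: mult_ac)
      then show "g ks x * ennreal (x k) ^ n = g (replicate n k @ ks) x" by (simp add: g_def mult_ac)
    qed
    finally show "(\<integral>\<^sup>+x. ennreal x ^ n \<partial>D N) = (\<integral>\<^sup>+x. g (replicate n k @ ks) x \<partial>N)" .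
    show "(\<integral>\<^sup>+x. indicator (A k) x \<partial>D N) = (\<integral>\<^sup>+x. indicator (A k) (x k) * g ks x \<partial>N)"
      by (simp add: D_def nn_integral_distr nn_integral_density mult.commute del: nn_integral_indicator)
  qed
  note p1 = prem[OF fin(1) sets(1) AE(1)] and p2 = prem[OF fin(2) sets(2) AE(2)]
  have "D N1 = D N2"
    by (rule finite_measure_eqI_moments) (use p1 p2 IH in simp_all)
  then have "(\<integral>\<^sup>+x. indicator (A k) (x k) * g ks x \<partial>N1) = (\<integral>\<^sup>+x. indicator (A k) (x k) * g ks x \<partial>N2)"
    using p1(5) p2(5) by simp
  then show ?case using insert.hyps by (simp add: g_def mult.assoc)
qed

lemma finite_measure_eqI_mixed_moments:
  fixes N1 N2 :: "(nat \<Rightarrow> real) measure"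
  assumes fin: "finite_measure N1" "finite_measure N2"
    and sets [measurable_cong, simp]: "sets N1 = sets seq_borel" "sets N2 = sets seq_borel"
    and AE: "AE x in N1. \<forall>i. x i \<in> {0..1}" "AE x in N2. \<forall>i. x i \<in> {0..1}"
    and eq: "\<And>ks. (\<integral>\<^sup>+x. (\<Prod>i\<leftarrow>ks. ennreal (x i)) \<partial>N1) = (\<integral>\<^sup>+x. (\<Prod>i\<leftarrow>ks. ennreal (x i)) \<partial>N2)"
  shows "N1 = N2"
proof (rule measure_eqI_PiM_infinite[OF sets])
  fix A :: "nat \<Rightarrow> real set" and J :: "nat set"
  assume J: "finite J" "J \<subseteq> UNIV" and A: "\<And>i. i \<in> J \<Longrightarrow> A i \<in> sets borel"
  let ?X = "prod_emb UNIV (\<lambda>_. borel) J (Pi\<^sub>E J A)"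
  have "emeasure N ?X = (\<integral>\<^sup>+x. (\<Prod>i\<in>J. indicator (A i) (x i)) * (\<Prod>i\<leftarrow>[]. ennreal (x i)) \<partial>N)"
    if [measurable_cong, simp]: "sets N = sets seq_borel" for N
  proof -
    have "?X \<in> sets seq_borel" using J A by (intro sets_PiM_I) auto
    then have "emeasure N ?X = (\<integral>\<^sup>+x. indicator ?X x \<partial>N)" by simp
    also have "indicator ?X = (\<lambda>x. \<Prod>i\<in>J. indicator (A i) (x i) :: ennreal)"
      using J by (intro ext) (auto simp: indicator_def prod_emb_def PiE_iff space_PiM split: if_splits intro!: prod_zero[symmetric])
    finally show ?thesis by simp
  qed
  then show "emeasure N1 ?X = emeasure N2 ?X"
    using mixed_moments_with_indicators_eq[OF assms J(1) A, where ks = "[]"] by simp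
qed fact

section \<open>Ranked sequences\<close>

abbreviation ennreal_seq :: "(nat \<Rightarrow> real) \<Rightarrow> nat \<Rightarrow> ennreal" where
  "ennreal_seq x \<equiv> \<lambda>i. ennreal (x i)"

section \<open>Measurability of the symmetric functions\<close>

lemma measurable_distinct_sum_aux:
  "distinct_sum ns \<in> borel_measurable (\<Pi>\<^sub>M i\<in>UNIV. borel)"
proof (induction ns)
  case (Cons n ns)
  note [measurable] = Cons
  have [measurable]: "(\<lambda>y. y(i := 0)) \<in> (\<Pi>\<^sub>M i\<in>UNIV. borel) \<rightarrow>\<^sub>M (\<Pi>\<^sub>M i\<in>UNIV. borel :: ennreal measure)" for i :: nat
    by (rule measurable_PiM_single') (auto simp: space_PiM)
  have "(\<lambda>y. \<Sum>i. y i ^ n * distinct_sum ns (y(i := 0))) \<in> borel_measurable (\<Pi>\<^sub>M i\<in>UNIV. borel)"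
    by measurable
  also have "(\<lambda>y. \<Sum>i. y i ^ n * distinct_sum ns (y(i := 0))) = distinct_sum (n # ns)"
    by (intro ext) simp
  finally show ?case .
next
  case Nil
  have "distinct_sum [] = (\<lambda>_. 1)" by (intro ext) simp
  then show ?case by simp
qed

lemma measurable_ennreal_seq:
  "ennreal_seq \<in> seq_borel \<rightarrow>\<^sub>M (\<Pi>\<^sub>M i\<in>UNIV. borel)"
  by (rule measurable_PiM_single') (auto simp: space_PiM)

lemma measurable_distinct_sum [measurable]:
  "(\<lambda>x. distinct_sum ns (ennreal_seq x)) \<in> borel_measurable seq_borel"
  by (rule measurable_compose[OF measurable_ennreal_seq measurable_distinct_sum_aux])

lemma measurable_power_sum [measurable]:
  "(\<lambda>x. power_sum m (ennreal_seq x)) \<in> borel_measurable seq_borel"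
proof -
  have [measurable]: "(\<lambda>x. ennreal (x i) ^ m) \<in> borel_measurable seq_borel" for i by measurable
  show ?thesis unfolding power_sum_def by (rule borel_measurable_suminf_order) simp
qed

lemma ranked_frequencies_nonneg: "x \<in> ranked_frequencies \<Longrightarrow> 0 \<le> x i"
  by (auto simp: ranked_frequencies_def)

lemma suminf_ennreal_seq_le_1:
  assumes "x \<in> ranked_frequencies"
  shows "(\<Sum>i. ennreal_seq x i) \<le> 1"
proof -
  have "(\<Sum>i. ennreal (x i)) = ennreal (\<Sum>i. x i)"
    using assms by (intro suminf_ennreal2) (auto simp: ranked_frequencies_def)
  then show ?thesis using assms by (simp add: ranked_frequencies_def)
qed

lemma ranked_frequencies_le_1:
  assumes "x \<in> ranked_frequencies"
  shows "x i \<le> 1"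
  using assms by (auto simp: ranked_frequencies_def dest: decseqD[of x 0 i])

lemma ranked_frequencies_shift:
  assumes "x \<in> ranked_frequencies"
  shows "(\<lambda>i. x (Suc i)) \<in> ranked_frequencies"
proof -
  have x: "decseq x" "x 0 \<le> 1" "\<And>k. 0 \<le> x k" "summable x" "(\<Sum>k. x k) \<le> 1"
    using assms by (auto simp: ranked_frequencies_def)
  have "(\<Sum>k. x (Suc k)) \<le> (\<Sum>k. x k)"
    using x suminf_split_head[OF x(4)] by simp
  then show ?thesis
    using x ranked_frequencies_le_1[OF assms, of 1]
    by (auto simp: ranked_frequencies_def decseq_Suc_iff summable_Suc_iff)
qed

text \<open>Summability and the infinite sum are traded for bounds on partial sums. In this form
  measurability is evident, and membership can be checked by finite sums.\<close>

lemma ranked_frequencies_eq: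
  "ranked_frequencies =
    {x. (\<forall>n. x (Suc n) \<le> x n) \<and> (\<forall>k. 0 \<le> x k) \<and> (\<forall>n. (\<Sum>k<n. x k) \<le> 1)}"
proof (intro equalityI subsetI)
  fix x :: "nat \<Rightarrow> real" assume "x \<in> ranked_frequencies"
  then show "x \<in> {x. (\<forall>n. x (Suc n) \<le> x n) \<and> (\<forall>k. 0 \<le> x k) \<and> (\<forall>n. (\<Sum>k<n. x k) \<le> 1)}"
    by (auto simp: ranked_frequencies_def decseq_Suc_iff intro: order_trans[OF sum_le_suminf])
next
  fix x :: "nat \<Rightarrow> real"
  assume "x \<in> {x. (\<forall>n. x (Suc n) \<le> x n) \<and> (\<forall>k. 0 \<le> x k) \<and> (\<forall>n. (\<Sum>k<n. x k) \<le> 1)}"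
  then have x: "\<And>n. x (Suc n) \<le> x n" "\<And>k. 0 \<le> x k" "\<And>n. (\<Sum>k<n. x k) \<le> 1" by auto
  have s: "summable x" by (rule summableI_nonneg_bounded[of _ 1]) (use x in auto)
  have "suminf x \<le> 1" by (rule suminf_le_const[OF s x(3)])
  then show "x \<in> ranked_frequencies"
    using x s x(3)[of 1] by (auto simp: ranked_frequencies_def decseq_Suc_iff)
qed

lemma sets_ranked_frequencies [measurable]: "ranked_frequencies \<in> sets seq_borel"
proof -
  have "{x \<in> space seq_borel. (\<forall>n. x (Suc n) \<le> x n) \<and> (\<forall>k. 0 \<le> x k) \<and> (\<forall>n. (\<Sum>k<n. x k) \<le> 1)}
    \<in> sets seq_borel"
    by (intro sets.sets_Collect_conj sets.sets_Collect_countable_All borel_measurable_le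
        borel_measurable_sum borel_measurable_const measurable_component_singleton) auto
  then show ?thesis by (simp add: ranked_frequencies_eq space_PiM)
qed

text \<open>The ranked sequence is recovered from its power sums: its first term is the limit of the
  \<open>m\<close>-th roots, and subtracting its powers gives the power sums of the shifted sequence.\<close>

definition power_sums :: "(nat \<Rightarrow> real) \<Rightarrow> nat \<Rightarrow> real" where
  "power_sums x m = enn2real (power_sum (Suc m) (ennreal_seq x))"

definition largest_term :: "(nat \<Rightarrow> real) \<Rightarrow> real" where
  "largest_term f = lim (\<lambda>m. root (Suc m) (f m))"

definition remove_largest :: "(nat \<Rightarrow> real) \<Rightarrow> nat \<Rightarrow> real" where
  "remove_largest f m = f m - largest_term f ^ Suc m"

definition from_power_sums :: "(nat \<Rightarrow> real) \<Rightarrow> nat \<Rightarrow> real" where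
  "from_power_sums f k = largest_term ((remove_largest ^^ k) f)"

lemma measurable_power_sums [measurable]: "power_sums \<in> seq_borel \<rightarrow>\<^sub>M seq_borel"
  unfolding power_sums_def[abs_def] by (rule measurable_PiM_single') (auto simp: space_PiM)

lemma measurable_largest_term [measurable]: "largest_term \<in> borel_measurable seq_borel"
  unfolding largest_term_def[abs_def] by (rule borel_measurable_lim_metric) measurable

lemma measurable_from_power_sums [measurable]: "from_power_sums \<in> seq_borel \<rightarrow>\<^sub>M seq_borel"
proof -
  have [measurable]: "remove_largest \<in> seq_borel \<rightarrow>\<^sub>M seq_borel"
    unfolding remove_largest_def[abs_def] by (rule measurable_PiM_single') (auto simp: space_PiM)
  have [measurable]: "(\<lambda>f. (remove_largest ^^ k) f) \<in> seq_borel \<rightarrow>\<^sub>M seq_borel" for k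
    by (induction k) auto
  show ?thesis
    unfolding from_power_sums_def[abs_def] by (rule measurable_PiM_single') (auto simp: space_PiM)
qed

lemma ennreal_power_sums:
  assumes "x \<in> ranked_frequencies"
  shows "ennreal (power_sums x m) = power_sum (Suc m) (ennreal_seq x)"
  using power_sum_le_1[OF suminf_ennreal_seq_le_1[OF assms], of "Suc m"]
  by (auto simp: power_sums_def intro!: ennreal_enn2real intro: le_less_trans)

lemma power_sums_nonneg: "0 \<le> power_sums x m"
  by (simp add: power_sums_def)

lemma power_sums_le_1:
  assumes "x \<in> ranked_frequencies"
  shows "power_sums x m \<le> 1"
  using power_sum_le_1[OF suminf_ennreal_seq_le_1[OF assms], of "Suc m"]
  by (simp flip: ennreal_power_sums[OF assms] add: power_sums_nonneg)

lemma power_sums_shift: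
  assumes "x \<in> ranked_frequencies"
  shows "power_sums x m = x 0 ^ Suc m + power_sums (\<lambda>i. x (Suc i)) m"
proof -
  have "ennreal (power_sums x m) = ennreal (x 0 ^ Suc m) + ennreal (power_sums (\<lambda>i. x (Suc i)) m)"
    unfolding ennreal_power_sums[OF assms] ennreal_power_sums[OF ranked_frequencies_shift[OF assms]]
    unfolding power_sum_def
    using suminf_offset[of "\<lambda>i. ennreal (x i) ^ Suc m" 1] ranked_frequencies_nonneg[OF assms]
    by (simp add: ennreal_power ennreal_mult add.commute)
  also have "\<dots> = ennreal (x 0 ^ Suc m + power_sums (\<lambda>i. x (Suc i)) m)"
    using ranked_frequencies_nonneg[OF assms, of 0]
    by (intro ennreal_plus[symmetric]) (auto simp: power_sums_nonneg)
  finally show ?thesis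
    using ranked_frequencies_nonneg[OF assms, of 0]
    by (subst (asm) ennreal_inj) (auto simp: power_sums_nonneg)
qed

text \<open>The exponent is \<open>Suc m\<close>: \<open>m\<close> factors are bounded by the
  largest term, and the remaining one is summed, to at most 1.\<close>

lemma power_sums_le_power:
  assumes "x \<in> ranked_frequencies"
  shows "power_sums x m \<le> x 0 ^ m"
proof -
  have "power_sum (Suc m) (ennreal_seq x) \<le> (\<Sum>i. ennreal (x 0) ^ m * ennreal (x i))"
    unfolding power_sum_def
  proof (intro suminf_le)
    fix i
    have "x i \<le> x 0" using assms by (auto simp: ranked_frequencies_def dest: decseqD[of x 0 i])
    then have "ennreal (x i) ^ m \<le> ennreal (x 0) ^ m"
      by (intro power_mono ennreal_leI) auto
    then show "ennreal (x i) ^ Suc m \<le> ennreal (x 0) ^ m * ennreal (x i)"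
      by (simp add: mult.commute mult_left_mono)
  qed auto
  also have "\<dots> \<le> ennreal (x 0) ^ m * 1"
    unfolding ennreal_suminf_cmult by (intro mult_left_mono suminf_ennreal_seq_le_1 assms) simp
  also have "\<dots> = ennreal (x 0 ^ m)"
    using ranked_frequencies_nonneg[OF assms] by (simp add: ennreal_power)
  finally show ?thesis
    using ranked_frequencies_nonneg[OF assms] by (simp flip: ennreal_power_sums[OF assms])
qed

lemma power_sums_sums:
  assumes x: "x \<in> ranked_frequencies"
  shows "(\<lambda>i. x i ^ Suc m) sums power_sums x m"
proof -
  have s: "summable x" "\<And>i. 0 \<le> x i" "\<And>i. x i \<le> 1"
    using x ranked_frequencies_nonneg[OF x] ranked_frequencies_le_1[OF x] by (auto simp: ranked_frequencies_def)
  have summ: "summable (\<lambda>i. x i ^ Suc m)"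
  proof (rule summable_comparison_test[OF _ s(1)])
    have "norm (x i ^ Suc m) \<le> x i" for i
      using s(2,3)[of i] power_le_one[of "x i" m] mult_left_mono[of "x i ^ m" 1 "x i"] by simp
    then show "\<exists>N. \<forall>n\<ge>N. norm (x n ^ Suc m) \<le> x n" by blast
  qed
  have "power_sum (Suc m) (ennreal_seq x) = (\<Sum>i. ennreal (x i ^ Suc m))"
    unfolding power_sum_def using s(2) by (simp only: ennreal_power)
  also have "\<dots> = ennreal (\<Sum>i. x i ^ Suc m)"
    by (rule suminf_ennreal2[OF _ summ]) (use s(2) in simp)
  finally have "power_sums x m = (\<Sum>i. x i ^ Suc m)"
    unfolding power_sums_def using s(2) suminf_nonneg[OF summ] by (simp del: power_Suc)
  then show ?thesis using summ by (simp only: summable_sums)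
qed

text \<open>This variance-like identity serves twice: its sign gives the log-convexity of the
  moments of \<open>Q\<close>, and its vanishing forces every positive frequency of \<open>P\<close>
  to equal \<open>t\<close>.\<close>

lemma power_sums_quadratic:
  assumes x: "x \<in> ranked_frequencies"
  shows "(\<lambda>i. x i * (x i - t) ^ 2) sums (power_sums x 2 - 2 * t * power_sums x 1 + t ^ 2 * power_sums x 0)"
proof -
  have "(\<lambda>i. x i ^ Suc 2 - 2 * t * x i ^ Suc 1 + t ^ 2 * x i ^ Suc 0) sums
      (power_sums x 2 - 2 * t * power_sums x 1 + t ^ 2 * power_sums x 0)"
    by (intro sums_add sums_diff sums_mult power_sums_sums[OF x])
  moreover have "x i ^ Suc 2 - 2 * t * x i ^ Suc 1 + t ^ 2 * x i ^ Suc 0 = x i * (x i - t) ^ 2" for i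
    by (simp add: power2_eq_square power3_eq_cube algebra_simps)
  ultimately show ?thesis by simp
qed

text \<open>The power sum lies between \<open>x 0 ^ Suc m\<close> and \<open>x 0 ^ m\<close>; after
  taking roots the two bounds differ by the factor \<open>root (Suc m) (1 / x 0)\<close>, which
  tends to 1.\<close>

lemma largest_term_power_sums:
  assumes "x \<in> ranked_frequencies"
  shows "largest_term (power_sums x) = x 0"
  unfolding largest_term_def
proof (rule limI)
  have x0: "0 \<le> x 0" using ranked_frequencies_nonneg[OF assms] .
  have lower: "x 0 \<le> root (Suc m) (power_sums x m)" for m
  proof -
    have "x 0 ^ Suc m \<le> power_sums x m"
      using power_sums_shift[OF assms, of m] power_sums_nonneg by (simp del: power_Suc)
    then have "root (Suc m) (x 0 ^ Suc m) \<le> root (Suc m) (power_sums x m)"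
      by (rule real_root_le_mono[rotated]) simp
    then show ?thesis using x0 by (simp add: real_root_power_cancel del: power_Suc)
  qed
  show "(\<lambda>m. root (Suc m) (power_sums x m)) \<longlonglongrightarrow> x 0"
  proof (cases "x 0 = 0")
    case True
    \<comment> \<open>At index 0 the bound is \<open>0 ^ 0 = 1\<close> and says nothing, so the
      sequence is shifted by one before the limit is taken.\<close>
    have "power_sums x (Suc m) = 0" for m
      using power_sums_le_power[OF assms, of "Suc m"] True power_sums_nonneg[of x "Suc m"] by simp
    then have "(\<lambda>m. root (Suc (Suc m)) (power_sums x (Suc m))) \<longlonglongrightarrow> x 0" using True by simp
    then show ?thesis by (subst (asm) filterlim_sequentially_Suc)
  next
    case False
    with x0 have x0: "0 < x 0" by simp
    have upper: "root (Suc m) (power_sums x m) \<le> x 0 * root (Suc m) (1 / x 0)" for m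
    proof -
      have "root (Suc m) (power_sums x m) \<le> root (Suc m) (x 0 ^ Suc m * (1 / x 0))"
        using power_sums_le_power[OF assms, of m] x0 by (intro real_root_le_mono) auto
      also have "\<dots> = x 0 * root (Suc m) (1 / x 0)"
        using x0 by (simp add: real_root_divide real_root_power_cancel del: power_Suc)
      finally show ?thesis .
    qed
    have "(\<lambda>m. root (Suc m) (1 / x 0)) \<longlonglongrightarrow> 1"
      using x0 LIMSEQ_root_const[of "1 / x 0"] by (subst filterlim_sequentially_Suc) simp
    from tendsto_mult[OF tendsto_const this, of "x 0"]
    have "(\<lambda>m. x 0 * root (Suc m) (1 / x 0)) \<longlonglongrightarrow> x 0" by simp
    from tendsto_sandwich[OF always_eventually always_eventually tendsto_const this,
      of "\<lambda>m. root (Suc m) (power_sums x m)"]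
    show ?thesis using lower upper by simp
  qed
qed

lemma from_power_sums_power_sums:
  assumes "x \<in> ranked_frequencies"
  shows "from_power_sums (power_sums x) = x"
proof
  fix k
  have "(remove_largest ^^ k) (power_sums x) = power_sums (\<lambda>i. x (i + k)) \<and> (\<lambda>i. x (i + k)) \<in> ranked_frequencies"
  proof (induction k)
    case (Suc k)
    let ?y = "\<lambda>i. x (i + k)"
    have "remove_largest (power_sums ?y) = power_sums (\<lambda>i. ?y (Suc i))"
      using Suc by (intro ext) (simp add: remove_largest_def largest_term_power_sums power_sums_shift[of ?y] del: power_Suc)
    then show ?case using Suc ranked_frequencies_shift[of ?y] by simp
  qed (use assms in simp)
  then show "from_power_sums (power_sums x) k = x k"
    by (simp add: from_power_sums_def largest_term_power_sums)
qed

text \<open>Each power sum is absorbed into the distinct sum by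
  \<open>power_sum_mult_distinct_sum\<close>. The additional factor \<open>distinct_sum ns\<close>
  is what lets the induction on \<open>ms\<close> close.\<close>

lemma nn_integral_prod_power_sums_eq:
  fixes N1 N2 :: "(nat \<Rightarrow> real) measure"
  assumes sets [measurable_cong]: "sets N1 = sets seq_borel" "sets N2 = sets seq_borel"
    and eq: "\<And>ns. \<forall>n\<in>set ns. 0 < n \<Longrightarrow>
      (\<integral>\<^sup>+x. distinct_sum ns (ennreal_seq x) \<partial>N1) = (\<integral>\<^sup>+x. distinct_sum ns (ennreal_seq x) \<partial>N2)"
    and ns: "\<forall>n\<in>set ns. 0 < n"
  shows "(\<integral>\<^sup>+x. (\<Prod>m\<leftarrow>ms. power_sum (Suc m) (ennreal_seq x)) * distinct_sum ns (ennreal_seq x) \<partial>N1) =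
    (\<integral>\<^sup>+x. (\<Prod>m\<leftarrow>ms. power_sum (Suc m) (ennreal_seq x)) * distinct_sum ns (ennreal_seq x) \<partial>N2)"
  using ns
proof (induction ms arbitrary: ns)
  case (Cons m ms)
  let ?P = "\<lambda>x. \<Prod>m\<leftarrow>ms. power_sum (Suc m) (ennreal_seq x)"
  have [measurable]: "?P \<in> borel_measurable seq_borel" by (induction ms) auto
  have upd: "\<forall>k\<in>set (ns[j := ns ! j + Suc m]). 0 < k" for j
    using Cons.prems set_update_subset_insert[of ns j "ns ! j + Suc m"] by auto
  have split: "(\<integral>\<^sup>+x. (\<Prod>m\<leftarrow>m # ms. power_sum (Suc m) (ennreal_seq x)) * distinct_sum ns (ennreal_seq x) \<partial>N) =
    (\<integral>\<^sup>+x. ?P x * distinct_sum (Suc m # ns) (ennreal_seq x) \<partial>N) +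
    (\<Sum>j<length ns. \<integral>\<^sup>+x. ?P x * distinct_sum (ns[j := ns ! j + Suc m]) (ennreal_seq x) \<partial>N)"
    if [measurable_cong]: "sets N = sets seq_borel" for N
  proof -
    have "(\<Prod>m\<leftarrow>m # ms. power_sum (Suc m) (ennreal_seq x)) * distinct_sum ns (ennreal_seq x) =
      ?P x * distinct_sum (Suc m # ns) (ennreal_seq x) +
      (\<Sum>j<length ns. ?P x * distinct_sum (ns[j := ns ! j + Suc m]) (ennreal_seq x))" for x
    proof -
      have "(\<Prod>m\<leftarrow>m # ms. power_sum (Suc m) (ennreal_seq x)) * distinct_sum ns (ennreal_seq x) =
        ?P x * (power_sum (Suc m) (ennreal_seq x) * distinct_sum ns (ennreal_seq x))"
        by (simp add: mult_ac)
      then show ?thesis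
        unfolding power_sum_mult_distinct_sum[OF zero_less_Suc Cons.prems]
        by (simp add: distrib_left sum_distrib_left del: distinct_sum.simps)
    qed
    then have "(\<integral>\<^sup>+x. (\<Prod>m\<leftarrow>m # ms. power_sum (Suc m) (ennreal_seq x)) * distinct_sum ns (ennreal_seq x) \<partial>N) =
      (\<integral>\<^sup>+x. ?P x * distinct_sum (Suc m # ns) (ennreal_seq x) +
      (\<Sum>j<length ns. ?P x * distinct_sum (ns[j := ns ! j + Suc m]) (ennreal_seq x)) \<partial>N)"
      by (intro nn_integral_cong)
    also have "\<dots> = (\<integral>\<^sup>+x. ?P x * distinct_sum (Suc m # ns) (ennreal_seq x) \<partial>N) +
      (\<integral>\<^sup>+x. (\<Sum>j<length ns. ?P x * distinct_sum (ns[j := ns ! j + Suc m]) (ennreal_seq x)) \<partial>N)"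
      by (rule nn_integral_add) measurable
    also have "(\<integral>\<^sup>+x. (\<Sum>j<length ns. ?P x * distinct_sum (ns[j := ns ! j + Suc m]) (ennreal_seq x)) \<partial>N) =
      (\<Sum>j<length ns. \<integral>\<^sup>+x. ?P x * distinct_sum (ns[j := ns ! j + Suc m]) (ennreal_seq x) \<partial>N)"
      by (rule nn_integral_sum) measurable
    finally show ?thesis .
  qed
  show ?case
    unfolding split[OF sets(1)] split[OF sets(2)]
    using Cons.prems upd by (intro arg_cong2[of _ _ _ _ "(+)"] sum.cong Cons.IH) auto
qed (use eq in simp)

text \<open>The power sums map ranked sequences into the unit cube, where mixed moments determine a
  finite measure; these mixed moments are expectations of products of power sums. The measurable
  left inverse \<open>from_power_sums\<close> carries the equality back.\<close>

lemma ranked_measure_eqI: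
  fixes N1 N2 :: "(nat \<Rightarrow> real) measure"
  assumes fin: "finite_measure N1" "finite_measure N2"
    and sets [measurable_cong, simp]: "sets N1 = sets seq_borel" "sets N2 = sets seq_borel"
    and AE: "AE x in N1. x \<in> ranked_frequencies" "AE x in N2. x \<in> ranked_frequencies"
    and eq: "\<And>ns. \<forall>n\<in>set ns. 0 < n \<Longrightarrow>
      (\<integral>\<^sup>+x. distinct_sum ns (ennreal_seq x) \<partial>N1) = (\<integral>\<^sup>+x. distinct_sum ns (ennreal_seq x) \<partial>N2)"
  shows "N1 = N2"
proof -
  have *: "finite_measure (distr N seq_borel power_sums)"
    "AE f in distr N seq_borel power_sums. \<forall>i. f i \<in> {0..1}"
    "(\<integral>\<^sup>+f. (\<Prod>i\<leftarrow>ks. ennreal (f i)) \<partial>distr N seq_borel power_sums) =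
      (\<integral>\<^sup>+x. (\<Prod>m\<leftarrow>ks. power_sum (Suc m) (ennreal_seq x)) * distinct_sum [] (ennreal_seq x) \<partial>N)"
    "distr (distr N seq_borel power_sums) seq_borel from_power_sums = N"
    if "finite_measure N" and [measurable_cong]: "sets N = sets seq_borel"
      and AE: "AE x in N. x \<in> ranked_frequencies" for N ks
  proof -
    interpret finite_measure N by fact
    show "finite_measure (distr N seq_borel power_sums)" by (rule finite_measure_distr) simp
    show "AE f in distr N seq_borel power_sums. \<forall>i. f i \<in> {0..1}"
    proof (subst AE_distr_iff)
      show "AE x in N. \<forall>i. power_sums x i \<in> {0..1}"
        using AE by eventually_elim (auto simp: power_sums_nonneg power_sums_le_1)
    qed (simp_all del: atLeastAtMost_iff)
    have [measurable]: "(\<lambda>f. \<Prod>i\<leftarrow>ks. ennreal (f i)) \<in> borel_measurable seq_borel"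
      by (induction ks) auto
    have "(\<integral>\<^sup>+f. (\<Prod>i\<leftarrow>ks. ennreal (f i)) \<partial>distr N seq_borel power_sums) =
      (\<integral>\<^sup>+x. (\<Prod>i\<leftarrow>ks. ennreal (power_sums x i)) \<partial>N)" by (simp add: nn_integral_distr)
    also have "\<dots> = (\<integral>\<^sup>+x. (\<Prod>m\<leftarrow>ks. power_sum (Suc m) (ennreal_seq x)) * distinct_sum [] (ennreal_seq x) \<partial>N)"
    proof (rule nn_integral_cong_AE)
      show "AE x in N. (\<Prod>i\<leftarrow>ks. ennreal (power_sums x i)) =
          (\<Prod>m\<leftarrow>ks. power_sum (Suc m) (ennreal_seq x)) * distinct_sum [] (ennreal_seq x)"
        using AE by eventually_elim (simp add: ennreal_power_sums)
    qed
    finally show "(\<integral>\<^sup>+f. (\<Prod>i\<leftarrow>ks. ennreal (f i)) \<partial>distr N seq_borel power_sums) =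
      (\<integral>\<^sup>+x. (\<Prod>m\<leftarrow>ks. power_sum (Suc m) (ennreal_seq x)) * distinct_sum [] (ennreal_seq x) \<partial>N)" .
    have "distr (distr N seq_borel power_sums) seq_borel from_power_sums = distr N seq_borel (\<lambda>x. x)"
      using AE by (subst distr_distr, simp, simp, intro distr_cong_AE)
        (auto elim!: eventually_mono simp: from_power_sums_power_sums)
    then show "distr (distr N seq_borel power_sums) seq_borel from_power_sums = N"
      by (simp add: distr_id2 that(2))
  qed
  have "distr N1 seq_borel power_sums = distr N2 seq_borel power_sums"
  proof (rule finite_measure_eqI_mixed_moments)
    note N1 = *[OF fin(1) sets(1) AE(1)] and N2 = *[OF fin(2) sets(2) AE(2)]
    show "finite_measure (distr N1 seq_borel power_sums)" "finite_measure (distr N2 seq_borel power_sums)"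
      using N1(1) N2(1) .
    show "AE f in distr N1 seq_borel power_sums. \<forall>i. f i \<in> {0..1}"
      "AE f in distr N2 seq_borel power_sums. \<forall>i. f i \<in> {0..1}"
      using N1(2) N2(2) .
    show "(\<integral>\<^sup>+f. (\<Prod>i\<leftarrow>ks. ennreal (f i)) \<partial>distr N1 seq_borel power_sums) =
        (\<integral>\<^sup>+f. (\<Prod>i\<leftarrow>ks. ennreal (f i)) \<partial>distr N2 seq_borel power_sums)" for ks
      unfolding N1(3) N2(3) by (rule nn_integral_prod_power_sums_eq[OF sets eq]) auto
  qed (rule sets_distr)+
  then show ?thesis
    using *(4)[OF fin(1) sets(1) AE(1)] *(4)[OF fin(2) sets(2) AE(2)] by metis
qed

section \<open>Moments of the Poisson--Dirichlet distribution\<close>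

text \<open>Since \<open>1 - t \<le> exp (- t)\<close>, the product is at most
  \<open>exp (- (d * harm n))\<close>, and the harmonic series diverges.\<close>

lemma prod_tendsto_0_if_harmonic_gap:
  fixes f :: "nat \<Rightarrow> real"
  assumes "0 < d" and f: "\<And>i. 0 \<le> f i" "\<And>i. f i \<le> 1 - d / (real i + 1)"
  shows "(\<lambda>n. \<Prod>i<n. f i) \<longlonglongrightarrow> 0"
proof -
  have le: "(\<Prod>i<n. f i) \<le> exp (- (d * harm n))" for n
  proof -
    have "(\<Prod>i<n. f i) \<le> (\<Prod>i<n. exp (- (d / (real i + 1))))"
      using f exp_ge_add_one_self by (intro prod_mono) (smt (verit, best))
    also have "\<dots> = exp (\<Sum>i<n. - (d * (1 / real (Suc i))))"
      by (simp add: exp_sum add.commute)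
    also have "(\<Sum>i<n. - (d * (1 / real (Suc i)))) = - (d * harm n)"
      by (simp add: sum_negf harm_altdef sum_distrib_left inverse_eq_divide)
    finally show ?thesis .
  qed
  have "filterlim (\<lambda>n. - (d * harm n :: real)) at_bot sequentially"
    unfolding filterlim_uminus_at_bot minus_minus
    by (rule filterlim_tendsto_pos_mult_at_top[OF tendsto_const assms(1) harm_at_top])
  then have "(\<lambda>n. exp (- (d * harm n :: real))) \<longlonglongrightarrow> 0"
    by (rule filterlim_compose[OF exp_at_bot])
  then show ?thesis
    by (rule tendsto_sandwich[OF always_eventually always_eventually tendsto_const, rotated 2])
       (use le f in \<open>auto intro: prod_nonneg\<close>)
qed

text \<open>\<open>beta_moment \<alpha> \<theta> r s\<close> is the expectation of \<open>W ^ r * (1 - W) ^ s\<close> for the first stick \<open>W\<close>,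
  and \<open>PD_moment\<close> is the Ewens--Pitman sampling formula.\<close>

definition beta_moment :: "real \<Rightarrow> real \<Rightarrow> nat \<Rightarrow> nat \<Rightarrow> real" where
  "beta_moment \<alpha> \<theta> r s =
     pochhammer (1 - \<alpha>) r * pochhammer (\<theta> + \<alpha>) s / pochhammer (1 + \<theta>) (r + s)"

definition PD_moment :: "real \<Rightarrow> real \<Rightarrow> nat list \<Rightarrow> real" where
  "PD_moment \<alpha> \<theta> ns =
     (if ns = [] then 1
      else (\<Prod>l=1..<length ns. \<theta> + real l * \<alpha>) * (\<Prod>n\<leftarrow>ns. pochhammer (1 - \<alpha>) (n - 1))
        / pochhammer (1 + \<theta>) (sum_list ns - 1))"

section \<open>Algebra of the Ewens--Pitman formula\<close>

lemma PD_moment_Nil [simp]: "PD_moment \<alpha> \<theta> [] = 1"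
  by (simp add: PD_moment_def)

text \<open>The formula has the factorized shape that independence demands: the factor for
  \<open>l = 1\<close> completes \<open>pochhammer (\<theta> + \<alpha>)\<close>, and the remaining
  factors are those of the parameter \<open>\<theta> + \<alpha>\<close>.\<close>

lemma PD_moment_Cons:
  assumes "0 < n" "\<forall>k\<in>set ns. 0 < k" "- 1 < \<theta>" "- 1 < \<theta> + \<alpha>"
  shows "PD_moment \<alpha> \<theta> (n # ns) =
    beta_moment \<alpha> \<theta> (n - 1) (sum_list ns) * PD_moment \<alpha> (\<theta> + \<alpha>) ns"
proof (cases "ns = []")
  case False
  have pos: "0 < sum_list ns" using False assms(2) by (cases ns) auto
  let ?k = "length ns" and ?s = "sum_list ns"
  have "0 < ?k" using False by simp
  have "(\<Prod>l=1..<Suc ?k. \<theta> + real l * \<alpha>) =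
      (\<theta> + real 1 * \<alpha>) * (\<Prod>l=Suc 1..<Suc ?k. \<theta> + real l * \<alpha>)"
    using \<open>0 < ?k\<close> by (intro prod.atLeast_Suc_lessThan) simp
  also have "(\<Prod>l=Suc 1..<Suc ?k. \<theta> + real l * \<alpha>) = (\<Prod>l=1..<?k. \<theta> + real (Suc l) * \<alpha>)"
    by (rule prod.shift_bounds_Suc_ivl)
  finally have "(\<Prod>l=1..<Suc ?k. \<theta> + real l * \<alpha>) =
      (\<theta> + \<alpha>) * (\<Prod>l=1..<?k. \<theta> + real (Suc l) * \<alpha>)" by simp
  then have 1: "(\<Prod>l=1..<Suc ?k. \<theta> + real l * \<alpha>) = (\<theta> + \<alpha>) * (\<Prod>l=1..<?k. \<theta> + \<alpha> + real l * \<alpha>)"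
    by (simp add: algebra_simps)
  have 2: "pochhammer (\<theta> + \<alpha>) ?s = (\<theta> + \<alpha>) * pochhammer (1 + (\<theta> + \<alpha>)) (?s - 1)"
    using pos pochhammer_rec[of "\<theta> + \<alpha>" "?s - 1"] by (simp add: add_ac)
  have 3: "pochhammer (1 + (\<theta> + \<alpha>)) (?s - 1) > 0" "pochhammer (1 + \<theta>) (n + ?s - 1) > 0"
    using assms by (auto intro!: pochhammer_pos)
  have 4: "n - 1 + ?s = n + ?s - 1" using assms by simp
  show ?thesis
    using 3 False unfolding PD_moment_def beta_moment_def 2 4 by (simp add: 1[unfolded One_nat_def] del: prod.op_ivl_Suc)
qed (simp add: PD_moment_def beta_moment_def)

text \<open>Prediction rule of the Chinese restaurant process: an existing block of size
  \<open>n\<close> receives the next element.\<close>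

lemma PD_moment_Suc:
  assumes "0 < n" "- 1 < \<theta>"
  shows "PD_moment \<alpha> \<theta> (Suc n # ns) =
    PD_moment \<alpha> \<theta> (n # ns) * (real n - \<alpha>) / (real (n + sum_list ns) + \<theta>)"
proof -
  have "pochhammer (1 - \<alpha>) n = pochhammer (1 - \<alpha>) (n - 1) * (real n - \<alpha>)"
    using assms(1) pochhammer_Suc[of "1 - \<alpha>" "n - 1"] by (simp add: of_nat_diff)
  moreover have "pochhammer (1 + \<theta>) (n + sum_list ns) =
      pochhammer (1 + \<theta>) (n + sum_list ns - 1) * (real (n + sum_list ns) + \<theta>)"
    using assms(1) pochhammer_Suc[of "1 + \<theta>" "n + sum_list ns - 1"] by (simp add: of_nat_diff add_ac)
  ultimately show ?thesis by (simp add: PD_moment_def)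
qed

text \<open>The companion prediction rule: the next element opens a new block.\<close>

lemma PD_moment_Cons_1:
  assumes "ns \<noteq> []" "\<forall>n\<in>set ns. 0 < n" "- 1 < \<theta>"
  shows "PD_moment \<alpha> \<theta> (1 # ns) =
    PD_moment \<alpha> \<theta> ns * (\<theta> + real (length ns) * \<alpha>) / (real (sum_list ns) + \<theta>)"
proof -
  have "0 < sum_list ns" using assms by (cases ns) auto
  then have "pochhammer (1 + \<theta>) (sum_list ns) =
      pochhammer (1 + \<theta>) (sum_list ns - 1) * (real (sum_list ns) + \<theta>)"
    using pochhammer_Suc[of "1 + \<theta>" "sum_list ns - 1"] by (simp add: of_nat_diff add_ac)
  then show ?thesis using assms
    by (simp add: PD_moment_def prod.atLeastLessThan_Suc Suc_le_eq)
qed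

lemma remove_nth_props:
  assumes "j < length ns"
  shows "sum_list (remove_nth j ns) = sum_list ns - ns ! j" "ns ! j \<le> sum_list ns"
    "length (remove_nth j ns) = length ns - 1" "set (remove_nth j ns) \<subseteq> set ns"
    "PD_moment \<alpha> \<theta> (ns ! j # remove_nth j ns) = PD_moment \<alpha> \<theta> ns"
proof -
  have "sum_list ns = sum_list (take j ns @ ns ! j # drop (Suc j) ns)"
    using id_take_nth_drop[OF assms] by simp
  then have s: "sum_list ns = sum_list (remove_nth j ns) + ns ! j" by (simp add: remove_nth_def)
  then show "sum_list (remove_nth j ns) = sum_list ns - ns ! j" "ns ! j \<le> sum_list ns" by auto
  show l: "length (remove_nth j ns) = length ns - 1" using assms by (simp add: remove_nth_def)
  show "set (remove_nth j ns) \<subseteq> set ns"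
    by (auto simp: remove_nth_def dest: in_set_takeD in_set_dropD)
  have "(\<Prod>n\<leftarrow>ns. f n) = (\<Prod>n\<leftarrow>take j ns @ ns ! j # drop (Suc j) ns. f n)" for f :: "nat \<Rightarrow> real"
    using id_take_nth_drop[OF assms] by simp
  then have "(\<Prod>n\<leftarrow>ns. f n) = f (ns ! j) * (\<Prod>n\<leftarrow>remove_nth j ns. f n)" for f :: "nat \<Rightarrow> real"
    by (simp add: remove_nth_def mult_ac)
  then have p: "(\<Prod>n\<leftarrow>ns ! j # remove_nth j ns. f n) = (\<Prod>n\<leftarrow>ns. f n)" for f :: "nat \<Rightarrow> real"
    by simp
  have "length (ns ! j # remove_nth j ns) = length ns" "sum_list (ns ! j # remove_nth j ns) = sum_list ns"
    "ns \<noteq> []" using s l assms by auto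
  then show "PD_moment \<alpha> \<theta> (ns ! j # remove_nth j ns) = PD_moment \<alpha> \<theta> ns"
    by (simp only: PD_moment_def p list.distinct if_False)
qed

text \<open>The first stick either is not picked at all or is picked as the \<open>j\<close>-th of the distinct terms.\<close>

lemma PD_moment_split:
  assumes "\<forall>n\<in>set ns. 0 < n" "ns \<noteq> []" "\<alpha> < 1" "0 \<le> \<theta> + \<alpha>"
  shows "PD_moment \<alpha> \<theta> ns = beta_moment \<alpha> \<theta> 0 (sum_list ns) * PD_moment \<alpha> (\<theta> + \<alpha>) ns +
    (\<Sum>j<length ns. beta_moment \<alpha> \<theta> (ns ! j) (sum_list ns - ns ! j) *
      PD_moment \<alpha> (\<theta> + \<alpha>) (remove_nth j ns))"
proof -
  let ?N = "sum_list ns" and ?F = "PD_moment \<alpha> \<theta> ns"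
  have \<theta>: "- 1 < \<theta>" "- 1 < \<theta> + \<alpha>" using assms by auto
  have "0 < ?N" using assms by (cases ns) auto
  then have N: "0 < real ?N + \<theta>" using \<theta> by simp
  have "beta_moment \<alpha> \<theta> (ns ! j) (?N - ns ! j) * PD_moment \<alpha> (\<theta> + \<alpha>) (remove_nth j ns) =
      ?F * (real (ns ! j) - \<alpha>) / (real ?N + \<theta>)" if j: "j < length ns" for j
  proof -
    have pos: "0 < ns ! j" using assms(1) j by simp
    have "PD_moment \<alpha> \<theta> (Suc (ns ! j) # remove_nth j ns) =
        ?F * (real (ns ! j) - \<alpha>) / (real ?N + \<theta>)"
      using remove_nth_props[OF j] pos \<theta> by (simp add: PD_moment_Suc of_nat_diff)
    moreover have "\<forall>k\<in>set (remove_nth j ns). 0 < k" using assms(1) remove_nth_props(4)[OF j] by blast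
    ultimately show ?thesis
      using PD_moment_Cons[of "Suc (ns ! j)" "remove_nth j ns" \<theta> \<alpha>] \<theta> remove_nth_props(1)[OF j]
      by simp
  qed
  then have "(\<Sum>j<length ns. beta_moment \<alpha> \<theta> (ns ! j) (?N - ns ! j) *
      PD_moment \<alpha> (\<theta> + \<alpha>) (remove_nth j ns)) =
    (\<Sum>j<length ns. ?F * (real (ns ! j) - \<alpha>) / (real ?N + \<theta>))" by simp
  also have "\<dots> = ?F * (\<Sum>j<length ns. real (ns ! j) - \<alpha>) / (real ?N + \<theta>)"
    by (simp add: sum_divide_distrib sum_distrib_left)
  also have "(\<Sum>j<length ns. real (ns ! j) - \<alpha>) = real ?N - real (length ns) * \<alpha>"
    by (simp add: sum_subtractf sum_list_sum_nth atLeast0LessThan)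
  finally have "(\<Sum>j<length ns. beta_moment \<alpha> \<theta> (ns ! j) (?N - ns ! j) *
      PD_moment \<alpha> (\<theta> + \<alpha>) (remove_nth j ns)) =
      ?F * (real ?N - real (length ns) * \<alpha>) / (real ?N + \<theta>)" .
  moreover have "beta_moment \<alpha> \<theta> 0 ?N * PD_moment \<alpha> (\<theta> + \<alpha>) ns =
      ?F * (\<theta> + real (length ns) * \<alpha>) / (real ?N + \<theta>)"
    using PD_moment_Cons[of 1 ns \<theta> \<alpha>] PD_moment_Cons_1[of ns \<theta> \<alpha>] assms \<theta> by simp
  ultimately have "beta_moment \<alpha> \<theta> 0 ?N * PD_moment \<alpha> (\<theta> + \<alpha>) ns +
    (\<Sum>j<length ns. beta_moment \<alpha> \<theta> (ns ! j) (?N - ns ! j) *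
      PD_moment \<alpha> (\<theta> + \<alpha>) (remove_nth j ns)) = ?F * (real ?N + \<theta>) / (real ?N + \<theta>)"
    by (simp add: add_divide_distrib[symmetric] algebra_simps)
  then show ?thesis using N by simp
qed

text \<open>Separates the first stick from the others. The factors are not identically distributed,
  so the tail is the product over the shifted family; equality is tested on cylinders.\<close>

lemma PiM_UNIV_nat_split:
  fixes N :: "nat \<Rightarrow> 'b measure"
  assumes N: "\<And>i. prob_space (N i)"
  shows "distr (N 0 \<Otimes>\<^sub>M PiM UNIV (\<lambda>i. N (Suc i))) (PiM UNIV N) (\<lambda>(s, \<omega>). case_nat s \<omega>) = PiM UNIV N"
    (is "?D = _")
proof -
  interpret P: product_prob_space N UNIV by (rule product_prob_spaceI) (rule N)
  interpret S: prob_space "PiM UNIV (\<lambda>i. N (Suc i))" by (intro prob_space_PiM N)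
  let ?S = "PiM UNIV (\<lambda>i. N (Suc i))" and ?f = "\<lambda>(s, \<omega>). case_nat s \<omega>"
  have f [measurable]: "?f \<in> N 0 \<Otimes>\<^sub>M ?S \<rightarrow>\<^sub>M PiM UNIV N"
  proof (rule measurable_PiM_single')
    fix i
    show "(\<lambda>\<omega>. (case \<omega> of (s, \<omega>) \<Rightarrow> case_nat s \<omega>) i) \<in> N 0 \<Otimes>\<^sub>M ?S \<rightarrow>\<^sub>M N i"
      by (cases i) (auto simp: split_beta')
  qed (auto simp: space_pair_measure space_PiM PiE_iff split: nat.split)
  show ?thesis
  proof (rule P.PiM_eq)
    fix J :: "nat set" and E
    assume J: "finite J" "J \<subseteq> UNIV" "\<And>j. j \<in> J \<Longrightarrow> E j \<in> sets (N j)"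
    let ?X = "prod_emb UNIV N J (\<Pi>\<^sub>E j\<in>J. E j)"
    have "\<And>j x. j \<in> J \<Longrightarrow> x \<in> E j \<Longrightarrow> x \<in> space (N j)"
      using J(3)[THEN sets.sets_into_space] by auto
    with J have "?f -` ?X \<inter> space (N 0 \<Otimes>\<^sub>M ?S) = (if 0 \<in> J then E 0 else space (N 0)) \<times>
      (prod_emb UNIV (\<lambda>i. N (Suc i)) (Suc -` J) (\<Pi>\<^sub>E j\<in>Suc -` J. E (Suc j)))" (is "_ = ?E \<times> ?F")
      by (auto simp: space_pair_measure space_PiM PiE_iff prod_emb_def all_conj_distrib
        split: nat.split nat.split_asm)
    then have "emeasure ?D ?X = emeasure (N 0 \<Otimes>\<^sub>M ?S) (?E \<times> ?F)"
      using J by (subst emeasure_distr) (auto intro!: sets_PiM_I)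
    also have "\<dots> = emeasure (N 0) ?E * emeasure ?S ?F"
      using J by (intro S.emeasure_pair_measure_Times) (auto intro!: sets_PiM_I finite_vimageI)
    also have "emeasure ?S ?F = (\<Prod>j\<in>Suc -` J. emeasure (N (Suc j)) (E (Suc j)))"
      using J N by (intro emeasure_PiM_emb) (auto simp: finite_vimageI)
    also have "\<dots> = (\<Prod>j\<in>J - {0}. emeasure (N j) (E j))"
      by (rule prod.reindex_bij_witness[of _ "\<lambda>j. j - 1" Suc]) auto
    also have "emeasure (N 0) ?E * (\<Prod>j\<in>J - {0}. emeasure (N j) (E j)) = (\<Prod>j\<in>J. emeasure (N j) (E j))"
      using prob_space.emeasure_space_1[OF N] by (auto simp: prod.remove J)
    finally show "emeasure ?D ?X = (\<Prod>j\<in>J. emeasure (N j) (E j))" .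
  qed simp
qed

text \<open>Power sums are expressed through the numbers of terms above a level, and these are what
  the decreasing rearrangement preserves.\<close>

lemma power_sum_layer_cake:
  assumes x: "\<And>i. 0 \<le> x i" "x \<longlonglongrightarrow> 0" and m: "0 < m"
  shows "power_sum m (ennreal_seq x) =
    (\<integral>\<^sup>+t. of_nat (card {i. root m t \<le> x i}) * indicator {0<..} t \<partial>lborel)"
proof -
  have fin: "finite {i. t \<le> x i}" if "0 < t" for t
  proof -
    have "\<forall>\<^sub>F i in sequentially. x i < t" using order_tendstoD(2)[OF x(2) that] .
    then obtain n where "\<And>i. i \<ge> n \<Longrightarrow> x i < t" by (auto simp: eventually_sequentially)
    then have "{i. t \<le> x i} \<subseteq> {..<n}" by (metis (mono_tags) lessThan_iff linorder_not_le mem_Collect_eq subsetI)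
    then show ?thesis using finite_subset by blast
  qed
  have ind: "indicator {0<..x i ^ m} t = indicator {i. root m t \<le> x i} i * (indicator {0<..} t :: ennreal)" for i t
  proof -
    have "t \<le> x i ^ m \<longleftrightarrow> root m t \<le> x i" if "0 < t"
    proof
      assume "t \<le> x i ^ m"
      then have "root m t \<le> root m (x i ^ m)" using m by simp
      then show "root m t \<le> x i" using m x(1) by (simp add: real_root_power_cancel)
    next
      assume "root m t \<le> x i"
      then have "root m t ^ m \<le> x i ^ m" using that m by (intro power_mono) auto
      then show "t \<le> x i ^ m" using that m by simp
    qed
    then show ?thesis by (auto simp: indicator_def)
  qed
  have "power_sum m (ennreal_seq x) = (\<Sum>i. \<integral>\<^sup>+t. indicator {0<..x i ^ m} t \<partial>lborel)"
    unfolding power_sum_def using x(1) by (simp add: ennreal_power)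
  also have "\<dots> = (\<integral>\<^sup>+t. (\<Sum>i. indicator {0<..x i ^ m} t) \<partial>lborel)"
    by (rule nn_integral_suminf[symmetric]) simp
  also have "\<dots> = (\<integral>\<^sup>+t. of_nat (card {i. root m t \<le> x i}) * indicator {0<..} t \<partial>lborel)"
  proof (rule nn_integral_cong)
    fix t :: real
    show "(\<Sum>i. indicator {0<..x i ^ m} t) = of_nat (card {i. root m t \<le> x i}) * (indicator {0<..} t :: ennreal)"
    proof (cases "0 < t")
      case True
      then have "finite {i. root m t \<le> x i}" using fin m by simp
      moreover from this have "(\<Sum>i. indicator {i. root m t \<le> x i} i :: ennreal) = (\<Sum>i\<in>{i. root m t \<le> x i}. 1)"
        by (subst suminf_finite[of "{i. root m t \<le> x i}"]) (auto intro!: sum.cong)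
      ultimately show ?thesis unfolding ind using True by simp
    qed (simp add: ind)
  qed
  finally show ?thesis .
qed

lemma decreasing_rearrangement_ranked:
  assumes x: "\<And>i. 0 \<le> x i" and sum: "(\<Sum>i. ennreal_seq x i) \<le> 1"
  shows "decreasing_rearrangement x \<in> ranked_frequencies"
    and "0 < m \<Longrightarrow> power_sum m (ennreal_seq (decreasing_rearrangement x)) = power_sum m (ennreal_seq x)"
proof -
  have summ: "summable y" "suminf y \<le> 1" if "\<And>i. 0 \<le> y i" "(\<Sum>i. ennreal_seq y i) \<le> 1" for y
  proof -
    show s: "summable y"
      using that by (intro summable_suminf_not_top) (auto simp: top_unique)
    show "suminf y \<le> 1" using suminf_ennreal2[OF that(1) s] that(2) by (simp add: suminf_nonneg s that(1))
  qed
  have lim: "x \<longlonglongrightarrow> 0" using summ(1)[OF x sum] by (rule summable_LIMSEQ_zero)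
  let ?d = "decreasing_rearrangement x"
  have d: "decseq ?d" "\<And>i. 0 \<le> ?d i"
    using decseq_decreasing_rearrangement[OF x lim] decreasing_rearrangement_nonneg[OF x lim] by auto
  \<comment> \<open>The layer-cake formula for \<open>?d\<close> needs this limit before the
    summability of \<open>?d\<close> is known.\<close>
  have dlim: "?d \<longlonglongrightarrow> 0"
  proof (rule LIMSEQ_I)
    fix e :: real assume e: "0 < e"
    let ?n = "card {i. e / 2 \<le> x i}"
    have "?d k < e" if "?n \<le> k" for k
      using decreasing_rearrangement_ge_iff[OF x lim, of "e / 2" k] e that by linarith
    then show "\<exists>n. \<forall>k\<ge>n. norm (?d k - 0) < e" using d by auto
  qed
  show ps: "power_sum m (ennreal_seq ?d) = power_sum m (ennreal_seq x)" if "0 < m" for m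
    unfolding power_sum_layer_cake[OF x lim that] power_sum_layer_cake[OF d(2) dlim that]
    using that by (intro nn_integral_cong)
      (auto simp: indicator_def card_decreasing_rearrangement[OF x lim])
  have "(\<Sum>i. ennreal_seq ?d i) \<le> 1" using ps[of 1] sum by (simp add: power_sum_def)
  from summ[OF d(2) this] have s: "summable ?d" "suminf ?d \<le> 1" .
  have "?d 0 \<le> suminf ?d" using s d sum_le_suminf[of ?d "{0}"] by auto
  then show "?d \<in> ranked_frequencies" using s d by (auto simp: ranked_frequencies_def)
qed

section \<open>Moments of the factors and of the stick-breaking sequence\<close>

lemma nn_integral_beta_distribution:
  assumes "0 < a" "0 < b"
  shows "(\<integral>\<^sup>+u. ennreal u ^ r * ennreal (1 - u) ^ s \<partial>beta_distribution a b) =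
    ennreal (pochhammer a r * pochhammer b s / pochhammer (a + b) (r + s))"
proof -
  have pos: "0 < Beta a b" using assms by (simp add: Beta_def Gamma_real_pos)
  let ?f = "\<lambda>u. u powr (a + real r - 1) * (1 - u) powr (b + real s - 1)"
  have "(?f has_integral Beta (a + real r) (b + real s)) {0<..<1}"
    using has_integral_Beta_real[of "a + real r" "b + real s"] assms by (simp add: has_integral_Icc_iff_Ioo)
  from has_integral_divide[OF this, of "Beta a b"]
  have "((\<lambda>u. if u \<in> {0<..<1} then ?f u / Beta a b else 0) has_integral
      Beta (a + real r) (b + real s) / Beta a b) UNIV"
    by (simp only: has_integral_restrict_UNIV)
  then have "(\<integral>\<^sup>+u. ennreal (if u \<in> {0<..<1} then ?f u / Beta a b else 0) \<partial>lborel) =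
      ennreal (Beta (a + real r) (b + real s) / Beta a b)"
    using pos by (intro nn_integral_has_integral_lborel) auto
  moreover have "(\<integral>\<^sup>+u. ennreal u ^ r * ennreal (1 - u) ^ s \<partial>beta_distribution a b) =
     (\<integral>\<^sup>+u. ennreal (if u \<in> {0<..<1} then ?f u / Beta a b else 0) \<partial>lborel)"
    unfolding beta_distribution_def
  proof (subst nn_integral_density)
    show "(\<integral>\<^sup>+u. ennreal (u powr (a - 1) * (1 - u) powr (b - 1) / Beta a b * indicator {0<..<1} u) *
         (ennreal u ^ r * ennreal (1 - u) ^ s) \<partial>lborel) =
      (\<integral>\<^sup>+u. ennreal (if u \<in> {0<..<1} then ?f u / Beta a b else 0) \<partial>lborel)"
    proof (rule nn_integral_cong)
      fix u :: real
      show "ennreal (u powr (a - 1) * (1 - u) powr (b - 1) / Beta a b * indicator {0<..<1} u) *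
         (ennreal u ^ r * ennreal (1 - u) ^ s) = ennreal (if u \<in> {0<..<1} then ?f u / Beta a b else 0)"
      proof (cases "u \<in> {0<..<1}")
        case True
        have "?f u = (u powr (a - 1) * u ^ r) * ((1 - u) powr (b - 1) * (1 - u) ^ s)"
          using True by (simp add: powr_realpow[symmetric] powr_add[symmetric] algebra_simps)
        then show ?thesis using True pos
          by (simp add: ennreal_power mult_ac flip: ennreal_mult')
      qed auto
    qed
  qed auto
  moreover have "Beta (a + real r) (b + real s) / Beta a b =
      pochhammer a r * pochhammer b s / pochhammer (a + b) (r + s)"
  proof -
    have [simp]: "x \<notin> \<int>\<^sub>\<le>\<^sub>0" if "0 < x" for x :: real using that by (auto elim!: nonpos_Ints_cases)
    have G: "0 < Gamma a" "0 < Gamma b" "0 < Gamma (a + b)" "0 < pochhammer (a + b) (r + s)"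
      using assms by (auto intro!: Gamma_real_pos pochhammer_pos)
    have nz: "Gamma a \<noteq> 0" "Gamma b \<noteq> 0" "Gamma (a + b) \<noteq> 0" using G by auto
    have eqs: "Gamma (a + real r) = pochhammer a r * Gamma a" "Gamma (b + real s) = pochhammer b s * Gamma b"
      "Gamma (a + real r + (b + real s)) = pochhammer (a + b) (r + s) * Gamma (a + b)"
      using assms pochhammer_Gamma[of a r] pochhammer_Gamma[of b s] pochhammer_Gamma[of "a + b" "r + s"] nz
      by (simp_all add: add_ac)
    show ?thesis unfolding Beta_def eqs using G by (simp add: divide_simps)
  qed
  ultimately show ?thesis by simp
qed

text \<open>The boundary case \<open>\<theta> + \<alpha> = 0\<close> is included: the first stick is
  then 1, and correspondingly \<open>pochhammer 0 s\<close> vanishes for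
  \<open>s > 0\<close>.\<close>

lemma nn_integral_PD_factor:
  assumes "\<alpha> < 1" "0 \<le> \<theta> + \<alpha>"
  shows "(\<integral>\<^sup>+u. ennreal u ^ r * ennreal (1 - u) ^ s \<partial>PD_factor \<alpha> \<theta> 0) = ennreal (beta_moment \<alpha> \<theta> r s)"
proof (cases "0 < \<theta> + \<alpha>")
  case True
  have "1 - \<alpha> + (\<theta> + \<alpha>) = 1 + \<theta>" by simp
  then show ?thesis
    using nn_integral_beta_distribution[of "1 - \<alpha>" "\<theta> + \<alpha>" r s] assms True
    by (simp add: PD_factor_def beta_moment_def)
next
  case False
  then have "\<theta> = - \<alpha>" using assms by simp
  moreover have "0 < pochhammer (1 - \<alpha>) r" using assms by (intro pochhammer_pos) simp
  ultimately show ?thesis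
    by (cases s) (simp_all add: PD_factor_def beta_moment_def nn_integral_return pochhammer_rec)
qed

lemma prob_space_PD_factor:
  assumes "\<alpha> < 1"
  shows "prob_space (PD_factor \<alpha> \<theta> k)"
  using assms by (auto simp: PD_factor_def intro!: prob_space_beta_distribution prob_space_return)

lemma AE_PD_factor:
  assumes "\<alpha> < 1"
  shows "AE u in PD_factor \<alpha> \<theta> k. u \<in> {0..1}"
proof -
  have "AE u in beta_distribution a b. u \<in> {0..1}" for a b
    unfolding beta_distribution_def by (subst AE_density) (auto intro!: AE_I2 simp: indicator_def)
  moreover have "AE u in return borel (1::real). u \<in> {0..1}"
    by (subst AE_return) (simp_all del: atLeastAtMost_iff, simp)
  ultimately show ?thesis unfolding PD_factor_def by (simp only: simp_thms split: if_split)
qed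

lemma AE_PD_factors:
  assumes "\<alpha> < 1"
  shows "AE w in PiM UNIV (PD_factor \<alpha> \<theta>). \<forall>k. w k \<in> {0..1}"
proof -
  interpret product_prob_space "PD_factor \<alpha> \<theta>" UNIV
    by (rule product_prob_spaceI) (rule prob_space_PD_factor[OF assms])
  show ?thesis unfolding AE_all_countable using AE_PD_factor[OF assms] by (auto intro!: AE_component simp del: atLeastAtMost_iff)
qed

lemma stick_breaking_nonneg:
  assumes "\<forall>k. w k \<in> {0..1}"
  shows "0 \<le> stick_breaking w k"
  using assms by (auto simp: stick_breaking_def intro!: mult_nonneg_nonneg prod_nonneg)

lemma sum_stick_breaking: "(\<Sum>k<n. stick_breaking w k) = 1 - (\<Prod>j<n. 1 - w j)"
  by (induction n) (auto simp: stick_breaking_def algebra_simps)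

lemma suminf_stick_breaking_le_1:
  assumes w: "\<forall>k. w k \<in> {0..1}"
  shows "(\<Sum>k. ennreal_seq (stick_breaking w) k) \<le> 1"
proof (rule suminf_le_const)
  fix n
  have "(\<Sum>k<n. ennreal_seq (stick_breaking w) k) = ennreal (\<Sum>k<n. stick_breaking w k)"
    by (rule sum_ennreal) (rule stick_breaking_nonneg[OF w])
  also have "\<dots> \<le> ennreal 1"
    unfolding sum_stick_breaking using w by (intro ennreal_leI) (auto intro!: prod_nonneg)
  finally show "(\<Sum>k<n. ennreal_seq (stick_breaking w) k) \<le> 1" by simp
qed simp

lemma stick_breaking_Suc:
  "stick_breaking w (Suc k) = (1 - w 0) * stick_breaking (\<lambda>k. w (Suc k)) k"
  by (simp add: stick_breaking_def prod.lessThan_Suc_shift del: prod.lessThan_Suc)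

text \<open>Behind the first stick lies the stick-breaking sequence of the shifted factors, scaled
  by \<open>1 - w 0\<close>. The scaling contributes one power of \<open>1 - w 0\<close> per unit of
  exponent not spent on the first stick.\<close>

lemma distinct_sum_stick_breaking:
  assumes w: "\<forall>k. w k \<in> {0..1}" and ns: "\<forall>n\<in>set ns. 0 < n"
  shows "distinct_sum ns (ennreal_seq (stick_breaking w)) =
    ennreal (1 - w 0) ^ sum_list ns * distinct_sum ns (ennreal_seq (stick_breaking (\<lambda>k. w (Suc k)))) +
    (\<Sum>j<length ns. ennreal (w 0) ^ (ns ! j) * ennreal (1 - w 0) ^ (sum_list ns - ns ! j) *
      distinct_sum (remove_nth j ns) (ennreal_seq (stick_breaking (\<lambda>k. w (Suc k)))))"
proof -
  let ?y = "ennreal_seq (stick_breaking w)" and ?z = "ennreal_seq (stick_breaking (\<lambda>k. w (Suc k)))"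
  have *: "distinct_sum ms (?y(0 := 0)) = ennreal (1 - w 0) ^ sum_list ms * distinct_sum ms ?z"
    if "\<forall>n\<in>set ms. 0 < n" for ms
  proof -
    have "distinct_sum ms (?y(0 := 0)) = distinct_sum ms (\<lambda>k. if k < 0 then ?y k else ?y (Suc k))"
      by (rule distinct_sum_delete[symmetric, OF suminf_stick_breaking_le_1[OF w] that])
    also have "(\<lambda>k. if k < 0 then ?y k else ?y (Suc k)) = (\<lambda>k. ennreal (1 - w 0) * ?z k)"
      using w by (auto simp: stick_breaking_Suc ennreal_mult')
    finally show ?thesis by (simp add: distinct_sum_scale del: fun_upd_apply)
  qed
  have y0: "?y 0 = ennreal (w 0)" by (simp add: stick_breaking_def)
  have "\<forall>n\<in>set (remove_nth j ns). 0 < n" if "j < length ns" for j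
    using ns remove_nth_props(4)[OF that] by blast
  then show ?thesis
    unfolding distinct_sum_split[OF ns, of ?y 0] *[OF ns] y0
    by (intro arg_cong2[of _ _ _ _ "(+)"] refl sum.cong) (auto simp: * remove_nth_props mult_ac)
qed

text \<open>Moments of the Griffiths--Engen--McCloskey sequence, that is, of the stick lengths
  before ranking.\<close>

definition GEM_moment :: "real \<Rightarrow> real \<Rightarrow> nat list \<Rightarrow> ennreal" where
  "GEM_moment \<alpha> \<theta> ns =
     (\<integral>\<^sup>+w. distinct_sum ns (ennreal_seq (stick_breaking w)) \<partial>PiM UNIV (PD_factor \<alpha> \<theta>))"

lemma sets_PiM_PD_factor [measurable_cong, simp]: "sets (PiM UNIV (PD_factor \<alpha> \<theta>)) = sets seq_borel"
  by (rule sets_PiM_cong) auto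

lemma measurable_distinct_sum_stick_breaking [measurable]:
  "(\<lambda>w. distinct_sum ns (ennreal_seq (stick_breaking w))) \<in> borel_measurable seq_borel"
  by (rule measurable_compose[OF measurable_stick_breaking measurable_distinct_sum])

lemma GEM_moment_le_1:
  assumes "\<alpha> < 1" "\<forall>n\<in>set ns. 0 < n"
  shows "GEM_moment \<alpha> \<theta> ns \<le> 1"
proof -
  interpret prob_space "PiM UNIV (PD_factor \<alpha> \<theta>)"
    by (intro prob_space_PiM prob_space_PD_factor assms)
  have "GEM_moment \<alpha> \<theta> ns \<le> (\<integral>\<^sup>+w. 1 \<partial>PiM UNIV (PD_factor \<alpha> \<theta>))"
    unfolding GEM_moment_def
  proof (rule nn_integral_mono_AE)
    show "AE w in PiM UNIV (PD_factor \<alpha> \<theta>). distinct_sum ns (ennreal_seq (stick_breaking w)) \<le> 1"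
      using AE_PD_factors[OF assms(1)]
      by eventually_elim (intro distinct_sum_le_1 suminf_stick_breaking_le_1 assms)
  qed
  then show ?thesis by (simp add: emeasure_space_1)
qed

text \<open>The factors after the first one are those of \<open>\<theta> + \<alpha>\<close> and
  independent of it, so integrating \<open>distinct_sum_stick_breaking\<close> separates the first
  stick from the rest.\<close>

lemma GEM_moment_split:
  assumes \<alpha>: "\<alpha> < 1" "0 \<le> \<theta> + \<alpha>" and ns: "\<forall>n\<in>set ns. 0 < n"
  shows "GEM_moment \<alpha> \<theta> ns = ennreal (beta_moment \<alpha> \<theta> 0 (sum_list ns)) * GEM_moment \<alpha> (\<theta> + \<alpha>) ns +
    (\<Sum>j<length ns. ennreal (beta_moment \<alpha> \<theta> (ns ! j) (sum_list ns - ns ! j)) *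
      GEM_moment \<alpha> (\<theta> + \<alpha>) (remove_nth j ns))"
proof -
  let ?F = "PD_factor \<alpha> \<theta> 0" and ?S = "PiM UNIV (PD_factor \<alpha> (\<theta> + \<alpha>))"
  interpret S: prob_space ?S by (intro prob_space_PiM prob_space_PD_factor \<alpha>)
  interpret F: prob_space ?F by (intro prob_space_PD_factor \<alpha>)
  interpret FS: pair_sigma_finite ?F ?S ..
  let ?d = "\<lambda>ms w. distinct_sum ms (ennreal_seq (stick_breaking w))"
  have "(\<lambda>i. PD_factor \<alpha> \<theta> (Suc i)) = PD_factor \<alpha> (\<theta> + \<alpha>)"
    by (intro ext) (simp add: PD_factor_def algebra_simps)
  then have D: "PiM UNIV (PD_factor \<alpha> \<theta>) =
      distr (?F \<Otimes>\<^sub>M ?S) (PiM UNIV (PD_factor \<alpha> \<theta>)) (\<lambda>(s, \<omega>). case_nat s \<omega>)"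
    using PiM_UNIV_nat_split[of "PD_factor \<alpha> \<theta>"] prob_space_PD_factor[OF \<alpha>(1)] by simp
  have cn [measurable]: "(\<lambda>(s, \<omega>). case_nat s \<omega>) \<in> ?F \<Otimes>\<^sub>M ?S \<rightarrow>\<^sub>M seq_borel"
  proof (rule measurable_PiM_single')
    fix i
    show "(\<lambda>\<omega>. (case \<omega> of (s, \<omega>) \<Rightarrow> case_nat s \<omega>) i) \<in> borel_measurable (?F \<Otimes>\<^sub>M ?S)"
      by (cases i) (auto simp: split_beta')
  qed (auto simp: space_PiM)
  have prod: "(\<integral>\<^sup>+x. f (fst x) * g (snd x) \<partial>(?F \<Otimes>\<^sub>M ?S)) = (\<integral>\<^sup>+u. f u \<partial>?F) * (\<integral>\<^sup>+w. g w \<partial>?S)"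
    if [measurable]: "f \<in> borel_measurable borel" "g \<in> borel_measurable seq_borel" for f g
    by (subst S.nn_integral_fst[symmetric]) (auto simp: nn_integral_cmult nn_integral_multc)
  have AE: "AE x in ?F \<Otimes>\<^sub>M ?S. fst x \<in> {0..1} \<and> (\<forall>k. snd x k \<in> {0..1})"
  proof (rule FS.AE_pair_measure)
    show "{x \<in> space (?F \<Otimes>\<^sub>M ?S). fst x \<in> {0..1} \<and> (\<forall>k. snd x k \<in> {0..1})} \<in> sets (?F \<Otimes>\<^sub>M ?S)"
      by measurable
    show "AE u in ?F. AE w in ?S. fst (u, w) \<in> {0..1} \<and> (\<forall>k. snd (u, w) k \<in> {0..1})"
      using AE_PD_factor[OF \<alpha>(1), of \<theta> 0]
    proof eventually_elim
      case (elim u)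
      show ?case using AE_PD_factors[OF \<alpha>(1), of "\<theta> + \<alpha>"] by eventually_elim (use elim in auto)
    qed
  qed
  have "GEM_moment \<alpha> \<theta> ns = (\<integral>\<^sup>+x. ?d ns (case x of (s, \<omega>) \<Rightarrow> case_nat s \<omega>) \<partial>(?F \<Otimes>\<^sub>M ?S))"
    unfolding GEM_moment_def by (subst D, subst nn_integral_distr) auto
  also have "\<dots> = (\<integral>\<^sup>+x. ennreal (1 - fst x) ^ sum_list ns * ?d ns (snd x) +
    (\<Sum>j<length ns. ennreal (fst x) ^ (ns ! j) * ennreal (1 - fst x) ^ (sum_list ns - ns ! j) *
      ?d (remove_nth j ns) (snd x)) \<partial>(?F \<Otimes>\<^sub>M ?S))"
  proof (rule nn_integral_cong_AE)
    show "AE x in ?F \<Otimes>\<^sub>M ?S. ?d ns (case x of (s, \<omega>) \<Rightarrow> case_nat s \<omega>) =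
      ennreal (1 - fst x) ^ sum_list ns * ?d ns (snd x) +
    (\<Sum>j<length ns. ennreal (fst x) ^ (ns ! j) * ennreal (1 - fst x) ^ (sum_list ns - ns ! j) *
      ?d (remove_nth j ns) (snd x))"
      using AE
    proof eventually_elim
      case (elim x)
      obtain s \<omega> where x: "x = (s, \<omega>)" by (cases x)
      have "\<forall>k. case_nat s \<omega> k \<in> {0..1}" using elim by (auto simp: x split: nat.split)
      from distinct_sum_stick_breaking[OF this ns] show ?case by (simp add: x)
    qed
  qed
  also have "\<dots> = (\<integral>\<^sup>+x. ennreal (1 - fst x) ^ sum_list ns * ?d ns (snd x) \<partial>(?F \<Otimes>\<^sub>M ?S)) +
    (\<Sum>j<length ns. \<integral>\<^sup>+x. ennreal (fst x) ^ (ns ! j) * ennreal (1 - fst x) ^ (sum_list ns - ns ! j) *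
      ?d (remove_nth j ns) (snd x) \<partial>(?F \<Otimes>\<^sub>M ?S))"
    by (subst nn_integral_add, measurable, subst nn_integral_sum) auto
  also have "(\<integral>\<^sup>+x. ennreal (1 - fst x) ^ sum_list ns * ?d ns (snd x) \<partial>(?F \<Otimes>\<^sub>M ?S)) =
      ennreal (beta_moment \<alpha> \<theta> 0 (sum_list ns)) * GEM_moment \<alpha> (\<theta> + \<alpha>) ns"
    using prod[of "\<lambda>u. ennreal (1 - u) ^ sum_list ns" "?d ns"] nn_integral_PD_factor[OF \<alpha>, of 0]
    by (simp add: GEM_moment_def)
  also have "(\<Sum>j<length ns. \<integral>\<^sup>+x. ennreal (fst x) ^ (ns ! j) * ennreal (1 - fst x) ^ (sum_list ns - ns ! j) *
      ?d (remove_nth j ns) (snd x) \<partial>(?F \<Otimes>\<^sub>M ?S)) =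
      (\<Sum>j<length ns. ennreal (beta_moment \<alpha> \<theta> (ns ! j) (sum_list ns - ns ! j)) *
        GEM_moment \<alpha> (\<theta> + \<alpha>) (remove_nth j ns))"
  proof (rule sum.cong[OF refl])
    fix j
    show "(\<integral>\<^sup>+x. ennreal (fst x) ^ (ns ! j) * ennreal (1 - fst x) ^ (sum_list ns - ns ! j) *
      ?d (remove_nth j ns) (snd x) \<partial>(?F \<Otimes>\<^sub>M ?S)) =
      ennreal (beta_moment \<alpha> \<theta> (ns ! j) (sum_list ns - ns ! j)) * GEM_moment \<alpha> (\<theta> + \<alpha>) (remove_nth j ns)"
    using prod[of "\<lambda>u. ennreal u ^ (ns ! j) * ennreal (1 - u) ^ (sum_list ns - ns ! j)" "?d (remove_nth j ns)"]
      nn_integral_PD_factor[OF \<alpha>]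
    by (simp add: GEM_moment_def)
  qed
  finally show ?thesis .
qed

lemma beta_moment_bounds:
  assumes "\<alpha> < 1" "0 \<le> \<theta> + \<alpha>"
  shows "0 \<le> beta_moment \<alpha> \<theta> r s" "beta_moment \<alpha> \<theta> r s \<le> 1"
proof -
  show nonneg: "0 \<le> beta_moment \<alpha> \<theta> r s"
  proof -
    have "0 \<le> pochhammer (\<theta> + \<alpha>) s"
      using assms(2) by (cases s; cases "\<theta> + \<alpha> = 0") (auto simp: pochhammer_rec intro!: mult_nonneg_nonneg pochhammer_nonneg)
    then show ?thesis
      using assms by (auto simp: beta_moment_def intro!: divide_nonneg_nonneg mult_nonneg_nonneg pochhammer_nonneg)
  qed
  interpret prob_space "PD_factor \<alpha> \<theta> 0" by (rule prob_space_PD_factor[OF assms(1)])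
  have "ennreal (beta_moment \<alpha> \<theta> r s) \<le> (\<integral>\<^sup>+u. 1 \<partial>PD_factor \<alpha> \<theta> 0)"
    unfolding nn_integral_PD_factor[OF assms, symmetric]
  proof (rule nn_integral_mono_AE)
    show "AE u in PD_factor \<alpha> \<theta> 0. ennreal u ^ r * ennreal (1 - u) ^ s \<le> 1"
      using AE_PD_factor[OF assms(1), of \<theta> 0] by eventually_elim (auto intro!: mult_le_one power_le_one)
  qed
  then show "beta_moment \<alpha> \<theta> r s \<le> 1" using nonneg by (simp add: emeasure_space_1)
qed

text \<open>The bound is the value at \<open>n = 1\<close>, the expected length remaining after the
  first stick. Its distance from 1 is \<open>(1 - \<alpha>) / (1 + \<theta>)\<close>, of harmonic
  order as \<open>\<theta>\<close> advances in steps of a positive \<open>\<alpha>\<close>.\<close>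

lemma beta_moment_0_antimono:
  assumes "\<alpha> < 1" "0 \<le> \<theta> + \<alpha>" "0 < n"
  shows "beta_moment \<alpha> \<theta> 0 n \<le> (\<theta> + \<alpha>) / (1 + \<theta>)"
  using assms(3)
proof (induction n rule: nat_induct_non_zero)
  case (Suc n)
  have "beta_moment \<alpha> \<theta> 0 (Suc n) = beta_moment \<alpha> \<theta> 0 n * ((\<theta> + \<alpha> + real n) / (1 + \<theta> + real n))"
    by (simp add: beta_moment_def pochhammer_Suc)
  also have "\<dots> \<le> beta_moment \<alpha> \<theta> 0 n * 1"
    using assms beta_moment_bounds[of \<alpha> \<theta> 0 n] by (intro mult_left_mono) auto
  finally show ?case using Suc by simp
qed (simp add: beta_moment_def)

lemma PD_moment_bounds:
  assumes "0 \<le> \<alpha>" "\<alpha> < 1" "- \<alpha> < \<theta>" "\<forall>n\<in>set ns. 0 < n"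
  shows "0 \<le> PD_moment \<alpha> \<theta> ns \<and> PD_moment \<alpha> \<theta> ns \<le> 1"
  using assms(3,4)
proof (induction ns arbitrary: \<theta>)
  case (Cons n ns)
  then show ?case
    using assms(1,2) Cons.IH[of "\<theta> + \<alpha>"] beta_moment_bounds[of \<alpha> \<theta> "n - 1" "sum_list ns"]
    by (auto simp: PD_moment_Cons intro!: mult_nonneg_nonneg mult_le_one)
qed simp

text \<open>The two families of moments satisfy the same recursion; its homogeneous part is damped by the
  expected length of the remaining stick, which tends to 0.\<close>

lemma GEM_moment_eq_PD_moment:
  assumes "PD_parameters \<alpha> \<theta>" "\<forall>n\<in>set ns. 0 < n"
  shows "GEM_moment \<alpha> \<theta> ns = ennreal (PD_moment \<alpha> \<theta> ns)"
proof -
  define \<Delta> where "\<Delta> \<theta> ns = enn2real (GEM_moment \<alpha> \<theta> ns) - PD_moment \<alpha> \<theta> ns" for \<theta> ns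
  have \<alpha>: "\<alpha> < 1" using assms by (auto simp: PD_parameters_def)
  have valid: "0 \<le> \<theta> + \<alpha>" "- 1 < \<theta>" if "PD_parameters \<alpha> \<theta>" for \<theta>
  proof -
    have "- real m * \<alpha> + \<alpha> = (real m - 1) * (- \<alpha>)" for m by (simp add: algebra_simps)
    then have "0 \<le> - real m * \<alpha> + \<alpha>" if "\<alpha> < 0" "1 \<le> m" for m
      using that by (simp only:) (intro mult_nonneg_nonneg; simp)
    then show "0 \<le> \<theta> + \<alpha>" using that by (auto simp: PD_parameters_def)
    then show "- 1 < \<theta>" using \<alpha> by simp
  qed
  have enn: "ennreal (enn2real (GEM_moment \<alpha> \<theta> ns)) = GEM_moment \<alpha> \<theta> ns"
    if "\<forall>n\<in>set ns. 0 < n" for \<theta> ns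
    using GEM_moment_le_1[OF \<alpha> that, of \<theta>] by (intro ennreal_enn2real) (auto intro: le_less_trans)
  have rem_pos: "\<forall>n\<in>set (remove_nth j ns). 0 < n" if "j < length ns" "\<forall>n\<in>set ns. 0 < n" for j and ns :: "nat list"
    using that remove_nth_props(4)[OF that(1)] by blast
  have split: "\<Delta> \<theta> ns = beta_moment \<alpha> \<theta> 0 (sum_list ns) * \<Delta> (\<theta> + \<alpha>) ns +
    (\<Sum>j<length ns. beta_moment \<alpha> \<theta> (ns ! j) (sum_list ns - ns ! j) * \<Delta> (\<theta> + \<alpha>) (remove_nth j ns))"
    if v: "PD_parameters \<alpha> \<theta>" and ns: "\<forall>n\<in>set ns. 0 < n" "ns \<noteq> []" for \<theta> ns
  proof -
    let ?g = "\<lambda>ns. enn2real (GEM_moment \<alpha> (\<theta> + \<alpha>) ns)" and ?b = "beta_moment \<alpha> \<theta>"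
    note b = beta_moment_bounds(1)[OF \<alpha> valid(1)[OF v]]
    have "GEM_moment \<alpha> \<theta> ns = ennreal (?b 0 (sum_list ns)) * ennreal (?g ns) +
      (\<Sum>j<length ns. ennreal (?b (ns ! j) (sum_list ns - ns ! j)) * ennreal (?g (remove_nth j ns)))"
      unfolding GEM_moment_split[OF \<alpha> valid(1)[OF v] ns(1)] enn[OF ns(1)]
      using enn[OF rem_pos[OF _ ns(1)]] by simp
    also have "\<dots> = ennreal (?b 0 (sum_list ns) * ?g ns +
      (\<Sum>j<length ns. ?b (ns ! j) (sum_list ns - ns ! j) * ?g (remove_nth j ns)))"
      using b by (subst ennreal_plus) (auto intro!: sum_nonneg simp: ennreal_mult sum_ennreal[symmetric] simp del: sum_ennreal)
    finally have "enn2real (GEM_moment \<alpha> \<theta> ns) = ?b 0 (sum_list ns) * ?g ns +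
      (\<Sum>j<length ns. ?b (ns ! j) (sum_list ns - ns ! j) * ?g (remove_nth j ns))"
      using b by (metis (no_types, lifting) enn2real_ennreal enn2real_nonneg add_nonneg_nonneg mult_nonneg_nonneg sum_nonneg)
    then show ?thesis
      unfolding \<Delta>_def PD_moment_split[OF ns \<alpha> valid(1)[OF v]]
      by (simp add: right_diff_distrib sum_subtractf)
  qed
  have \<Delta>_Nil: "\<Delta> \<theta> [] = 0" for \<theta>
  proof -
    interpret prob_space "PiM UNIV (PD_factor \<alpha> \<theta>)" by (intro prob_space_PiM prob_space_PD_factor \<alpha>)
    show ?thesis by (simp add: \<Delta>_def GEM_moment_def emeasure_space_1)
  qed
  have "\<forall>\<theta>. PD_parameters \<alpha> \<theta> \<longrightarrow> (\<forall>n\<in>set ns. 0 < n) \<longrightarrow> \<Delta> \<theta> ns = 0" for ns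
  proof (induction "length ns" arbitrary: ns rule: less_induct)
    case less
    show ?case
    proof (intro allI impI)
      fix \<theta> assume v: "PD_parameters \<alpha> \<theta>" and ns: "\<forall>n\<in>set ns. 0 < n"
      show "\<Delta> \<theta> ns = 0"
      proof (cases "ns = []")
        case False
        then have N: "0 < sum_list ns" using ns by (cases ns) auto
        have step: "\<Delta> \<theta> ns = beta_moment \<alpha> \<theta> 0 (sum_list ns) * \<Delta> (\<theta> + \<alpha>) ns" if v: "PD_parameters \<alpha> \<theta>" for \<theta>
        proof -
          have "beta_moment \<alpha> \<theta> (ns ! j) (sum_list ns - ns ! j) * \<Delta> (\<theta> + \<alpha>) (remove_nth j ns) = 0"
            if j: "j < length ns" for j
          proof (cases "PD_parameters \<alpha> (\<theta> + \<alpha>)")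
            case True
            then show ?thesis
              using less[of "remove_nth j ns"] remove_nth_props(3)[OF j] j rem_pos[OF j ns] by auto
          next
            \<comment> \<open>The shift leaves the parameter range only for
              \<open>\<theta> + \<alpha> = 0\<close>. Then \<open>pochhammer 0\<close> kills the
              coefficient, unless the shorter list is empty, where the difference itself is
              0.\<close>
            case v': False
            have "\<theta> + \<alpha> = 0"
            proof (rule ccontr)
              assume ne: "\<theta> + \<alpha> \<noteq> 0"
              have "\<not> (0 \<le> \<alpha> \<and> - \<alpha> < \<theta>)" using v' \<alpha> by (auto simp: PD_parameters_def)
              then obtain m where m: "\<alpha> < 0" "1 \<le> m" "\<theta> = - real m * \<alpha>" using v by (auto simp: PD_parameters_def)
              then have "\<theta> + \<alpha> = - real (m - 1) * \<alpha>" by (simp add: of_nat_diff algebra_simps)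
              moreover from this have "1 \<le> m - 1" using ne by (cases "m - 1 = 0") auto
              ultimately have "PD_parameters \<alpha> (\<theta> + \<alpha>)"
                using m(1) unfolding PD_parameters_def by (intro disjI2 conjI exI[of _ "m - 1"]) auto
              then show False using v' by simp
            qed
            then show ?thesis
            proof (cases "remove_nth j ns")
              case (Cons a l)
              then have "0 < sum_list (remove_nth j ns)" using rem_pos[OF j ns] by auto
              then obtain s where "sum_list ns - ns ! j = Suc s"
                using remove_nth_props(1)[OF j] gr0_implies_Suc by metis
              then show ?thesis using \<open>\<theta> + \<alpha> = 0\<close> by (simp add: beta_moment_def pochhammer_rec)
            qed (simp add: \<Delta>_Nil)
          qed
          then have "(\<Sum>j<length ns. beta_moment \<alpha> \<theta> (ns ! j) (sum_list ns - ns ! j) *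
              \<Delta> (\<theta> + \<alpha>) (remove_nth j ns)) = 0"
            by (intro sum.neutral) blast
          then show ?thesis using split[OF v ns False] by simp
        qed
        show ?thesis
        proof (cases "0 \<le> \<alpha>")
          case True
          have v: "- \<alpha> < \<theta>" using v True by (auto simp: PD_parameters_def)
          have v': "PD_parameters \<alpha> (\<theta> + real i * \<alpha>)" "- \<alpha> < \<theta> + real i * \<alpha>" for i
          proof -
            have "0 \<le> real i * \<alpha>" using True by simp
            then show "- \<alpha> < \<theta> + real i * \<alpha>" using v by linarith
            then show "PD_parameters \<alpha> (\<theta> + real i * \<alpha>)" using True \<alpha> by (simp add: PD_parameters_def)
          qed
          define f where "f i = beta_moment \<alpha> (\<theta> + real i * \<alpha>) 0 (sum_list ns)" for i
          have f0: "0 \<le> f i" for i unfolding f_def using beta_moment_bounds[OF \<alpha> valid(1)[OF v'(1)]] by blast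
          have iter: "\<Delta> \<theta> ns = (\<Prod>i<k. f i) * \<Delta> (\<theta> + real k * \<alpha>) ns" for k
          proof (induction k)
            case (Suc k)
            then show ?case using step[OF v'(1)[of k]] by (simp add: f_def algebra_simps)
          qed simp
          have abs: "\<bar>\<Delta> (\<theta> + real k * \<alpha>) ns\<bar> \<le> 2" for k
          proof -
            have "GEM_moment \<alpha> (\<theta> + real k * \<alpha>) ns \<le> ennreal 1"
              using GEM_moment_le_1[OF \<alpha> ns] by simp
            then have "enn2real (GEM_moment \<alpha> (\<theta> + real k * \<alpha>) ns) \<le> 1" by (rule enn2real_leI[rotated]) simp
            then show ?thesis
              using PD_moment_bounds[OF True \<alpha> v'(2) ns, of k]
                enn2real_nonneg[of "GEM_moment \<alpha> (\<theta> + real k * \<alpha>) ns"] unfolding \<Delta>_def by linarith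
          qed
          \<comment> \<open>The constant of the gap comes from
            \<open>1 + \<theta> + i \<alpha> \<le> (1 + |\<theta>|) (i + 1)\<close>, which uses
            \<open>\<alpha> < 1\<close>.\<close>
          have "(\<lambda>k. \<Prod>i<k. f i) \<longlonglongrightarrow> 0"
          proof (rule prod_tendsto_0_if_harmonic_gap[where d = "(1 - \<alpha>) / (1 + \<bar>\<theta>\<bar>)"])
            fix i
            have pos: "0 < 1 + (\<theta> + real i * \<alpha>)" using valid(2)[OF v'(1), of i] by simp
            have "f i \<le> (\<theta> + real i * \<alpha> + \<alpha>) / (1 + (\<theta> + real i * \<alpha>))"
              unfolding f_def by (rule beta_moment_0_antimono[OF \<alpha> valid(1)[OF v'(1)] N])
            also have "\<dots> = 1 - (1 - \<alpha>) / (1 + (\<theta> + real i * \<alpha>))" using pos by (simp add: field_simps)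
            also have "\<dots> \<le> 1 - (1 - \<alpha>) / ((1 + \<bar>\<theta>\<bar>) * (real i + 1))"
            proof -
              have "real i * \<alpha> \<le> real i * 1" using \<alpha> by (intro mult_left_mono) auto
              moreover have "0 \<le> \<bar>\<theta>\<bar> * real i" by simp
              ultimately have "1 + (\<theta> + real i * \<alpha>) \<le> (1 + \<bar>\<theta>\<bar>) * (real i + 1)"
                unfolding distrib_left distrib_right by linarith
              then show ?thesis using \<alpha> pos by (intro diff_left_mono divide_left_mono) auto
            qed
            finally show "f i \<le> 1 - (1 - \<alpha>) / (1 + \<bar>\<theta>\<bar>) / (real i + 1)" by simp
          qed (use \<alpha> f0 in \<open>auto intro!: divide_pos_pos\<close>)
          note lim = tendsto_mult_right[OF this, of 2]
          have "\<bar>\<Delta> \<theta> ns\<bar> \<le> (\<Prod>i<k. f i) * 2" for k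
            unfolding iter[of k] abs_mult using abs[of k] f0
            by (intro mult_mono) (auto simp: prod_nonneg abs_prod)
          then have "\<bar>\<Delta> \<theta> ns\<bar> \<le> 0 * 2" by (intro LIMSEQ_le_const[OF lim]) blast
          then show ?thesis by simp
        next
          case neg: False
          then obtain m where m: "1 \<le> m" "\<theta> = - real m * \<alpha>" using v by (auto simp: PD_parameters_def)
          have "\<Delta> (- real (Suc m) * \<alpha>) ns = 0" for m
          proof (induction m)
            case 0
            obtain s where "sum_list ns = Suc s" using N gr0_implies_Suc by blast
            then show ?case using step[of "- \<alpha>"] neg by (force simp: PD_parameters_def beta_moment_def pochhammer_rec)
          next
            case (Suc m)
            have "PD_parameters \<alpha> (- real (Suc (Suc m)) * \<alpha>)"
              using neg unfolding PD_parameters_def by (intro disjI2 conjI exI[of _ "Suc (Suc m)"]) auto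
            from step[OF this] show ?case using Suc by (simp add: algebra_simps)
          qed
          from this[of "m - 1"] show ?thesis using m by simp
        qed
      qed (simp add: \<Delta>_Nil)
    qed
  qed
  then have "enn2real (GEM_moment \<alpha> \<theta> ns) = PD_moment \<alpha> \<theta> ns" using assms by (simp add: \<Delta>_def)
  then show ?thesis using enn[OF assms(2), of \<theta>] by simp
qed

lemma measurable_ranked_stick_breaking [measurable]:
  "(\<lambda>w. decreasing_rearrangement (stick_breaking w)) \<in> seq_borel \<rightarrow>\<^sub>M seq_borel"
  by (rule measurable_compose[OF measurable_stick_breaking measurable_decreasing_rearrangement])

lemma
  assumes "PD_parameters \<alpha> \<theta>"
  shows AE_PD_ranked: "AE x in PD \<alpha> \<theta>. x \<in> ranked_frequencies"
    and nn_integral_PD: "\<forall>n\<in>set ns. 0 < n \<Longrightarrow>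
      (\<integral>\<^sup>+x. distinct_sum ns (ennreal_seq x) \<partial>PD \<alpha> \<theta>) = ennreal (PD_moment \<alpha> \<theta> ns)"
proof -
  have \<alpha>: "\<alpha> < 1" using assms by (auto simp: PD_parameters_def)
  note AE = AE_PD_factors[OF \<alpha>, of \<theta>]
  let ?P = "PiM UNIV (PD_factor \<alpha> \<theta>)" and ?r = "\<lambda>w. decreasing_rearrangement (stick_breaking w)"
  show "AE x in PD \<alpha> \<theta>. x \<in> ranked_frequencies"
    unfolding PD_def
  proof (subst AE_distr_iff)
    show "AE w in ?P. ?r w \<in> ranked_frequencies"
      using AE by eventually_elim
        (intro decreasing_rearrangement_ranked stick_breaking_nonneg suminf_stick_breaking_le_1)
  qed (simp_all add: space_PiM)
  assume ns: "\<forall>n\<in>set ns. 0 < n"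
  have "(\<integral>\<^sup>+x. distinct_sum ns (ennreal_seq x) \<partial>PD \<alpha> \<theta>) = (\<integral>\<^sup>+w. distinct_sum ns (ennreal_seq (?r w)) \<partial>?P)"
    unfolding PD_def by (rule nn_integral_distr) measurable
  also have "\<dots> = GEM_moment \<alpha> \<theta> ns"
    unfolding GEM_moment_def
  proof (rule nn_integral_cong_AE)
    show "AE w in ?P. distinct_sum ns (ennreal_seq (?r w)) = distinct_sum ns (ennreal_seq (stick_breaking w))"
      using AE
    proof eventually_elim
      case (elim w)
      note w = stick_breaking_nonneg[OF elim] suminf_stick_breaking_le_1[OF elim]
      show ?case
        by (rule distinct_sum_cong_power_sum[OF decreasing_rearrangement_ranked(2)[OF w]
            suminf_ennreal_seq_le_1[OF decreasing_rearrangement_ranked(1)[OF w]] ns])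
    qed
  qed
  also have "\<dots> = ennreal (PD_moment \<alpha> \<theta> ns)" by (rule GEM_moment_eq_PD_moment[OF assms ns])
  finally show "(\<integral>\<^sup>+x. distinct_sum ns (ennreal_seq x) \<partial>PD \<alpha> \<theta>) = ennreal (PD_moment \<alpha> \<theta> ns)" .
qed

section \<open>Size-biased deletion\<close>

lemma measurable_pick_fixed [measurable]: "(\<lambda>x. pick x j) \<in> borel_measurable seq_borel"
  by (cases j) (auto simp: pick_def)

lemma measurable_delete_renormalize_fixed [measurable]:
  "(\<lambda>x. delete_renormalize x j) \<in> seq_borel \<rightarrow>\<^sub>M seq_borel"
proof (cases j)
  case (enat n)
  show ?thesis
  proof (rule measurable_PiM_single')
    fix i
    have "(\<lambda>x. if x n = 0 then x i else if x n = 1 then 0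
        else (if i < n then x i else x (Suc i)) / (1 - x n)) \<in> borel_measurable seq_borel"
      by measurable
    also have "(\<lambda>x. if x n = 0 then x i else if x n = 1 then 0
        else (if i < n then x i else x (Suc i)) / (1 - x n)) = (\<lambda>x. delete_renormalize x j i)"
      by (auto simp: delete_renormalize_def enat)
    finally show "(\<lambda>x. delete_renormalize x j i) \<in> borel_measurable seq_borel" .
  qed (simp add: space_PiM)
qed (simp add: delete_renormalize_def)

lemma delete_renormalize_ranked:
  assumes x: "x \<in> ranked_frequencies"
  shows "delete_renormalize x j \<in> ranked_frequencies"
proof (cases "\<exists>n. j = enat n \<and> x n \<noteq> 0 \<and> x n \<noteq> 1")
  case True
  then obtain n where j: "j = enat n" and n: "x n \<noteq> 0" "x n \<noteq> 1" by blast
  have n: "0 < x n" "x n < 1"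
    using n ranked_frequencies_nonneg[OF x, of n] ranked_frequencies_le_1[OF x, of n] by auto
  let ?y = "\<lambda>k. if k < n then x k else x (Suc k)"
  have eq: "delete_renormalize x j = (\<lambda>k. ?y k / (1 - x n))"
    using n by (auto simp: delete_renormalize_def j)
  have x': "\<And>n. x (Suc n) \<le> x n" "\<And>k. 0 \<le> x k" "\<And>n. (\<Sum>k<n. x k) \<le> 1"
    using x by (auto simp: ranked_frequencies_eq)
  have "(\<Sum>k<m. ?y k) \<le> 1 - x n" for m
  proof -
    \<comment> \<open>Once position \<open>n\<close> has been passed, the first \<open>m\<close>
      remaining terms together with \<open>x n\<close> fit into the first \<open>m + 1\<close> terms
      of \<open>x\<close>. For \<open>m < n\<close> the term \<open>x n\<close> is accounted for
      separately below.\<close>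
    have "(\<Sum>k<m. ?y k) + (if n \<le> m then x n else 0) \<le> (\<Sum>k<Suc m. x k)"
    proof (induction m)
      case (Suc m)
      then show ?case using x'(2)[of "Suc m"] x'(1)[of m] by (auto split: if_splits simp: le_Suc_eq)
    qed (use x' in auto)
    then show ?thesis
    proof (cases "n \<le> m")
      case False
      have "(\<Sum>k<m. ?y k) = (\<Sum>k<m. x k)" using False by (intro sum.cong) auto
      moreover have "(\<Sum>k<m. x k) + x n = (\<Sum>k\<in>insert n {..<m}. x k)" using False by simp
      moreover have "\<dots> \<le> (\<Sum>k<Suc n. x k)" using False x' by (intro sum_mono2) auto
      ultimately show ?thesis using x'(3)[of "Suc n"] by simp
    qed (use x'(3)[of "Suc m"] in simp)
  qed
  then have "(\<Sum>k<m. ?y k / (1 - x n)) \<le> 1" for m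
    using n by (simp add: sum_divide_distrib[symmetric] divide_le_eq_1_pos)
  moreover have "?y (Suc k) / (1 - x n) \<le> ?y k / (1 - x n)" for k
    using x'(1)[of k] x'(1)[of "Suc k"] n by (intro divide_right_mono) auto
  moreover have "0 \<le> ?y k / (1 - x n)" for k using n x'(2) by simp
  ultimately show ?thesis unfolding eq ranked_frequencies_eq by blast
next
  case False
  have "(\<lambda>k. 0) \<in> ranked_frequencies" by (simp add: ranked_frequencies_eq)
  then show ?thesis using False x by (cases j) (auto simp: delete_renormalize_def)
qed

text \<open>The weight undoes the renormalization exactly; for this reason powers of
  \<open>1 - X\<close> accompany the distinct sums of \<open>Q\<close> from here on.\<close>

lemma distinct_sum_delete_renormalize:
  assumes x: "x \<in> ranked_frequencies" and n: "0 < x n" "x n < 1" and ns: "\<forall>k\<in>set ns. 0 < k"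
  shows "ennreal (1 - x n) ^ sum_list ns * distinct_sum ns (ennreal_seq (delete_renormalize x (enat n))) =
    distinct_sum ns ((ennreal_seq x)(n := 0))"
proof -
  let ?y = "\<lambda>k. if k < n then ennreal_seq x k else ennreal_seq x (Suc k)"
  have "ennreal_seq (delete_renormalize x (enat n)) = (\<lambda>k. ennreal (1 / (1 - x n)) * ?y k)"
    using n by (auto simp: delete_renormalize_def simp flip: ennreal_mult')
  then have "distinct_sum ns (ennreal_seq (delete_renormalize x (enat n))) =
      ennreal (1 / (1 - x n)) ^ sum_list ns * distinct_sum ns ((ennreal_seq x)(n := 0))"
    by (simp only: distinct_sum_scale distinct_sum_delete[OF suminf_ennreal_seq_le_1[OF x] ns])
  moreover have "ennreal (1 - x n) ^ sum_list ns * ennreal (1 / (1 - x n)) ^ sum_list ns = 1"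
    using n by (simp flip: power_mult_distrib ennreal_mult')
  ultimately show ?thesis by (simp add: mult.assoc[symmetric] del: fun_upd_apply)
qed

text \<open>The condition \<open>P_0_neq_1\<close> keeps \<open>1 - X\<close> positive almost
  surely, so that the renormalization can be undone.\<close>

locale size_biased_deletion = prob_space M for M :: "'a measure" +
  fixes P :: "'a \<Rightarrow> nat \<Rightarrow> real" and J :: "'a \<Rightarrow> enat"
  assumes P [measurable]: "P \<in> M \<rightarrow>\<^sub>M seq_borel"
    and P_ranked: "AE \<omega> in M. P \<omega> \<in> ranked_frequencies"
    and P_0_neq_1: "AE \<omega> in M. P \<omega> 0 \<noteq> 1"
    and size_biased: "size_biased_index M P J"
begin

abbreviation X :: "'a \<Rightarrow> real" where "X \<omega> \<equiv> pick (P \<omega>) (J \<omega>)"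
abbreviation Q :: "'a \<Rightarrow> nat \<Rightarrow> real" where "Q \<omega> \<equiv> delete_renormalize (P \<omega>) (J \<omega>)"

lemma J [measurable]: "J \<in> M \<rightarrow>\<^sub>M count_space UNIV"
  using size_biased by (simp add: size_biased_index_def)

lemma X [measurable]: "X \<in> borel_measurable M"
  by (rule measurable_compose_countable[OF _ J]) measurable

lemma Q [measurable]: "Q \<in> M \<rightarrow>\<^sub>M seq_borel"
  by (rule measurable_compose_countable[OF _ J]) measurable

lemma Q_ranked: "AE \<omega> in M. Q \<omega> \<in> ranked_frequencies"
  using P_ranked by eventually_elim (rule delete_renormalize_ranked)

lemma P_less_1: "AE \<omega> in M. \<forall>j. P \<omega> j < 1"
  using P_ranked P_0_neq_1
proof eventually_elim
  case (elim \<omega>)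
  show ?case
  proof
    fix j
    have "P \<omega> j \<le> P \<omega> 0" using elim by (auto simp: ranked_frequencies_def dest: decseqD)
    then show "P \<omega> j < 1" using elim ranked_frequencies_le_1[of "P \<omega>" 0] by linarith
  qed
qed

text \<open>The conditional probability, tested on the events generated by \<open>P\<close>, says
  that two weighted image measures under \<open>P\<close> agree; integration against them gives the
  claim for all \<open>g\<close>.\<close>

lemma nn_integral_size_biased_index:
  assumes [measurable]: "g \<in> borel_measurable seq_borel"
  shows "(\<integral>\<^sup>+\<omega>. indicator {\<omega> \<in> space M. J \<omega> = enat j} \<omega> * g (P \<omega>) \<partial>M) =
    (\<integral>\<^sup>+\<omega>. ennreal (P \<omega> j) * g (P \<omega>) \<partial>M)"
proof -
  let ?F = "vimage_algebra (space M) P seq_borel" and ?I = "{\<omega> \<in> space M. J \<omega> = enat j}"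
  have Psp: "P \<in> space M \<rightarrow> space seq_borel" using measurable_space[OF P] by blast
  have setsF: "sets ?F = {P -` B \<inter> space M | B. B \<in> sets seq_borel}"
    by (rule sets_vimage_algebra2[OF Psp])
  have "subalgebra M ?F" unfolding subalgebra_def setsF by auto
  then interpret F: finite_measure_subalgebra M ?F by unfold_locales
  have [measurable]: "?I \<in> sets M" by measurable
  have cond: "AE \<omega> in M. real_cond_exp M ?F (indicator ?I) \<omega> = P \<omega> j"
    using size_biased by (simp add: size_biased_index_def)
  have iI: "integrable M (indicator ?I :: 'a \<Rightarrow> real)" by (simp add: emeasure_eq_measure)
  have iP: "integrable M (\<lambda>\<omega>. P \<omega> j)"
  proof (rule integrable_const_bound[of _ 1])
    show "AE \<omega> in M. norm (P \<omega> j) \<le> 1"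
      using P_ranked by eventually_elim (auto simp: ranked_frequencies_nonneg ranked_frequencies_le_1)
  qed simp
  have "distr (density M (indicator ?I)) seq_borel P = distr (density M (\<lambda>\<omega>. ennreal (P \<omega> j))) seq_borel P"
  proof (rule measure_eqI)
    fix B assume "B \<in> sets (distr (density M (indicator ?I)) seq_borel P)"
    then have B [measurable]: "B \<in> sets seq_borel" by simp
    let ?A = "P -` B \<inter> space M"
    have A: "?A \<in> sets ?F" "?A \<in> sets M" unfolding setsF using B by auto
    have *: "emeasure (distr (density M h) seq_borel P) B = (\<integral>\<^sup>+\<omega>. h \<omega> * indicator ?A \<omega> \<partial>M)"
      if [measurable]: "h \<in> borel_measurable M" for h
      using A(2) by (simp add: emeasure_distr emeasure_density)
    have "(\<integral>\<^sup>+\<omega>. indicator ?I \<omega> * indicator ?A \<omega> \<partial>M) = ennreal (\<integral>\<omega>. indicator ?A \<omega> * indicator ?I \<omega> \<partial>M)"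
    proof (subst nn_integral_eq_integral[symmetric])
      show "integrable M (\<lambda>\<omega>. indicator ?A \<omega> * indicator ?I \<omega> :: real)"
        using integrable_real_mult_indicator[OF A(2) iI] by (simp add: mult.commute)
      show "(\<integral>\<^sup>+\<omega>. indicator ?I \<omega> * indicator ?A \<omega> \<partial>M) =
          (\<integral>\<^sup>+\<omega>. ennreal (indicator ?A \<omega> * indicator ?I \<omega>) \<partial>M)"
        by (intro nn_integral_cong) (simp add: indicator_def)
    qed simp
    also have "(\<integral>\<omega>. indicator ?A \<omega> * indicator ?I \<omega> \<partial>M) = (\<integral>\<omega>. indicator ?A \<omega> * P \<omega> j \<partial>M :: real)"
    proof -
      have "(\<integral>\<omega>. indicator ?A \<omega> * (indicator ?I \<omega> :: real) \<partial>M) =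
          (\<integral>\<omega>. indicator ?A \<omega> * real_cond_exp M ?F (indicator ?I) \<omega> \<partial>M)"
        using F.real_cond_exp_intA[OF iI A(1)] by (simp add: set_lebesgue_integral_def)
      also have "\<dots> = (\<integral>\<omega>. indicator ?A \<omega> * P \<omega> j \<partial>M)"
      proof (rule integral_cong_AE)
        show "AE \<omega> in M. indicator ?A \<omega> * real_cond_exp M ?F (indicator ?I) \<omega> = indicator ?A \<omega> * P \<omega> j"
          using cond by eventually_elim simp
      qed (use A(2) in measurable)
      finally show ?thesis .
    qed
    also have "ennreal \<dots> = (\<integral>\<^sup>+\<omega>. ennreal (indicator ?A \<omega> * P \<omega> j) \<partial>M)"
    proof (rule nn_integral_eq_integral[symmetric])
      show "integrable M (\<lambda>\<omega>. indicator ?A \<omega> * P \<omega> j)"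
        using integrable_real_mult_indicator[OF A(2) iP] by (simp add: mult.commute)
      show "AE \<omega> in M. 0 \<le> indicator ?A \<omega> * P \<omega> j"
        using P_ranked by eventually_elim (simp add: ranked_frequencies_nonneg)
    qed
    also have "\<dots> = (\<integral>\<^sup>+\<omega>. ennreal (P \<omega> j) * indicator ?A \<omega> \<partial>M)"
      by (intro nn_integral_cong) (simp add: indicator_def)
    finally show "emeasure (distr (density M (indicator ?I)) seq_borel P) B =
        emeasure (distr (density M (\<lambda>\<omega>. ennreal (P \<omega> j))) seq_borel P) B"
      by (simp add: *)
  qed simp
  then have "(\<integral>\<^sup>+x. g x \<partial>distr (density M (indicator ?I)) seq_borel P) =
      (\<integral>\<^sup>+x. g x \<partial>distr (density M (\<lambda>\<omega>. ennreal (P \<omega> j))) seq_borel P)" by simp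
  then show ?thesis by (simp add: nn_integral_distr nn_integral_density)
qed

text \<open>Summation over the values of \<open>J\<close> replaces the pick by the weight
  \<open>P \<omega> j\<close>, and the power of \<open>1 - X\<close> turns \<open>Q\<close> back
  into \<open>P\<close> with its \<open>j\<close>-th term deleted. The right-hand side involves
  \<open>P\<close> alone.\<close>

lemma nn_integral_deletion:
  assumes [measurable]: "\<phi> \<in> borel_measurable borel" and ns: "\<forall>n\<in>set ns. 0 < n"
  shows "(\<integral>\<^sup>+\<omega>. indicator {0<..} (X \<omega>) * \<phi> (X \<omega>) * ennreal (1 - X \<omega>) ^ sum_list ns *
      distinct_sum ns (ennreal_seq (Q \<omega>)) \<partial>M) =
    (\<integral>\<^sup>+\<omega>. (\<Sum>j. ennreal (P \<omega> j) * \<phi> (P \<omega> j) * distinct_sum ns ((ennreal_seq (P \<omega>))(j := 0))) \<partial>M)"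
proof -
  define f where "f j x = indicator {0<..} (x j) * \<phi> (x j) * ennreal (1 - x j) ^ sum_list ns *
      distinct_sum ns (ennreal_seq (delete_renormalize x (enat j)))" for j x
  have [measurable]: "(\<lambda>x. distinct_sum ns (ennreal_seq (delete_renormalize x j))) \<in> borel_measurable seq_borel" for j
    by (rule measurable_compose[OF measurable_delete_renormalize_fixed measurable_distinct_sum])
  have f [measurable]: "f j \<in> borel_measurable seq_borel" for j unfolding f_def by measurable
  have "indicator {0<..} (X \<omega>) * \<phi> (X \<omega>) * ennreal (1 - X \<omega>) ^ sum_list ns *
      distinct_sum ns (ennreal_seq (Q \<omega>)) =
      (\<Sum>j. indicator {\<omega> \<in> space M. J \<omega> = enat j} \<omega> * f j (P \<omega>))" if "\<omega> \<in> space M" for \<omega>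
  proof (cases "J \<omega>")
    case (enat n)
    have "(\<Sum>j. indicator {\<omega> \<in> space M. J \<omega> = enat j} \<omega> * f j (P \<omega>)) = (\<Sum>j\<in>{n}. f j (P \<omega>))"
      using that by (subst suminf_finite[of "{n}"]) (auto simp: enat indicator_def)
    then show ?thesis by (simp add: f_def enat pick_def)
  qed (simp add: pick_def)
  then have "(\<integral>\<^sup>+\<omega>. indicator {0<..} (X \<omega>) * \<phi> (X \<omega>) * ennreal (1 - X \<omega>) ^ sum_list ns *
      distinct_sum ns (ennreal_seq (Q \<omega>)) \<partial>M) =
      (\<integral>\<^sup>+\<omega>. (\<Sum>j. indicator {\<omega> \<in> space M. J \<omega> = enat j} \<omega> * f j (P \<omega>)) \<partial>M)"
    by (intro nn_integral_cong)
  also have "\<dots> = (\<Sum>j. \<integral>\<^sup>+\<omega>. indicator {\<omega> \<in> space M. J \<omega> = enat j} \<omega> * f j (P \<omega>) \<partial>M)"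
    by (rule nn_integral_suminf) measurable
  also have "\<dots> = (\<Sum>j. \<integral>\<^sup>+\<omega>. ennreal (P \<omega> j) * f j (P \<omega>) \<partial>M)"
    by (intro suminf_cong nn_integral_size_biased_index f)
  also have "\<dots> = (\<integral>\<^sup>+\<omega>. (\<Sum>j. ennreal (P \<omega> j) * f j (P \<omega>)) \<partial>M)"
    by (rule nn_integral_suminf[symmetric]) measurable
  also have "\<dots> = (\<integral>\<^sup>+\<omega>. (\<Sum>j. ennreal (P \<omega> j) * \<phi> (P \<omega> j) * distinct_sum ns ((ennreal_seq (P \<omega>))(j := 0))) \<partial>M)"
  proof (rule nn_integral_cong_AE)
    show "AE \<omega> in M. (\<Sum>j. ennreal (P \<omega> j) * f j (P \<omega>)) =
        (\<Sum>j. ennreal (P \<omega> j) * \<phi> (P \<omega> j) * distinct_sum ns ((ennreal_seq (P \<omega>))(j := 0)))"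
      using P_ranked P_less_1
    proof eventually_elim
      case (elim \<omega>)
      show ?case
      proof (rule suminf_cong)
        fix j
        show "ennreal (P \<omega> j) * f j (P \<omega>) =
            ennreal (P \<omega> j) * \<phi> (P \<omega> j) * distinct_sum ns ((ennreal_seq (P \<omega>))(j := 0))"
        proof (cases "P \<omega> j = 0")
          case False
          then have "0 < P \<omega> j" using ranked_frequencies_nonneg[OF elim(1), of j] by simp
          then show ?thesis
            using elim(2) by (subst distinct_sum_delete_renormalize[OF elim(1) _ _ ns, symmetric])
              (auto simp: f_def mult_ac)
        qed simp
      qed
    qed
  qed
  finally show ?thesis .
qed

text \<open>A vanishing term is picked with conditional probability 0, so a pick of value 0 means
  that no term is picked.\<close>

lemma AE_J_infinity_iff: "AE \<omega> in M. X \<omega> = 0 \<longleftrightarrow> J \<omega> = \<infinity>"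
proof -
  have "AE \<omega> in M. \<not> (J \<omega> = enat j \<and> P \<omega> j = 0)" for j
  proof -
    have "(\<integral>\<^sup>+\<omega>. indicator {\<omega> \<in> space M. J \<omega> = enat j} \<omega> * indicator {x. x j = 0} (P \<omega>) \<partial>M) =
        (\<integral>\<^sup>+\<omega>. ennreal (P \<omega> j) * indicator {x. x j = 0} (P \<omega>) \<partial>M)"
    proof (rule nn_integral_size_biased_index)
      have "{x \<in> space seq_borel. x j = 0} \<in> sets seq_borel" by measurable
      then show "indicator {x. x j = 0} \<in> borel_measurable seq_borel"
        by (intro borel_measurable_indicator) (simp add: space_PiM)
    qed
    also have "\<dots> = (\<integral>\<^sup>+\<omega>. 0 \<partial>M)" by (intro nn_integral_cong) (auto simp: indicator_def)
    finally have 0: "(\<integral>\<^sup>+\<omega>. indicator {\<omega> \<in> space M. J \<omega> = enat j} \<omega> * indicator {x. x j = 0} (P \<omega>) \<partial>M) = 0"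
      by simp
    have "(\<integral>\<^sup>+\<omega>. indicator {\<omega> \<in> space M. J \<omega> = enat j \<and> P \<omega> j = 0} \<omega> \<partial>M) = 0"
      unfolding 0[symmetric] by (intro nn_integral_cong) (auto simp: indicator_def)
    then have "AE \<omega> in M. indicator {\<omega> \<in> space M. J \<omega> = enat j \<and> P \<omega> j = 0} \<omega> = (0::ennreal)"
      by (subst (asm) nn_integral_0_iff_AE) measurable
    then show ?thesis by (rule AE_mp) (auto intro!: AE_I2 simp: indicator_def)
  qed
  then have "AE \<omega> in M. \<forall>j. \<not> (J \<omega> = enat j \<and> P \<omega> j = 0)" by (simp add: AE_all_countable)
  then show ?thesis
  proof eventually_elim
    case (elim \<omega>)
    then show ?case by (cases "J \<omega>") (auto simp: pick_def)
  qed
qed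

text \<open>Given \<open>P\<close>, nothing is picked with conditional probability one minus the
  total mass, and then \<open>Q = P\<close>. The additive form avoids subtraction in
  \<open>ennreal\<close>.\<close>

lemma nn_integral_dust:
  assumes [measurable]: "g \<in> borel_measurable seq_borel"
  shows "(\<integral>\<^sup>+\<omega>. indicator {0} (X \<omega>) * g (Q \<omega>) \<partial>M) + (\<integral>\<^sup>+\<omega>. (\<Sum>j. ennreal_seq (P \<omega>) j) * g (P \<omega>) \<partial>M) =
    (\<integral>\<^sup>+\<omega>. g (P \<omega>) \<partial>M)"
proof -
  have "(\<integral>\<^sup>+\<omega>. (\<Sum>j. ennreal_seq (P \<omega>) j) * g (P \<omega>) \<partial>M) =
      (\<Sum>j. \<integral>\<^sup>+\<omega>. ennreal (P \<omega> j) * g (P \<omega>) \<partial>M)"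
    by (subst nn_integral_suminf[symmetric]) (auto simp: ennreal_suminf_multc)
  also have "\<dots> = (\<Sum>j. \<integral>\<^sup>+\<omega>. indicator {\<omega> \<in> space M. J \<omega> = enat j} \<omega> * g (P \<omega>) \<partial>M)"
    by (intro suminf_cong nn_integral_size_biased_index[symmetric]) simp
  also have "\<dots> = (\<integral>\<^sup>+\<omega>. (\<Sum>j. indicator {\<omega> \<in> space M. J \<omega> = enat j} \<omega> * g (P \<omega>)) \<partial>M)"
    by (rule nn_integral_suminf[symmetric]) measurable
  also have "(\<integral>\<^sup>+\<omega>. indicator {0} (X \<omega>) * g (Q \<omega>) \<partial>M) + \<dots> =
      (\<integral>\<^sup>+\<omega>. indicator {0} (X \<omega>) * g (Q \<omega>) + (\<Sum>j. indicator {\<omega> \<in> space M. J \<omega> = enat j} \<omega> * g (P \<omega>)) \<partial>M)"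
    by (rule nn_integral_add[symmetric]) measurable
  also have "\<dots> = (\<integral>\<^sup>+\<omega>. g (P \<omega>) \<partial>M)"
  proof (rule nn_integral_cong_AE)
    show "AE \<omega> in M. indicator {0} (X \<omega>) * g (Q \<omega>) +
        (\<Sum>j. indicator {\<omega> \<in> space M. J \<omega> = enat j} \<omega> * g (P \<omega>)) = g (P \<omega>)"
      using AE_J_infinity_iff AE_space
    proof eventually_elim
      case (elim \<omega>)
      show ?case
      proof (cases "J \<omega>")
        case (enat n)
        have "(\<Sum>j. indicator {\<omega> \<in> space M. J \<omega> = enat j} \<omega> * g (P \<omega>)) = (\<Sum>j\<in>{n}. g (P \<omega>))"
          using elim by (subst suminf_finite[of "{n}"]) (auto simp: enat indicator_def)
        then show ?thesis using elim by (simp add: enat)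
      next
        case infinity
        then show ?thesis by (simp add: pick_def delete_renormalize_def)
      qed
    qed
  qed
  finally show ?thesis .
qed

end

text \<open>The preimages of measurable sets already form a sigma-algebra, so independence can be
  tested on them.\<close>

lemma (in prob_space) indep_random_variables_iff:
  assumes [measurable]: "X \<in> M \<rightarrow>\<^sub>M A" "Y \<in> M \<rightarrow>\<^sub>M B"
  shows "indep_random_variables M A X B Y \<longleftrightarrow>
    (\<forall>S\<in>sets A. \<forall>T\<in>sets B. prob ((X -` S \<inter> space M) \<inter> (Y -` T \<inter> space M)) =
      prob (X -` S \<inter> space M) * prob (Y -` T \<inter> space M))"
proof -
  have *: "sigma_sets (space M) {X -` S \<inter> space M |S. S \<in> sets A} = {X -` S \<inter> space M |S. S \<in> sets A}"
    if "X \<in> M \<rightarrow>\<^sub>M A" for X :: "'a \<Rightarrow> 'x" and A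
  proof -
    have "X \<in> space M \<rightarrow> space A" using that by (auto dest: measurable_space)
    from sets_vimage_algebra2[OF this] show ?thesis
      by (simp add: sets_vimage_algebra)
  qed
  show ?thesis
    unfolding indep_random_variables_def *[OF assms(1)] *[OF assms(2)] indep_sets2_eq using assms by auto blast+
qed

text \<open>Independence identifies the joint law with the product of the two image measures;
  Tonelli does the rest.\<close>

lemma (in prob_space) nn_integral_indep_random_variables:
  assumes indep: "indep_random_variables M A X B Y"
    and [measurable]: "f \<in> borel_measurable A" "g \<in> borel_measurable B"
  shows "(\<integral>\<^sup>+\<omega>. f (X \<omega>) * g (Y \<omega>) \<partial>M) = (\<integral>\<^sup>+\<omega>. f (X \<omega>) \<partial>M) * (\<integral>\<^sup>+\<omega>. g (Y \<omega>) \<partial>M)"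
proof -
  have XY [measurable]: "X \<in> M \<rightarrow>\<^sub>M A" "Y \<in> M \<rightarrow>\<^sub>M B"
    using indep by (auto simp: indep_random_variables_def)
  interpret X: prob_space "distr M A X" by (rule prob_space_distr) simp
  interpret Y: prob_space "distr M B Y" by (rule prob_space_distr) simp
  interpret XY: pair_sigma_finite "distr M A X" "distr M B Y" ..
  have "distr M A X \<Otimes>\<^sub>M distr M B Y = distr M (A \<Otimes>\<^sub>M B) (\<lambda>\<omega>. (X \<omega>, Y \<omega>))"
  proof (rule pair_measure_eqI)
    fix S T assume ST: "S \<in> sets (distr M A X)" "T \<in> sets (distr M B Y)"
    then have [measurable]: "S \<in> sets A" "T \<in> sets B" by auto
    have "(\<lambda>\<omega>. (X \<omega>, Y \<omega>)) -` (S \<times> T) \<inter> space M = (X -` S \<inter> space M) \<inter> (Y -` T \<inter> space M)" by auto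
    then show "emeasure (distr M A X) S * emeasure (distr M B Y) T =
        emeasure (distr M (A \<Otimes>\<^sub>M B) (\<lambda>\<omega>. (X \<omega>, Y \<omega>))) (S \<times> T)"
      using indep[unfolded indep_random_variables_iff[OF XY]] ST
      by (simp add: emeasure_distr emeasure_eq_measure ennreal_mult)
  qed (unfold_locales, auto)
  then have "(\<integral>\<^sup>+z. f (fst z) * g (snd z) \<partial>(distr M A X \<Otimes>\<^sub>M distr M B Y)) =
      (\<integral>\<^sup>+\<omega>. f (X \<omega>) * g (Y \<omega>) \<partial>M)" by (simp add: nn_integral_distr)
  moreover have "(\<integral>\<^sup>+z. f (fst z) * g (snd z) \<partial>(distr M A X \<Otimes>\<^sub>M distr M B Y)) =
      (\<integral>\<^sup>+x. f x \<partial>distr M A X) * (\<integral>\<^sup>+y. g y \<partial>distr M B Y)"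
    by (subst Y.nn_integral_fst[symmetric]) (auto simp: nn_integral_cmult nn_integral_multc)
  ultimately show ?thesis by (simp add: nn_integral_distr)
qed

section \<open>Deletion from a Poisson--Dirichlet sequence\<close>

context size_biased_deletion
begin

lemma measurable_distinct_sum_P [measurable]:
  "(\<lambda>\<omega>. distinct_sum ns (ennreal_seq (P \<omega>))) \<in> borel_measurable M"
  "(\<lambda>\<omega>. distinct_sum ns (ennreal_seq (Q \<omega>))) \<in> borel_measurable M"
  by (rule measurable_compose[OF P measurable_distinct_sum] measurable_compose[OF Q measurable_distinct_sum])+

lemma X_bounds: "AE \<omega> in M. 0 \<le> X \<omega> \<and> X \<omega> < 1"
  using P_ranked P_less_1
proof eventually_elim
  case (elim \<omega>)
  then show ?case by (cases "J \<omega>") (auto simp: pick_def ranked_frequencies_nonneg)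
qed

lemma X_pos:
  assumes sum: "(\<integral>\<^sup>+\<omega>. (\<Sum>j. ennreal_seq (P \<omega>) j) \<partial>M) = 1"
  shows "AE \<omega> in M. 0 < X \<omega>"
proof -
  have "(\<integral>\<^sup>+\<omega>. indicator {0} (X \<omega>) * 1 \<partial>M) + 1 = (\<integral>\<^sup>+\<omega>. 1 \<partial>M)"
    using nn_integral_dust[OF borel_measurable_const[of 1]] unfolding mult_1_right sum .
  then have "(\<integral>\<^sup>+\<omega>. indicator {0} (X \<omega>) \<partial>M) + 1 = 0 + 1"
    by (simp only: mult_1_right nn_integral_const emeasure_space_1 add_0 mult_1_left)
  then have "(\<integral>\<^sup>+\<omega>. indicator {0} (X \<omega>) \<partial>M) = 0" by (rule ennreal_add_right_cancelD[rotated]) simp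
  then have "AE \<omega> in M. indicator {0} (X \<omega>) = (0::ennreal)" by (subst (asm) nn_integral_0_iff_AE) measurable
  with X_bounds show ?thesis
  proof eventually_elim
    case (elim \<omega>)
    have "X \<omega> \<noteq> 0" using elim(2) by (metis indicator_eq_0_iff singletonI)
    then show ?case using elim(1) by linarith
  qed
qed

text \<open>Size-biasing supplies the extra power in \<open>Suc r\<close>, and the picked term
  becomes one more distinct index.\<close>

lemma nn_integral_deletion_moment:
  assumes ns: "\<forall>n\<in>set ns. 0 < n"
  shows "(\<integral>\<^sup>+\<omega>. indicator {0<..} (X \<omega>) * ennreal (X \<omega>) ^ r * ennreal (1 - X \<omega>) ^ sum_list ns *
      distinct_sum ns (ennreal_seq (Q \<omega>)) \<partial>M) =
    (\<integral>\<^sup>+\<omega>. distinct_sum (Suc r # ns) (ennreal_seq (P \<omega>)) \<partial>M)"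
  using nn_integral_deletion[of "\<lambda>x. ennreal x ^ r" ns] ns by (simp add: mult.assoc)

context
  fixes \<alpha> \<theta> :: real
  assumes params: "PD_parameters \<alpha> \<theta>" and law: "distr M seq_borel P = PD \<alpha> \<theta>"
begin

lemma nn_integral_P_PD:
  assumes "\<forall>n\<in>set ns. 0 < n"
  shows "(\<integral>\<^sup>+\<omega>. distinct_sum ns (ennreal_seq (P \<omega>)) \<partial>M) = ennreal (PD_moment \<alpha> \<theta> ns)"
  using nn_integral_PD[OF params assms] by (simp add: law[symmetric] nn_integral_distr)

text \<open>The shift could fail only for \<open>\<alpha> < 0\<close> and \<open>m = 1\<close>.
  There the expected sum of squares is 1, which is impossible when all frequencies are almost surely
  below 1.\<close>

lemma PD_parameters_shift: "PD_parameters \<alpha> (\<theta> + \<alpha>)"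
proof (rule ccontr)
  assume not: "\<not> PD_parameters \<alpha> (\<theta> + \<alpha>)"
  have "\<not> (0 \<le> \<alpha> \<and> \<alpha> < 1 \<and> - \<alpha> < \<theta>)" using not by (auto simp: PD_parameters_def)
  then obtain m where m: "\<alpha> < 0" "1 \<le> m" "\<theta> = - real m * \<alpha>" using params by (auto simp: PD_parameters_def)
  have "m = 1"
  proof (rule ccontr)
    assume "m \<noteq> 1"
    then have "PD_parameters \<alpha> (\<theta> + \<alpha>)" using m unfolding PD_parameters_def
      by (intro disjI2 conjI exI[of _ "m - 1"]) (auto simp: of_nat_diff algebra_simps)
    then show False using not by simp
  qed
  then have "PD_moment \<alpha> \<theta> [2] = 1" using m by (simp add: PD_moment_def)
  then have 1: "(\<integral>\<^sup>+\<omega>. distinct_sum [2] (ennreal_seq (P \<omega>)) \<partial>M) = 1" using nn_integral_P_PD[of "[2]"] by simp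
  have less: "AE \<omega> in M. distinct_sum [2] (ennreal_seq (P \<omega>)) < 1"
    using P_ranked P_less_1
  proof eventually_elim
    case (elim \<omega>)
    have "distinct_sum [2] (ennreal_seq (P \<omega>)) = ennreal (power_sums (P \<omega>) 1)"
      by (simp add: ennreal_power_sums[OF elim(1)] power_sum_def numeral_2_eq_2)
    also have "\<dots> < 1" using power_sums_le_power[OF elim(1), of 1] elim(2)
      by (auto simp: power_sums_nonneg intro: le_less_trans)
    finally show ?case .
  qed
  have "(\<integral>\<^sup>+\<omega>. distinct_sum [2] (ennreal_seq (P \<omega>)) \<partial>M) + (\<integral>\<^sup>+\<omega>. 1 - distinct_sum [2] (ennreal_seq (P \<omega>)) \<partial>M) =
      (\<integral>\<^sup>+\<omega>. distinct_sum [2] (ennreal_seq (P \<omega>)) + (1 - distinct_sum [2] (ennreal_seq (P \<omega>))) \<partial>M)"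
    by (rule nn_integral_add[symmetric]) measurable
  also have "\<dots> = (\<integral>\<^sup>+\<omega>. 1 \<partial>M)"
    using less by (intro nn_integral_cong_AE) (auto elim!: eventually_mono simp: add_diff_inverse_ennreal)
  finally have "(\<integral>\<^sup>+\<omega>. 1 - distinct_sum [2] (ennreal_seq (P \<omega>)) \<partial>M) = 0"
    unfolding 1 by (simp add: emeasure_space_1 del: distinct_sum.simps)
  then have "AE \<omega> in M. 1 - distinct_sum [2] (ennreal_seq (P \<omega>)) = 0"
    by (subst (asm) nn_integral_0_iff_AE) measurable
  with less have "AE \<omega> in M. False" by eventually_elim (auto simp: diff_eq_0_iff_ennreal)
  then show False by simp
qed

lemma \<theta>_plus_\<alpha>_pos: "0 < \<theta> + \<alpha>" and \<alpha>_less_1: "\<alpha> < 1"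
proof -
  show "\<alpha> < 1" using params by (auto simp: PD_parameters_def)
  show "0 < \<theta> + \<alpha>"
    using params PD_parameters_shift by (auto simp: PD_parameters_def mult_less_0_iff)
qed

lemma X_pos_PD: "AE \<omega> in M. 0 < X \<omega>"
  using nn_integral_P_PD[of "[1]"] by (intro X_pos) (simp add: PD_moment_def)

text \<open>For fixed \<open>ns\<close> only integrals carrying the weight
  \<open>(1 - X) ^ sum_list ns\<close> are known. Their moments in \<open>X\<close> determine a
  measure on the unit interval, and since \<open>X < 1\<close> the weight can be divided out
  afterwards.\<close>

lemma nn_integral_joint_PD:
  assumes A [measurable]: "A \<in> sets borel" and ns: "\<forall>n\<in>set ns. 0 < n"
  shows "(\<integral>\<^sup>+\<omega>. indicator A (X \<omega>) * distinct_sum ns (ennreal_seq (Q \<omega>)) \<partial>M) =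
    emeasure (beta_distribution (1 - \<alpha>) (\<theta> + \<alpha>)) A * ennreal (PD_moment \<alpha> (\<theta> + \<alpha>) ns)"
proof -
  let ?B = "beta_distribution (1 - \<alpha>) (\<theta> + \<alpha>)" and ?N = "sum_list ns"
  let ?c = "ennreal (PD_moment \<alpha> (\<theta> + \<alpha>) ns)"
  have [measurable_cong]: "sets ?B = sets borel" by (simp add: beta_distribution_def)
  have pos: "0 < 1 - \<alpha>" "0 < \<theta> + \<alpha>" using \<alpha>_less_1 \<theta>_plus_\<alpha>_pos by auto
  interpret B: prob_space ?B by (rule prob_space_beta_distribution[OF pos])
  have AEB: "AE u in ?B. 0 < u \<and> u < 1"
    unfolding beta_distribution_def by (subst AE_density) (auto intro!: AE_I2 simp: indicator_def split: if_splits)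
  define K1 where "K1 = distr (density M (\<lambda>\<omega>. ennreal (1 - X \<omega>) ^ ?N * distinct_sum ns (ennreal_seq (Q \<omega>)))) borel X"
  define K2 where "K2 = density ?B (\<lambda>u. ?c * ennreal (1 - u) ^ ?N)"
  have sets [measurable_cong, simp]: "sets K1 = sets borel" "sets K2 = sets borel"
    by (simp_all add: K1_def K2_def beta_distribution_def)
  have K1: "(\<integral>\<^sup>+x. f x \<partial>K1) = (\<integral>\<^sup>+\<omega>. f (X \<omega>) * (ennreal (1 - X \<omega>) ^ ?N * distinct_sum ns (ennreal_seq (Q \<omega>))) \<partial>M)"
    if [measurable]: "f \<in> borel_measurable borel" for f
    unfolding K1_def by (subst nn_integral_distr, simp, simp, subst nn_integral_density) (simp_all add: mult_ac)
  have K2: "(\<integral>\<^sup>+x. f x \<partial>K2) = ?c * (\<integral>\<^sup>+u. f u * ennreal (1 - u) ^ ?N \<partial>?B)"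
    if [measurable]: "f \<in> borel_measurable borel" for f
  proof -
    have "(\<integral>\<^sup>+x. f x \<partial>K2) = (\<integral>\<^sup>+u. ?c * (f u * ennreal (1 - u) ^ ?N) \<partial>?B)"
      unfolding K2_def by (subst nn_integral_density) (simp_all add: mult_ac)
    also have "\<dots> = ?c * (\<integral>\<^sup>+u. f u * ennreal (1 - u) ^ ?N \<partial>?B)" by (rule nn_integral_cmult) simp
    finally show ?thesis .
  qed
  have pow: "(\<lambda>x. ennreal x ^ r) \<in> borel_measurable borel" for r by measurable
  have m1: "(\<integral>\<^sup>+x. ennreal x ^ r \<partial>K1) = ennreal (PD_moment \<alpha> \<theta> (Suc r # ns))" for r
  proof -
    have "(\<integral>\<^sup>+x. ennreal x ^ r \<partial>K1) = (\<integral>\<^sup>+\<omega>. indicator {0<..} (X \<omega>) * ennreal (X \<omega>) ^ r * ennreal (1 - X \<omega>) ^ sum_list ns *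
      distinct_sum ns (ennreal_seq (Q \<omega>)) \<partial>M)"
      unfolding K1[OF pow]
      using X_pos_PD by (intro nn_integral_cong_AE) (auto elim!: eventually_mono simp: mult_ac)
    then show ?thesis using nn_integral_deletion_moment[OF ns, of r] nn_integral_P_PD[of "Suc r # ns"] ns by simp
  qed
  have m2: "(\<integral>\<^sup>+x. ennreal x ^ r \<partial>K2) = ennreal (PD_moment \<alpha> \<theta> (Suc r # ns))" for r
  proof -
    have "(\<integral>\<^sup>+x. ennreal x ^ r \<partial>K2) = ?c * ennreal (beta_moment \<alpha> \<theta> r ?N)"
      unfolding K2[OF pow] nn_integral_beta_distribution[OF pos]
      by (simp add: beta_moment_def)
    also have "\<dots> = ennreal (beta_moment \<alpha> \<theta> r ?N * PD_moment \<alpha> (\<theta> + \<alpha>) ns)"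
      using beta_moment_bounds[of \<alpha> \<theta> r ?N] pos by (subst mult.commute) (simp add: ennreal_mult')
    finally show ?thesis using PD_moment_Cons[of "Suc r" ns \<theta> \<alpha>] ns pos by simp
  qed
  have "K1 = K2"
  proof (rule finite_measure_eqI_moments)
    have "emeasure K (space K) = (\<integral>\<^sup>+x. ennreal x ^ 0 \<partial>K)" for K :: "real measure" by simp
    then show "finite_measure K1" "finite_measure K2"
      using m1[of 0] m2[of 0] by (auto intro!: finite_measureI)
    show "AE x in K1. x \<in> {0..1}"
    proof -
      have "AE \<omega> in M. 0 < ennreal (1 - X \<omega>) ^ ?N * distinct_sum ns (ennreal_seq (Q \<omega>)) \<longrightarrow> X \<omega> \<in> {0..1}"
        using X_bounds by eventually_elim auto
      then have "AE \<omega> in density M (\<lambda>\<omega>. ennreal (1 - X \<omega>) ^ ?N * distinct_sum ns (ennreal_seq (Q \<omega>))). X \<omega> \<in> {0..1}"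
        by (subst AE_density) auto
      then show ?thesis unfolding K1_def by (subst AE_distr_iff) (auto simp del: atLeastAtMost_iff)
    qed
    show "AE x in K2. x \<in> {0..1}"
    proof -
      have "AE u in ?B. 0 < ?c * ennreal (1 - u) ^ ?N \<longrightarrow> u \<in> {0..1}" using AEB by eventually_elim auto
      then show ?thesis unfolding K2_def by (subst AE_density) auto
    qed
    show "(\<integral>\<^sup>+x. ennreal x ^ n \<partial>K1) = (\<integral>\<^sup>+x. ennreal x ^ n \<partial>K2)" for n unfolding m1 m2 ..
  qed simp_all
  \<comment> \<open>Integrating this function against \<open>K1 = K2\<close> restricts to
    \<open>A\<close> and cancels the weight.\<close>
  define \<psi> where "\<psi> x = indicator A x * ennreal (1 / (1 - x)) ^ ?N" for x
  have \<psi> [measurable]: "\<psi> \<in> borel_measurable borel" unfolding \<psi>_def by measurable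
  have inv: "ennreal (1 / (1 - x)) ^ ?N * ennreal (1 - x) ^ ?N = 1" if "x < 1" for x
    using that by (simp flip: power_mult_distrib ennreal_mult')
  have "(\<integral>\<^sup>+\<omega>. indicator A (X \<omega>) * distinct_sum ns (ennreal_seq (Q \<omega>)) \<partial>M) = (\<integral>\<^sup>+x. \<psi> x \<partial>K1)"
    unfolding K1[OF \<psi>]
  proof (rule nn_integral_cong_AE)
    show "AE \<omega> in M. indicator A (X \<omega>) * distinct_sum ns (ennreal_seq (Q \<omega>)) =
        \<psi> (X \<omega>) * (ennreal (1 - X \<omega>) ^ ?N * distinct_sum ns (ennreal_seq (Q \<omega>)))"
      using X_bounds
    proof eventually_elim
      case (elim \<omega>)
      have "\<psi> (X \<omega>) * (ennreal (1 - X \<omega>) ^ ?N * distinct_sum ns (ennreal_seq (Q \<omega>))) =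
        indicator A (X \<omega>) * distinct_sum ns (ennreal_seq (Q \<omega>)) *
        (ennreal (1 / (1 - X \<omega>)) ^ ?N * ennreal (1 - X \<omega>) ^ ?N)"
        unfolding \<psi>_def by (simp only: mult_ac)
      then show ?case using inv[of "X \<omega>"] elim by simp
    qed
  qed
  also have "\<dots> = ?c * (\<integral>\<^sup>+u. \<psi> u * ennreal (1 - u) ^ ?N \<partial>?B)" unfolding \<open>K1 = K2\<close> by (rule K2[OF \<psi>])
  also have "(\<integral>\<^sup>+u. \<psi> u * ennreal (1 - u) ^ ?N \<partial>?B) = (\<integral>\<^sup>+u. indicator A u \<partial>?B)"
  proof (rule nn_integral_cong_AE)
    show "AE u in ?B. \<psi> u * ennreal (1 - u) ^ ?N = indicator A u"
      using AEB
    proof eventually_elim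
      case (elim u)
      then show ?case using inv[of u] unfolding \<psi>_def by (simp only: mult.assoc mult_1_right)
    qed
  qed
  also have "\<dots> = emeasure ?B A" by simp
  finally show ?thesis by (simp add: mult.commute)
qed

text \<open>Now \<open>A\<close> is fixed and the sequence varies: restricting \<open>Q\<close> to
  \<open>X \<in> A\<close> gives a finite measure on ranked sequences whose distinct-sum integrals
  are constant multiples of those of the Poisson--Dirichlet law.\<close>

lemma emeasure_joint_PD:
  assumes A [measurable]: "A \<in> sets borel" and B: "B \<in> sets seq_borel"
  shows "emeasure M ((X -` A \<inter> space M) \<inter> (Q -` B \<inter> space M)) =
    emeasure (beta_distribution (1 - \<alpha>) (\<theta> + \<alpha>)) A * emeasure (PD \<alpha> (\<theta> + \<alpha>)) B"
proof -
  let ?b = "emeasure (beta_distribution (1 - \<alpha>) (\<theta> + \<alpha>)) A" and ?PD = "PD \<alpha> (\<theta> + \<alpha>)"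
  have setsPD [measurable_cong, simp]: "sets ?PD = sets seq_borel" by (simp add: PD_def)
  interpret PD: prob_space ?PD by (rule prob_space_PD[OF PD_parameters_shift])
  interpret B: prob_space "beta_distribution (1 - \<alpha>) (\<theta> + \<alpha>)"
    using \<alpha>_less_1 \<theta>_plus_\<alpha>_pos by (intro prob_space_beta_distribution) auto
  define N1 where "N1 = distr (density M (\<lambda>\<omega>. indicator A (X \<omega>))) seq_borel Q"
  define N2 where "N2 = density ?PD (\<lambda>_. ?b)"
  have "N1 = N2"
  proof (rule ranked_measure_eqI)
    have "finite_measure (density M (\<lambda>\<omega>. indicator A (X \<omega>)))"
    proof (rule finite_measureI)
      have "emeasure (density M (\<lambda>\<omega>. indicator A (X \<omega>))) (space M) = (\<integral>\<^sup>+\<omega>. indicator A (X \<omega>) \<partial>M)"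
        by (simp add: emeasure_density cong: nn_integral_cong)
      also have "\<dots> \<le> (\<integral>\<^sup>+\<omega>. 1 \<partial>M)" by (intro nn_integral_mono) (auto simp: indicator_def)
      finally show "emeasure (density M (\<lambda>\<omega>. indicator A (X \<omega>))) (space (density M (\<lambda>\<omega>. indicator A (X \<omega>)))) \<noteq> \<infinity>"
        by (auto simp: emeasure_space_1 top_unique)
    qed
    then show "finite_measure N1" unfolding N1_def by (rule finite_measure.finite_measure_distr) simp
    show "finite_measure N2"
    proof (rule finite_measureI)
      have "emeasure N2 (space N2) = (\<integral>\<^sup>+x. 1 \<partial>N2)" by simp
      also have "\<dots> = ?b" unfolding N2_def by (subst nn_integral_density) (simp_all add: PD.emeasure_space_1)
      finally show "emeasure N2 (space N2) \<noteq> \<infinity>" by (simp add: B.emeasure_eq_measure)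
    qed
    show "sets N1 = sets seq_borel" "sets N2 = sets seq_borel" by (simp_all add: N1_def N2_def)
    show "AE x in N1. x \<in> ranked_frequencies"
      unfolding N1_def
    proof (subst AE_distr_iff)
      show "AE \<omega> in density M (\<lambda>\<omega>. indicator A (X \<omega>)). Q \<omega> \<in> ranked_frequencies"
        using Q_ranked by (subst AE_density) (auto elim!: eventually_mono)
    qed (simp_all add: space_PiM)
    show "AE x in N2. x \<in> ranked_frequencies"
      unfolding N2_def using AE_PD_ranked[OF PD_parameters_shift]
      by (subst AE_density) (auto elim!: eventually_mono)
    fix ns :: "nat list" assume ns: "\<forall>n\<in>set ns. 0 < n"
    have "(\<integral>\<^sup>+x. distinct_sum ns (ennreal_seq x) \<partial>N1) =
        (\<integral>\<^sup>+\<omega>. indicator A (X \<omega>) * distinct_sum ns (ennreal_seq (Q \<omega>)) \<partial>M)"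
      by (simp add: N1_def nn_integral_distr nn_integral_density)
    also have "\<dots> = ?b * ennreal (PD_moment \<alpha> (\<theta> + \<alpha>) ns)" by (rule nn_integral_joint_PD[OF A ns])
    also have "\<dots> = (\<integral>\<^sup>+x. distinct_sum ns (ennreal_seq x) \<partial>N2)"
      by (simp add: N2_def nn_integral_density nn_integral_cmult nn_integral_PD[OF PD_parameters_shift ns])
    finally show "(\<integral>\<^sup>+x. distinct_sum ns (ennreal_seq x) \<partial>N1) = (\<integral>\<^sup>+x. distinct_sum ns (ennreal_seq x) \<partial>N2)" .
  qed
  have "emeasure N1 B = (\<integral>\<^sup>+\<omega>. indicator A (X \<omega>) * indicator (Q -` B \<inter> space M) \<omega> \<partial>M)"
    unfolding N1_def using B by (simp add: emeasure_distr emeasure_density)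
  also have "\<dots> = (\<integral>\<^sup>+\<omega>. indicator ((X -` A \<inter> space M) \<inter> (Q -` B \<inter> space M)) \<omega> \<partial>M)"
    by (intro nn_integral_cong) (auto simp: indicator_def)
  also have "\<dots> = emeasure M ((X -` A \<inter> space M) \<inter> (Q -` B \<inter> space M))"
    using A B by (intro nn_integral_indicator sets.Int measurable_sets[OF X] measurable_sets[OF Q])
  finally show ?thesis
    unfolding \<open>N1 = N2\<close> N2_def using B by (simp add: emeasure_density nn_integral_cmult)
qed

text \<open>Taking one of the two sets in the product formula to be the whole space identifies both
  marginals.\<close>

lemma deletion_PD:
  shows "indep_random_variables M borel X seq_borel Q"
    and "distr M seq_borel Q = PD \<alpha> (\<theta> + \<alpha>)"
proof -
  let ?b = "beta_distribution (1 - \<alpha>) (\<theta> + \<alpha>)"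
  interpret PD: prob_space "PD \<alpha> (\<theta> + \<alpha>)" by (rule prob_space_PD[OF PD_parameters_shift])
  interpret B: prob_space ?b
    using \<alpha>_less_1 \<theta>_plus_\<alpha>_pos by (intro prob_space_beta_distribution) auto
  have sp: "space ?b = UNIV" "space (PD \<alpha> (\<theta> + \<alpha>)) = UNIV"
    by (simp_all add: beta_distribution_def PD_def space_PiM)
  have Q': "emeasure M (Q -` B \<inter> space M) = emeasure (PD \<alpha> (\<theta> + \<alpha>)) B" if "B \<in> sets seq_borel" for B
  proof -
    have "X -` UNIV \<inter> space M \<inter> (Q -` B \<inter> space M) = Q -` B \<inter> space M" by auto
    then show ?thesis using emeasure_joint_PD[of UNIV B] that B.emeasure_space_1 by (simp add: sp)
  qed
  have X': "emeasure M (X -` A \<inter> space M) = emeasure ?b A" if "A \<in> sets borel" for A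
  proof -
    have "X -` A \<inter> space M \<inter> (Q -` UNIV \<inter> space M) = X -` A \<inter> space M" by auto
    moreover have "UNIV \<in> sets seq_borel" using sets.top[of seq_borel] by (simp add: space_PiM)
    ultimately show ?thesis using emeasure_joint_PD[of A UNIV] that PD.emeasure_space_1 by (simp add: sp)
  qed
  show "distr M seq_borel Q = PD \<alpha> (\<theta> + \<alpha>)"
    by (rule measure_eqI) (simp_all add: PD_def[of \<alpha> "\<theta> + \<alpha>"] emeasure_distr Q'[unfolded PD_def])
  show "indep_random_variables M borel X seq_borel Q"
    unfolding indep_random_variables_iff[OF X Q]
  proof (intro ballI)
    fix A B assume AB: "A \<in> sets (borel::real measure)" "B \<in> sets seq_borel"
    have "ennreal (prob (X -` A \<inter> space M \<inter> (Q -` B \<inter> space M))) =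
        ennreal (prob (X -` A \<inter> space M) * prob (Q -` B \<inter> space M))"
      using emeasure_joint_PD[OF AB] X'[OF AB(1)] Q'[OF AB(2)]
      by (simp add: emeasure_eq_measure ennreal_mult)
    then show "prob (X -` A \<inter> space M \<inter> (Q -` B \<inter> space M)) =
        prob (X -` A \<inter> space M) * prob (Q -` B \<inter> space M)"
      by (subst (asm) ennreal_inj) auto
  qed
qed

end
end

section \<open>The moment equations\<close>

text \<open>On the level \<open>r + s = n\<close> the difference of two solutions alternates in sign, so a single
  instance of the symmetry relation makes it vanish.\<close>

lemma symmetric_moments_unique:
  fixes A A' :: "nat \<Rightarrow> nat \<Rightarrow> real" and B B' :: "nat \<Rightarrow> real"
  assumes add: "\<And>r s. A r s = A (Suc r) s + A r (Suc s)" "\<And>r s. A' r s = A' (Suc r) s + A' r (Suc s)"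
    and sym: "\<And>r s. A r s * B s = A s r * B r" "\<And>r s. A' r s * B' s = A' s r * B' r"
    and init: "A 0 0 = A' 0 0" "B 0 = B' 0" "B 1 = B' 1" "B 2 = B' 2"
    and pos: "\<And>s. 0 < A 0 s" "\<And>s. 0 < B s" and dec: "\<And>s. B (Suc s) < B s"
  shows "A r s = A' r s"
proof -
  define D where "D r s = A r s - A' r s" for r s
  have D_add: "D r s = D (Suc r) s + D r (Suc s)" for r s
    using add[of r s] by (simp add: D_def)
  have D_sym: "D r s * B s = D s r * B r" if "B r = B' r" "B s = B' s" for r s
    using sym[of r s] that by (simp add: D_def left_diff_distrib)
  have antimono: "B s < B r" if "r < s" for r s
    using lift_Suc_mono_less[of "\<lambda>n. - B n", OF _ that] dec by simp
  have level: "D r s = (- 1) ^ r * D 0 (Suc n)" if "\<And>r s. r + s = n \<Longrightarrow> D r s = 0" "r + s = Suc n" for n r s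
    using that(2)
  proof (induction r arbitrary: s)
    case (Suc r)
    have "D (Suc r) s = - D r (Suc s)" using D_add[of r s] that(1)[of r s] Suc.prems by simp
    then show ?case using Suc.IH[of "Suc s"] Suc.prems by simp
  qed simp
  have next_level: "D r s = 0" if "\<And>r s. r + s = n \<Longrightarrow> D r s = 0" "D 0 (Suc n) = 0" "r + s = Suc n" for n r s
    using level[OF that(1,3)] that(2) by simp
  have *: "(\<forall>k\<le>n. B k = B' k) \<and> (\<forall>m\<le>n. \<forall>r s. r + s = m \<longrightarrow> D r s = 0)" if "2 \<le> n" for n
    using that
  proof (induction n rule: dec_induct)
    \<comment> \<open>Levels 1 and 2 use the pairs (0,1) and (0,2), whose values of \<open>B\<close>
      are given. From level 3 on the pair (1,n) is used, because \<open>B (Suc n)\<close> is not yet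
      known to agree.\<close>
    case base
    have 0: "D r s = 0" if "r + s = 0" for r s using that init(1) by (simp add: D_def)
    have "D 1 0 = - D 0 1" using level[of 0 1 0] 0 by simp
    then have "D 0 1 * (B 1 + B 0) = 0" using D_sym[of 0 1] init by (simp add: algebra_simps)
    then have "D 0 (Suc 0) = 0" using pos(2)[of 0] pos(2)[of 1] by simp
    note 1 = next_level[OF 0 this]
    have "D 2 0 = D 0 2" using level[of 1 2 0] 1 by (simp add: numeral_2_eq_2)
    then have "D 0 2 * (B 2 - B 0) = 0" using D_sym[of 0 2] init by (simp add: algebra_simps)
    then have "D 0 (Suc (Suc 0)) = 0" using antimono[of 0 2] by (simp add: numeral_2_eq_2)
    note 2 = next_level[OF 1 this]
    show ?case using 0 1 2 init by (auto simp: le_Suc_eq numeral_2_eq_2)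
  next
    case (step n)
    have B: "\<And>k. k \<le> n \<Longrightarrow> B k = B' k" and D: "\<And>r s. r + s \<le> n \<Longrightarrow> D r s = 0" using step.IH by auto
    have "D 1 n * B n = D n 1 * B 1" using D_sym[of 1 n] B step.hyps by simp
    \<comment> \<open>Both differences are multiples of \<open>D 0 (Suc n)\<close>, with signs -1
      and \<open>(- 1) ^ n\<close>. For odd \<open>n\<close> the bracket is
      \<open>B n - B 1\<close>, nonzero by strict decrease since \<open>n \<ge> 2\<close>.\<close>
    then have "D 0 (Suc n) * (B n + (- 1) ^ n * B 1) = 0"
      using level[of n 1 n] level[of n n 1] D by (simp add: algebra_simps)
    moreover have "B n + (- 1) ^ n * B 1 \<noteq> 0"
      using antimono[of 1 n] pos(2)[of n] pos(2)[of 1] step.hyps by (cases "even n") auto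
    ultimately have D0: "D 0 (Suc n) = 0" by simp
    have D': "D r s = 0" if "r + s = Suc n" for r s using next_level[OF D D0 that] by simp
    \<comment> \<open>Once the level is settled, the pair (0,n+1) yields the next value of
      \<open>B\<close>.\<close>
    have "A 0 (Suc n) * B (Suc n) = A 0 (Suc n) * B' (Suc n)"
      using sym[of 0 "Suc n"] D'[of 0 "Suc n"] D'[of "Suc n" 0] init(2) by (simp add: D_def)
    then have "B (Suc n) = B' (Suc n)" using pos(1)[of "Suc n"] by simp
    then show ?case using B D D' by (auto simp: le_Suc_eq)
  qed
  have "D r s = 0" using *[of "r + s + 2"] le_add1[of "r + s" 2] le_add2[of 2 "r + s"] by blast
  then show ?thesis by (simp add: D_def)
qed

text \<open>The ratio is a product of factors \<open>1 - v / (x + v + i)\<close>, hence with a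
  harmonic gap.\<close>

lemma pochhammer_ratio_tendsto_0:
  assumes "0 < x" "0 < v"
  shows "(\<lambda>n. pochhammer x n / pochhammer (x + v) n :: real) \<longlonglongrightarrow> 0"
proof -
  have "(\<lambda>n. \<Prod>i<n. (x + real i) / (x + v + real i)) \<longlonglongrightarrow> 0"
  proof (rule prod_tendsto_0_if_harmonic_gap[where d = "v / (x + v + 1)"])
    fix i
    have "0 \<le> (x + v) * real i" using assms by simp
    then have "x + v + real i \<le> (x + v + 1) * (real i + 1)" unfolding distrib_left distrib_right by linarith
    then have "v / ((x + v + 1) * (real i + 1)) \<le> v / (x + v + real i)"
      using assms by (intro divide_left_mono) auto
    moreover have "(x + real i) / (x + v + real i) = 1 - v / (x + v + real i)"
      using assms by (simp add: field_simps)
    ultimately show "(x + real i) / (x + v + real i) \<le> 1 - v / (x + v + 1) / (real i + 1)" by simp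
  qed (use assms in auto)
  moreover have "(\<Prod>i<n. (x + real i) / (x + v + real i)) = pochhammer x n / pochhammer (x + v) n" for n
    by (induction n) (simp_all add: pochhammer_Suc)
  ultimately show ?thesis by simp
qed

lemma eq_if_same_increments:
  fixes f g :: "nat \<Rightarrow> real"
  assumes "\<And>n. f n - f (Suc n) = g n - g (Suc n)" "f \<longlonglongrightarrow> 0" "g \<longlonglongrightarrow> 0"
  shows "f n = g n"
proof -
  have const: "f n - g n = f 0 - g 0" for n
  proof (induction n)
    case (Suc n)
    then show ?case using assms(1)[of n] by simp
  qed simp
  have "(\<lambda>n. f n - g n) \<longlonglongrightarrow> 0" using tendsto_diff[OF assms(2,3)] by simp
  moreover have "(\<lambda>n. f n - g n) = (\<lambda>n. f 0 - g 0)" using const by (rule ext)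
  ultimately have "(\<lambda>n. f 0 - g 0) \<longlonglongrightarrow> 0" by (simp only:)
  then have "f 0 - g 0 = 0" by (simp add: LIMSEQ_const_iff)
  then show ?thesis using const[of n] by simp
qed

text \<open>The moments \<open>p\<close> of \<open>P\<close>, \<open>p'\<close> of \<open>Q\<close>, and \<open>a\<close> of the size-biased pick, when the pick is
  independent of \<open>Q\<close>.\<close>

locale deletion_moments =
  fixes p p' :: "nat list \<Rightarrow> real" and a :: "nat \<Rightarrow> nat \<Rightarrow> real"
  assumes p_Cons: "\<And>r ns. \<forall>n\<in>set ns. 0 < n \<Longrightarrow> p (Suc r # ns) = a r (sum_list ns) * p' ns"
    and p_move: "\<And>ns j. \<forall>n\<in>set ns. 0 < n \<Longrightarrow> j < length ns \<Longrightarrow> p ns = p (ns ! j # remove_nth j ns)"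
    and p_sum: "\<And>ns. \<forall>n\<in>set ns. 0 < n \<Longrightarrow> p ns = (\<Sum>j<length ns. p (ns[j := Suc (ns ! j)])) + p (1 # ns)"
    and a_add: "\<And>r s. a r s = a (Suc r) s + a r (Suc s)"
    and p_Nil: "p [] = 1" and p'_Nil: "p' [] = 1" and p'_1: "p' [1] = 1" and a_0_0: "a 0 0 = 1"
    and p_nonneg: "\<And>ns. 0 \<le> p ns" and a_pos: "\<And>r s. 0 < a r s"
    and p_pos: "\<And>r. 0 < r \<Longrightarrow> 0 < p [1, 1, r]"
    and a_lim: "(\<lambda>r. a r 0) \<longlonglongrightarrow> 0"
    and p'_logconvex: "p' [2] ^ 2 \<le> p' [3]"
begin

lemma p_swap:
  assumes "0 < r" "0 < s"
  shows "p [r, s] = p [s, r]"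
  using p_move[of "[r, s]" 1] assms by simp

lemma p_two: "p [Suc r, Suc s] = a r (Suc s) * p' [Suc s]"
  using p_Cons[of "[Suc s]" r] by simp

lemma b_pos: "0 < p' [Suc s]"
proof -
  have "p [1, Suc s] = p [2, Suc s] + p [1, Suc (Suc s)] + p [1, 1, Suc s]"
    using p_sum[of "[1, Suc s]"] by (simp add: lessThan_Suc numeral_2_eq_2)
  then have "0 < p [1, Suc s]"
    using p_pos[of "Suc s"] p_nonneg[of "[2, Suc s]"] p_nonneg[of "[1, Suc (Suc s)]"] by simp
  then show ?thesis using p_two[of 0 s] a_pos[of 0 "Suc s"] by (simp add: zero_less_mult_iff)
qed

text \<open>In the addition rule at \<open>[1, Suc s]\<close> the additivity of \<open>a\<close>
  leaves \<open>a 0 (s+2)\<close> times the decrease on one side and \<open>p [1, 1, Suc s]\<close>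
  on the other. Here three distinct positive frequencies are needed.\<close>

lemma b_less: "p' [Suc (Suc s)] < p' [Suc s]"
proof -
  have "p [1, Suc s] = p [2, Suc s] + p [1, Suc (Suc s)] + p [1, 1, Suc s]"
    using p_sum[of "[1, Suc s]"] by (simp add: lessThan_Suc numeral_2_eq_2)
  then have "a 0 (Suc s) * p' [Suc s] = a 1 (Suc s) * p' [Suc s] +
      a 0 (Suc (Suc s)) * p' [Suc (Suc s)] + p [1, 1, Suc s]"
    using p_two[of 0 s] p_two[of 1 s] p_two[of 0 "Suc s"] by (simp add: numeral_2_eq_2)
  then have "a 0 (Suc (Suc s)) * p' [Suc (Suc s)] < a 0 (Suc (Suc s)) * p' [Suc s]"
    using p_pos[of "Suc s"] a_add[of 0 "Suc s"] by (simp add: algebra_simps)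
  then show ?thesis using a_pos by (simp add: mult_less_cancel_left_pos)
qed

text \<open>The second argument is shifted because symmetry is available only for two positive
  exponents, where \<open>p [Suc r, Suc s]\<close> involves \<open>a r (Suc s)\<close>.\<close>

lemma a_eqI:
  assumes "\<And>r s. A' r s = A' (Suc r) s + A' r (Suc s)" "\<And>r s. A' r s * B' s = A' s r * B' r"
    and "A' 0 0 = a 0 1" "B' 0 = 1" "B' 1 = p' [2]" "B' 2 = p' [3]"
  shows "a r (Suc s) = A' r s"
proof (rule symmetric_moments_unique[of "\<lambda>r s. a r (Suc s)" A' "\<lambda>s. p' [Suc s]" B'])
  show "a r (Suc s) * p' [Suc s] = a s (Suc r) * p' [Suc r]" for r s
    using p_swap[of "Suc r" "Suc s"] by (simp add: p_two)
  show "a r (Suc s) = a (Suc r) (Suc s) + a r (Suc (Suc s))" for r s by (rule a_add)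
  show "A' r s = A' (Suc r) s + A' r (Suc s)" "A' r s * B' s = A' s r * B' r" for r s by fact+
qed (use assms(3-) a_pos b_pos b_less p'_1 in \<open>auto simp: numeral_2_eq_2 numeral_3_eq_3\<close>)

text \<open>The geometric solution of the system: the moments are those of a pick that is constantly
  \<open>x\<close>.\<close>

lemma degenerate_case:
  assumes eq: "p' [3] = p' [2] ^ 2"
  shows "\<exists>x. 0 < x \<and> p [2] = x \<and> p [3] = x ^ 2"
proof -
  define y where "y = p' [2]"
  have y: "0 < y" using b_pos[of 1] by (simp add: y_def numeral_2_eq_2)
  \<comment> \<open>With \<open>b\<close> geometric of ratio \<open>y\<close>, symmetry of
    \<open>x ^ r * (1 - x) ^ s * y ^ s\<close> in \<open>r\<close> and \<open>s\<close> requires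
    \<open>(1 - x) * y = x\<close>.\<close>
  define x where "x = y / (1 + y)"
  have x: "0 < x" "x < 1" "(1 - x) * y = x" "x \<noteq> 1" using y by (auto simp: x_def field_simps)
  have A: "a r (Suc s) = a 0 1 * x ^ r * (1 - x) ^ s" for r s
  proof (rule a_eqI[of _ "\<lambda>s. y ^ s"])
    fix r s
    show "a 0 1 * x ^ r * (1 - x) ^ s = a 0 1 * x ^ Suc r * (1 - x) ^ s + a 0 1 * x ^ r * (1 - x) ^ Suc s"
      by (simp add: algebra_simps)
    have "(1 - x) ^ k * y ^ k = x ^ k" for k using x(3) by (simp flip: power_mult_distrib)
    then have "a 0 1 * x ^ r * (1 - x) ^ s * y ^ s = a 0 1 * x ^ r * x ^ s"
      "a 0 1 * x ^ s * (1 - x) ^ r * y ^ r = a 0 1 * x ^ s * x ^ r" by (simp_all add: mult.assoc)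
    then show "a 0 1 * x ^ r * (1 - x) ^ s * y ^ s = a 0 1 * x ^ s * (1 - x) ^ r * y ^ r"
      by (simp only: mult_ac)
  qed (use eq in \<open>auto simp: y_def\<close>)
  define C where "C = a 0 1 / (1 - x)"
  have a0: "a r 0 = C * x ^ r" for r
  proof (rule eq_if_same_increments[OF _ a_lim])
    fix n
    have "C * (1 - x) = a 0 1" using x by (simp add: C_def)
    moreover have "C * x ^ n - C * x ^ Suc n = (C * (1 - x)) * x ^ n" by (simp add: algebra_simps)
    ultimately have "C * x ^ n - C * x ^ Suc n = a 0 1 * x ^ n" by (simp only:)
    then show "a n 0 - a (Suc n) 0 = C * x ^ n - C * x ^ Suc n" using a_add[of n 0] A[of n 0] by simp
  next
    show "(\<lambda>r. C * x ^ r) \<longlonglongrightarrow> 0" using x by (intro tendsto_mult_right_zero LIMSEQ_power_zero) auto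
  qed
  have "C = 1" using a0[of 0] a_0_0 by simp
  then have "p [2] = x" "p [3] = x ^ 2"
    using a0[of 1] a0[of 2] p_Cons[of "[]" 1] p_Cons[of "[]" 2] p'_Nil
    by (simp_all add: numeral_2_eq_2 numeral_3_eq_3)
  then show ?thesis using x by blast
qed

text \<open>Two values of \<open>p'\<close> fit the two parameters of a beta law; uniqueness does the rest. The
  positivity of \<open>\<theta> + \<alpha>\<close> comes from the total mass being finite.\<close>

lemma beta_case:
  assumes ne: "p' [2] ^ 2 < p' [3]"
  shows "\<exists>\<alpha> \<theta>. \<alpha> < 1 \<and> 0 < \<theta> + \<alpha> \<and> (\<forall>r s. a r s = beta_moment \<alpha> \<theta> r s)"
proof -
  define \<beta> where "\<beta> = p' [2]"
  define \<rho> where "\<rho> = p' [3] / \<beta>"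
  have \<beta>: "0 < \<beta>" "\<beta> < 1"
    using b_pos[of 1] b_less[of 0] p'_1 by (auto simp: \<beta>_def numeral_2_eq_2)
  have "p' [3] < \<beta>" using b_less[of 1] by (simp add: \<beta>_def numeral_2_eq_2 numeral_3_eq_3)
  then have \<rho>: "\<beta> < \<rho>" "\<rho> < 1" using \<beta> ne by (auto simp: \<rho>_def \<beta>_def field_simps power2_eq_square)
  \<comment> \<open>The ansatz \<open>b (Suc s) = pochhammer x s / pochhammer w s\<close> must match
    two values: \<open>x / w = \<beta>\<close> and \<open>(1 + x) / (1 + w) = \<rho>\<close>.
    Solving for \<open>w\<close> gives this quotient; strict log-convexity makes its denominator
    positive.\<close>
  define w where "w = (1 - \<rho>) / (\<rho> - \<beta>)"
  define x where "x = \<beta> * w"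
  have w: "0 < w" using \<rho> by (simp add: w_def)
  have x: "0 < x" using w \<beta> by (simp add: x_def)
  have w1: "(1 + x) / (1 + w) = \<rho>"
  proof -
    have "w * (\<rho> - \<beta>) = 1 - \<rho>" using \<rho> by (simp add: w_def)
    then have "1 + x = \<rho> * (1 + w)" by (simp add: x_def algebra_simps)
    then show ?thesis using w by simp
  qed
  define c where "c = a 0 1"
  have c: "0 < c" using a_pos by (simp add: c_def)
  have A: "a r (Suc s) = c * pochhammer x r * pochhammer w s / pochhammer (x + w) (r + s)" for r s
  proof (rule a_eqI[of _ "\<lambda>s. pochhammer x s / pochhammer w s"])
    fix r s
    have pos: "0 < pochhammer (x + w) (r + s)" "0 < x + w + real (r + s)"
      using x w by (auto intro!: pochhammer_pos add_pos_nonneg)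
    let ?K = "c * pochhammer x r * pochhammer w s" and ?T = "pochhammer (x + w) (r + s)"
      and ?E = "x + w + real (r + s)"
    have "c * pochhammer x (Suc r) * pochhammer w s / pochhammer (x + w) (Suc r + s) = ?K * (x + real r) / (?T * ?E)"
      by (simp add: pochhammer_Suc mult_ac)
    moreover have "c * pochhammer x r * pochhammer w (Suc s) / pochhammer (x + w) (r + Suc s) =
        ?K * (w + real s) / (?T * ?E)"
      by (simp add: pochhammer_Suc mult_ac)
    moreover have "?K * (x + real r) / (?T * ?E) + ?K * (w + real s) / (?T * ?E) = ?K * ?E / (?T * ?E)"
      by (simp add: add_divide_distrib[symmetric] distrib_left[symmetric] add_ac)
    ultimately show "?K / ?T =
      c * pochhammer x (Suc r) * pochhammer w s / pochhammer (x + w) (Suc r + s) +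
      c * pochhammer x r * pochhammer w (Suc s) / pochhammer (x + w) (r + Suc s)"
      using pos by simp
    have "0 < pochhammer w k" for k using w by (rule pochhammer_pos)
    then have "pochhammer w r \<noteq> 0" "pochhammer w s \<noteq> 0" by (simp_all add: less_imp_neq[symmetric])
    then show "c * pochhammer x r * pochhammer w s / pochhammer (x + w) (r + s) * (pochhammer x s / pochhammer w s) =
      c * pochhammer x s * pochhammer w r / pochhammer (x + w) (s + r) * (pochhammer x r / pochhammer w r)"
      by (simp add: add.commute)
  next
    show "pochhammer x 1 / pochhammer w 1 = p' [2]" using w by (simp add: x_def \<beta>_def)
    have "pochhammer x 2 / pochhammer w 2 = (x / w) * ((1 + x) / (1 + w))"
      by (simp add: numeral_2_eq_2 pochhammer_Suc add.commute)
    also have "\<dots> = p' [3]" unfolding w1 using w \<beta> by (simp add: x_def \<rho>_def)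
    finally show "pochhammer x 2 / pochhammer w 2 = p' [3]" .
  qed (simp_all add: c_def)
  have sum_a: "(\<Sum>r<n. a r 1) \<le> 1" for n
  proof -
    have "(\<Sum>r<n. a r 1) = a 0 0 - a n 0"
    proof (induction n)
      case (Suc n)
      then show ?case using a_add[of n 0] by simp
    qed simp
    then show ?thesis using a_0_0 a_pos[of n 0] by simp
  qed
  \<comment> \<open>The number \<open>w - 1\<close> becomes \<open>\<theta> + \<alpha>\<close>. For
    \<open>w \<le> 1\<close> the terms \<open>a r 1\<close> dominate a multiple of the harmonic
    series, against the bound \<open>sum_a\<close>, which comes from telescoping
    \<open>a r 0\<close>.\<close>
  have w_gt_1: "1 < w"
  proof (rule ccontr)
    assume "\<not> 1 < w"
    then have w1: "w \<le> 1" by simp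
    define K where "K = c * (x / (x + 1))"
    have K: "0 < K" using c x by (simp add: K_def)
    have "K * inverse (real (Suc r)) \<le> a r 1" for r
    proof -
      have "0 \<le> x * real r" using x by simp
      then have "x + real r \<le> (x + 1) * real (Suc r)" by (simp add: algebra_simps)
      then have "x / ((x + 1) * real (Suc r)) \<le> x / (x + real r)"
        using x by (intro divide_left_mono) (auto intro!: mult_pos_pos add_pos_nonneg)
      also have "\<dots> = pochhammer x r / pochhammer (x + 1) r"
      proof -
        have "x * pochhammer (x + 1) r = pochhammer x r * (x + real r)"
          using pochhammer_rec[of x r] pochhammer_Suc[of x r] by simp
        moreover have "0 < pochhammer (x + 1) r" "0 < x + real r" using x by (auto intro!: pochhammer_pos add_pos_nonneg)
        ultimately show ?thesis by (simp add: frac_eq_eq)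
      qed
      also have "\<dots> \<le> pochhammer x r / pochhammer (x + w) r"
      proof (rule divide_left_mono)
        show "pochhammer (x + w) r \<le> pochhammer (x + 1) r"
          using x w w1 by (induction r) (auto simp: pochhammer_Suc intro!: mult_mono less_imp_le[OF pochhammer_pos])
      qed (use x w in \<open>auto intro!: mult_pos_pos pochhammer_pos less_imp_le[OF pochhammer_pos]\<close>)
      finally have "c * (x / ((x + 1) * real (Suc r))) \<le> c * (pochhammer x r / pochhammer (x + w) r)"
        using c by (intro mult_left_mono) auto
      moreover have "c * (x / ((x + 1) * real (Suc r))) = K * inverse (real (Suc r))"
        unfolding K_def by (simp add: divide_inverse del: of_nat_Suc)
      moreover have "c * (pochhammer x r / pochhammer (x + w) r) = a r 1" using A[of r 0] by simp
      ultimately show ?thesis by (simp only:)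
    qed
    then have "(\<Sum>r<n. K * inverse (real (Suc r))) \<le> (\<Sum>r<n. a r 1)" for n by (intro sum_mono)
    then have "K * harm n \<le> 1" for n
      unfolding harm_altdef sum_distrib_left using sum_a[of n] by (rule order_trans)
    then have le: "harm n \<le> 1 / K" for n using K by (simp add: field_simps)
    have "\<forall>\<^sub>F n in sequentially. 1 / K < (harm n :: real)"
      using harm_at_top unfolding filterlim_at_top_dense by blast
    then obtain n where "1 / K < (harm n :: real)" by (auto simp: eventually_sequentially)
    then show False using le[of n] by simp
  qed
  define v where "v = w - 1"
  have v: "0 < v" using w_gt_1 by (simp add: v_def)
  have w_eq: "w = v + 1" by (simp add: v_def)
  \<comment> \<open>Chosen so that the increments of
    \<open>C * (pochhammer x r / pochhammer (x + v) r)\<close> are exactly \<open>a r 1\<close>; the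
    value \<open>a 0 0 = 1\<close> then forces \<open>C = 1\<close>.\<close>
  define C where "C = c * (x + v) / v"
  have shift: "c / pochhammer (x + w) n = C * v / pochhammer (x + v) (Suc n)" for n
    using v x by (simp add: C_def w_eq pochhammer_rec add.assoc)
  have a0: "a r 0 = C * (pochhammer x r / pochhammer (x + v) r)" for r
  proof (rule eq_if_same_increments[OF _ a_lim])
    fix n
    have pos: "0 < pochhammer (x + v) n" "0 < x + v + real n" using x v by (auto intro!: pochhammer_pos add_pos_nonneg)
    have eq: "pochhammer x n / pochhammer (x + v) n - pochhammer x (Suc n) / pochhammer (x + v) (Suc n) =
        pochhammer x n * v / pochhammer (x + v) (Suc n)"
    proof -
      let ?K = "pochhammer x n" and ?T = "pochhammer (x + v) n" and ?E = "x + v + real n"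
      have "?K / ?T - ?K * (x + real n) / (?T * ?E) = (?K * ?E - ?K * (x + real n)) / (?T * ?E)"
        using pos by (simp add: diff_divide_distrib)
      also have "?K * ?E - ?K * (x + real n) = ?K * v" by (simp add: algebra_simps)
      finally show ?thesis by (simp only: pochhammer_Suc)
    qed
    have "C * (pochhammer x n / pochhammer (x + v) n) - C * (pochhammer x (Suc n) / pochhammer (x + v) (Suc n)) =
        pochhammer x n * (C * v / pochhammer (x + v) (Suc n))"
      unfolding right_diff_distrib[symmetric] eq by simp
    also have "\<dots> = a n 1" unfolding shift[symmetric] using A[of n 0] by simp
    finally show "a n 0 - a (Suc n) 0 =
        C * (pochhammer x n / pochhammer (x + v) n) - C * (pochhammer x (Suc n) / pochhammer (x + v) (Suc n))"
      using a_add[of n 0] by simp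
  next
    show "(\<lambda>r. C * (pochhammer x r / pochhammer (x + v) r)) \<longlonglongrightarrow> 0"
      by (rule tendsto_mult_right_zero[OF pochhammer_ratio_tendsto_0[OF x v]])
  qed
  have C: "C = 1" using a0[of 0] a_0_0 by simp
  have "a r s = beta_moment (1 - x) (v + x - 1) r s" for r s
  proof (cases s)
    case 0
    then show ?thesis using a0[of r] by (simp add: beta_moment_def C add.commute)
  next
    case (Suc k)
    have "a r s = pochhammer x r * pochhammer w k * (c / pochhammer (x + w) (r + k))"
      using A[of r k] by (simp add: Suc)
    also have "\<dots> = pochhammer x r * (v * pochhammer (v + 1) k) / pochhammer (x + v) (r + Suc k)"
      unfolding shift C by (simp add: w_eq)
    finally show ?thesis by (simp add: beta_moment_def Suc pochhammer_rec[of v] add.commute)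
  qed
  then show ?thesis using x v by (intro exI[of _ "1 - x"] exI[of _ "v + x - 1"]) auto
qed

text \<open>For negative \<open>\<alpha>\<close> the factors \<open>\<theta> + l * \<alpha>\<close> in the moments of \<open>1, \<dots>, 1\<close> must not become
  negative, so one of them vanishes.\<close>

lemma PD_case:
  assumes \<alpha>: "\<alpha> < 1" "0 < \<theta> + \<alpha>" and a: "\<And>r s. a r s = beta_moment \<alpha> \<theta> r s"
  shows "PD_parameters \<alpha> \<theta>" and "\<And>ns. \<forall>n\<in>set ns. 0 < n \<Longrightarrow> p ns = PD_moment \<alpha> \<theta> ns"
proof -
  have \<theta>: "- 1 < \<theta>" using \<alpha> by simp
  have p_Suc: "p (Suc n # ns) = p (n # ns) * (real n - \<alpha>) / (real (n + sum_list ns) + \<theta>)"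
    if n: "0 < n" and ns: "\<forall>n\<in>set ns. 0 < n" for n ns
  proof -
    obtain m where m: "n = Suc m" using n gr0_implies_Suc by blast
    have "a (Suc m) s = a m s * (real (Suc m) - \<alpha>) / (real (Suc m + s) + \<theta>)" for s
      unfolding a beta_moment_def by (simp add: pochhammer_Suc algebra_simps)
    then show ?thesis unfolding m p_Cons[OF ns] by (simp add: mult_ac)
  qed
  \<comment> \<open>The rule for a new block is what the addition rule leaves after subtracting the
    growth of all existing blocks.\<close>
  have p_1: "p (1 # ns) = p ns * (\<theta> + real (length ns) * \<alpha>) / (real (sum_list ns) + \<theta>)"
    if ne: "ns \<noteq> []" and ns: "\<forall>n\<in>set ns. 0 < n" for ns
  proof -
    let ?N = "real (sum_list ns) + \<theta>"
    have "0 < sum_list ns" using ne ns by (cases ns) auto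
    then have N: "0 < ?N" using \<theta> by simp
    have "p (ns[j := Suc (ns ! j)]) = p ns * (real (ns ! j) - \<alpha>) / ?N" if j: "j < length ns" for j
    proof -
      have pos: "\<forall>n\<in>set (ns[j := Suc (ns ! j)]). 0 < n"
        using ns set_update_subset_insert[of ns j "Suc (ns ! j)"] by auto
      have rem: "remove_nth j (ns[j := Suc (ns ! j)]) = remove_nth j ns" by (simp add: remove_nth_def)
      have pos': "\<forall>n\<in>set (remove_nth j ns). 0 < n" "0 < ns ! j"
        using ns remove_nth_props(4)[OF j] j by auto
      have "p (ns[j := Suc (ns ! j)]) = p (Suc (ns ! j) # remove_nth j ns)"
        using p_move[OF pos, of j] j by (simp add: rem)
      also have "\<dots> = p ns * (real (ns ! j) - \<alpha>) / ?N"
        using p_Suc[OF pos'(2,1)] p_move[OF ns j] remove_nth_props(1,2)[OF j] by (simp add: of_nat_diff)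
      finally show ?thesis .
    qed
    then have S: "(\<Sum>j<length ns. p (ns[j := Suc (ns ! j)])) =
        (\<Sum>j<length ns. p ns * (real (ns ! j) - \<alpha>) / ?N)" by (intro sum.cong) auto
    have "p ns = (\<Sum>j<length ns. p ns * (real (ns ! j) - \<alpha>) / ?N) + p (1 # ns)"
      using p_sum[OF ns] unfolding S .
    also have "(\<Sum>j<length ns. p ns * (real (ns ! j) - \<alpha>) / ?N) =
        p ns * (\<Sum>j<length ns. real (ns ! j) - \<alpha>) / ?N"
      by (simp add: sum_divide_distrib sum_distrib_left)
    also have "(\<Sum>j<length ns. real (ns ! j) - \<alpha>) = real (sum_list ns) - real (length ns) * \<alpha>"
      by (simp add: sum_subtractf sum_list_sum_nth atLeast0LessThan)
    finally have "p (1 # ns) = p ns - p ns * (real (sum_list ns) - real (length ns) * \<alpha>) / ?N" by simp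
    then show ?thesis using N by (simp add: field_simps)
  qed
  \<comment> \<open>The two rules generate every list: a new entry starts at 1 and is raised step by
    step. Singletons come directly from \<open>p_Cons\<close>.\<close>
  show eq: "p ns = PD_moment \<alpha> \<theta> ns" if "\<forall>n\<in>set ns. 0 < n" for ns
    using that
  proof (induction ns)
    case (Cons n ns)
    have ns: "\<forall>n\<in>set ns. 0 < n" "0 < n" using Cons.prems by auto
    show ?case
    proof (cases "ns = []")
      case True
      obtain m where "n = Suc m" using ns gr0_implies_Suc by blast
      then show ?thesis
        using True p_Cons[of "[]" m] PD_moment_Cons[of n "[]" \<theta> \<alpha>] \<alpha> \<theta> p'_Nil by (simp add: a)
    next
      case False
      from ns(2) show ?thesis
      proof (induction n rule: nat_induct_non_zero)
        case 1
        then show ?case using p_1[OF False ns(1)] PD_moment_Cons_1[OF False ns(1) \<theta>] Cons.IH[OF ns(1)] by simp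
      next
        case (Suc n)
        then show ?case using p_Suc[OF _ ns(1)] PD_moment_Suc[OF _ \<theta>] by simp
      qed
    qed
  qed (simp add: p_Nil)
  show "PD_parameters \<alpha> \<theta>"
  proof (cases "0 \<le> \<alpha>")
    case True
    then show ?thesis using \<alpha> by (simp add: PD_parameters_def)
  next
    case False
    have "\<exists>k\<ge>1. \<theta> + real k * \<alpha> = 0"
    proof (rule ccontr)
      assume "\<not> (\<exists>k\<ge>1. \<theta> + real k * \<alpha> = 0)"
      then have ne: "\<And>k. 1 \<le> k \<Longrightarrow> \<theta> + real k * \<alpha> \<noteq> 0" by blast
      have "0 < p (replicate (Suc k) 1) \<and> 0 < \<theta> + real (Suc k) * \<alpha>" for k
      proof (induction k)
        case 0
        show ?case using eq[of "[1]"] \<alpha> by (simp add: PD_moment_def)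
      next
        case (Suc k)
        have step: "p (1 # replicate n 1) = p (replicate n 1) * (\<theta> + real n * \<alpha>) / (real n + \<theta>)"
          if "0 < n" for n using p_1[of "replicate n 1"] that by (simp add: sum_list_replicate)
        have "0 < p (replicate (Suc (Suc k)) 1)"
          using step[of "Suc k"] Suc \<theta> by simp
        moreover have "0 \<le> p (replicate (Suc (Suc (Suc k))) 1)" by (rule p_nonneg)
        ultimately have "0 \<le> \<theta> + real (Suc (Suc k)) * \<alpha>"
          using step[of "Suc (Suc k)"] \<theta> by (simp add: zero_le_mult_iff zero_le_divide_iff)
        then show ?case using ne[of "Suc (Suc k)"] \<open>0 < p (replicate (Suc (Suc k)) 1)\<close> by simp
      qed
      then have pos: "0 < \<theta> + real (Suc k) * \<alpha>" for k by blast
      obtain k where "\<theta> / (- \<alpha>) < real k" using reals_Archimedean2 by blast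
      then have "\<theta> < real k * (- \<alpha>)" using False by (subst (asm) pos_divide_less_eq) auto
      then have "\<theta> + real k * \<alpha> < 0" by simp
      moreover have "real (Suc k) * \<alpha> \<le> real k * \<alpha>" using False by (intro mult_right_mono_neg) auto
      ultimately show False using pos[of k] by simp
    qed
    then show ?thesis using False unfolding PD_parameters_def by (intro disjI2 conjI) (auto simp: eq_neg_iff_add_eq_0)
  qed
qed

lemma moments_dichotomy:
  "(\<exists>\<alpha> \<theta>. PD_parameters \<alpha> \<theta> \<and> (\<forall>ns. (\<forall>n\<in>set ns. 0 < n) \<longrightarrow> p ns = PD_moment \<alpha> \<theta> ns)) \<or>
   (\<exists>x. 0 < x \<and> p [2] = x \<and> p [3] = x ^ 2)"
proof (cases "p' [3] = p' [2] ^ 2")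
  case True
  then show ?thesis using degenerate_case by blast
next
  case False
  then have "p' [2] ^ 2 < p' [3]" using p'_logconvex by simp
  then obtain \<alpha> \<theta> where *: "\<alpha> < 1" "0 < \<theta> + \<alpha>" "\<And>r s. a r s = beta_moment \<alpha> \<theta> r s"
    using beta_case by blast
  show ?thesis using PD_case[OF *] by blast
qed

end

section \<open>Moments of the pick and of the remaining sequence\<close>

lemma (in prob_space) nn_integral_pos:
  assumes [measurable]: "f \<in> borel_measurable M" and "AE \<omega> in M. E \<omega> \<longrightarrow> 0 < f \<omega>" and "\<not> (AE \<omega> in M. \<not> E \<omega>)"
  shows "0 < (\<integral>\<^sup>+\<omega>. f \<omega> \<partial>M)"
proof (rule ccontr)
  assume "\<not> 0 < (\<integral>\<^sup>+\<omega>. f \<omega> \<partial>M)"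
  then have "AE \<omega> in M. f \<omega> = 0" by (subst nn_integral_0_iff_AE[symmetric]) (auto simp: not_less)
  with assms(2) have "AE \<omega> in M. \<not> E \<omega>" by eventually_elim auto
  then show False using assms(3) by blast
qed

text \<open>The first \<open>m\<close> terms already exhaust the mass 1.\<close>

lemma uniform_ranked:
  assumes x: "x \<in> ranked_frequencies" and m: "0 < m" "\<forall>k<m. x k = 1 / real m"
  shows "x = (\<lambda>k. if k < m then 1 / real m else 0)"
proof
  fix k
  show "x k = (if k < m then 1 / real m else 0)"
  proof (cases "k < m")
    case False
    have "(\<Sum>i<Suc k. x i) \<le> 1" using x unfolding ranked_frequencies_eq by blast
    moreover have "(\<Sum>i\<in>insert k {..<m}. x i) \<le> (\<Sum>i<Suc k. x i)"
      using False ranked_frequencies_nonneg[OF x] by (intro sum_mono2) auto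
    moreover have "(\<Sum>i\<in>insert k {..<m}. x i) = x k + 1" using False m by simp
    ultimately show ?thesis using ranked_frequencies_nonneg[OF x, of k] False by simp
  qed (use m in simp)
qed

context size_biased_deletion
begin

lemma distinct_sum_P_le_1:
  assumes "\<forall>n\<in>set ns. 0 < n"
  shows "(\<integral>\<^sup>+\<omega>. distinct_sum ns (ennreal_seq (P \<omega>)) \<partial>M) \<le> 1"
    and "(\<integral>\<^sup>+\<omega>. distinct_sum ns (ennreal_seq (Q \<omega>)) \<partial>M) \<le> 1"
proof -
  have *: "(\<integral>\<^sup>+\<omega>. distinct_sum ns (ennreal_seq (Y \<omega>)) \<partial>M) \<le> 1" if "AE \<omega> in M. Y \<omega> \<in> ranked_frequencies" for Y
  proof -
    have "(\<integral>\<^sup>+\<omega>. distinct_sum ns (ennreal_seq (Y \<omega>)) \<partial>M) \<le> (\<integral>\<^sup>+\<omega>. 1 \<partial>M)"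
      using that by (intro nn_integral_mono_AE)
        (auto elim!: eventually_mono intro!: distinct_sum_le_1 suminf_ennreal_seq_le_1 assms)
    then show ?thesis by (simp add: emeasure_space_1)
  qed
  show "(\<integral>\<^sup>+\<omega>. distinct_sum ns (ennreal_seq (P \<omega>)) \<partial>M) \<le> 1"
    "(\<integral>\<^sup>+\<omega>. distinct_sum ns (ennreal_seq (Q \<omega>)) \<partial>M) \<le> 1"
    by (rule *[OF P_ranked] *[OF Q_ranked])+
qed

definition P_moment :: "nat list \<Rightarrow> real" where
  "P_moment ns = enn2real (\<integral>\<^sup>+\<omega>. distinct_sum ns (ennreal_seq (P \<omega>)) \<partial>M)"

definition Q_moment :: "nat list \<Rightarrow> real" where
  "Q_moment ns = enn2real (\<integral>\<^sup>+\<omega>. distinct_sum ns (ennreal_seq (Q \<omega>)) \<partial>M)"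

text \<open>The indicator matters only for \<open>r = 0\<close>, where \<open>0 ^ 0 = 1\<close>
  would count the event that nothing is picked.\<close>

definition X_integral :: "nat \<Rightarrow> nat \<Rightarrow> ennreal" where
  "X_integral r s = (\<integral>\<^sup>+\<omega>. indicator {0<..} (X \<omega>) * ennreal (X \<omega>) ^ r * ennreal (1 - X \<omega>) ^ s \<partial>M)"

definition X_moment :: "nat \<Rightarrow> nat \<Rightarrow> real" where
  "X_moment r s = enn2real (X_integral r s)"

lemma ennreal_P_moment:
  "\<forall>n\<in>set ns. 0 < n \<Longrightarrow> ennreal (P_moment ns) = (\<integral>\<^sup>+\<omega>. distinct_sum ns (ennreal_seq (P \<omega>)) \<partial>M)"
  using distinct_sum_P_le_1(1)[of ns] unfolding P_moment_def by (intro ennreal_enn2real) (auto intro: le_less_trans)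

lemma ennreal_Q_moment:
  "\<forall>n\<in>set ns. 0 < n \<Longrightarrow> ennreal (Q_moment ns) = (\<integral>\<^sup>+\<omega>. distinct_sum ns (ennreal_seq (Q \<omega>)) \<partial>M)"
  using distinct_sum_P_le_1(2)[of ns] unfolding Q_moment_def by (intro ennreal_enn2real) (auto intro: le_less_trans)

lemma ennreal_X_moment: "ennreal (X_moment r s) = X_integral r s"
proof -
  have "X_integral r s \<le> (\<integral>\<^sup>+\<omega>. 1 \<partial>M)"
    unfolding X_integral_def
  proof (rule nn_integral_mono_AE)
    show "AE \<omega> in M. indicator {0<..} (X \<omega>) * ennreal (X \<omega>) ^ r * ennreal (1 - X \<omega>) ^ s \<le> 1"
      using X_bounds by eventually_elim (auto intro!: mult_le_one power_le_one simp: indicator_def)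
  qed
  then show ?thesis
    unfolding X_moment_def by (intro ennreal_enn2real) (auto simp: emeasure_space_1 intro: le_less_trans)
qed

lemma X_moment_nonneg: "0 \<le> X_moment r s" and P_moment_nonneg: "0 \<le> P_moment ns"
  and Q_moment_nonneg: "0 \<le> Q_moment ns"
  by (simp_all add: X_moment_def P_moment_def Q_moment_def)

lemma X_moment_add: "X_moment r s = X_moment (Suc r) s + X_moment r (Suc s)"
proof -
  have "X_integral r s = (\<integral>\<^sup>+\<omega>. indicator {0<..} (X \<omega>) * ennreal (X \<omega>) ^ Suc r * ennreal (1 - X \<omega>) ^ s +
      indicator {0<..} (X \<omega>) * ennreal (X \<omega>) ^ r * ennreal (1 - X \<omega>) ^ Suc s \<partial>M)"
    unfolding X_integral_def
  proof (rule nn_integral_cong_AE)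
    show "AE \<omega> in M. indicator {0<..} (X \<omega>) * ennreal (X \<omega>) ^ r * ennreal (1 - X \<omega>) ^ s =
      indicator {0<..} (X \<omega>) * ennreal (X \<omega>) ^ Suc r * ennreal (1 - X \<omega>) ^ s +
      indicator {0<..} (X \<omega>) * ennreal (X \<omega>) ^ r * ennreal (1 - X \<omega>) ^ Suc s"
      using X_bounds
    proof eventually_elim
      case (elim \<omega>)
      have one: "ennreal (X \<omega>) + ennreal (1 - X \<omega>) = 1" using elim by (simp flip: ennreal_plus)
      have "indicator {0<..} (X \<omega>) * ennreal (X \<omega>) ^ Suc r * ennreal (1 - X \<omega>) ^ s +
        indicator {0<..} (X \<omega>) * ennreal (X \<omega>) ^ r * ennreal (1 - X \<omega>) ^ Suc s =
        indicator {0<..} (X \<omega>) * ennreal (X \<omega>) ^ r * ennreal (1 - X \<omega>) ^ s * (ennreal (X \<omega>) + ennreal (1 - X \<omega>))"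
        unfolding distrib_left power_Suc by (simp only: mult_ac)
      then show ?case unfolding one by simp
    qed
  qed
  also have "\<dots> = X_integral (Suc r) s + X_integral r (Suc s)"
    unfolding X_integral_def by (rule nn_integral_add) measurable
  finally have "ennreal (X_moment r s) = ennreal (X_moment (Suc r) s + X_moment r (Suc s))"
    by (simp add: ennreal_X_moment X_moment_nonneg)
  then show ?thesis by (subst (asm) ennreal_inj) (auto intro: X_moment_nonneg add_nonneg_nonneg)
qed

text \<open>Dominated convergence; a pick equal to 1 with positive probability would leave a
  positive limit.\<close>

lemma X_moment_lim: "(\<lambda>r. X_moment r 0) \<longlonglongrightarrow> 0"
proof -
  have eq: "X_moment r 0 = (\<integral>\<omega>. indicator {0<..} (X \<omega>) * X \<omega> ^ r \<partial>M)" for r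
  proof -
    have "X_integral r 0 = (\<integral>\<^sup>+\<omega>. ennreal (indicator {0<..} (X \<omega>) * X \<omega> ^ r) \<partial>M)"
      unfolding X_integral_def using X_bounds
      by (intro nn_integral_cong_AE) (auto elim!: eventually_mono simp: ennreal_power indicator_def)
    then show ?thesis
      unfolding X_moment_def using X_bounds
      by (subst integral_eq_nn_integral) (auto elim!: eventually_mono)
  qed
  have "(\<lambda>r. \<integral>\<omega>. indicator {0<..} (X \<omega>) * X \<omega> ^ r \<partial>M) \<longlonglongrightarrow> (\<integral>\<omega>. 0 \<partial>M)"
  proof (rule integral_dominated_convergence[where w = "\<lambda>_. 1"])
    show "AE \<omega> in M. (\<lambda>r. indicator {0<..} (X \<omega>) * X \<omega> ^ r) \<longlonglongrightarrow> 0"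
      using X_bounds by eventually_elim (intro tendsto_mult_right_zero LIMSEQ_power_zero, auto)
    show "AE \<omega> in M. norm (indicator {0<..} (X \<omega>) * X \<omega> ^ r) \<le> 1" for r
      using X_bounds by eventually_elim (auto simp: indicator_def power_le_one)
  qed auto
  then show ?thesis by (simp add: eq)
qed

lemma P_moment_move:
  assumes "\<forall>n\<in>set ns. 0 < n" "j < length ns"
  shows "P_moment ns = P_moment (ns ! j # remove_nth j ns)"
  unfolding P_moment_def using distinct_sum_move[OF assms] by simp

lemma power_sum_1_P: "(\<Sum>j. ennreal_seq (P \<omega>) j) = power_sum 1 (ennreal_seq (P \<omega>))"
  by (simp add: power_sum_def)

text \<open>The total mass is the first power sum, so multiplying by it either opens an index with
  exponent 1 or raises one exponent by 1.\<close>

lemma integral_sum_P_mult: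
  assumes ns: "\<forall>n\<in>set ns. 0 < n"
  shows "(\<integral>\<^sup>+\<omega>. (\<Sum>j. ennreal_seq (P \<omega>) j) * distinct_sum ns (ennreal_seq (P \<omega>)) \<partial>M) =
    ennreal ((\<Sum>j<length ns. P_moment (ns[j := Suc (ns ! j)])) + P_moment (1 # ns))"
proof -
  have pos: "\<forall>n\<in>set (ns[j := Suc (ns ! j)]). 0 < n" for j
    using ns set_update_subset_insert[of ns j "Suc (ns ! j)"] by auto
  have "(\<integral>\<^sup>+\<omega>. (\<Sum>j. ennreal_seq (P \<omega>) j) * distinct_sum ns (ennreal_seq (P \<omega>)) \<partial>M) =
      (\<integral>\<^sup>+\<omega>. distinct_sum (1 # ns) (ennreal_seq (P \<omega>)) +
        (\<Sum>j<length ns. distinct_sum (ns[j := Suc (ns ! j)]) (ennreal_seq (P \<omega>))) \<partial>M)"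
    unfolding power_sum_1_P power_sum_mult_distinct_sum[OF zero_less_one ns] by simp
  also have "\<dots> = (\<integral>\<^sup>+\<omega>. distinct_sum (1 # ns) (ennreal_seq (P \<omega>)) \<partial>M) +
      (\<integral>\<^sup>+\<omega>. (\<Sum>j<length ns. distinct_sum (ns[j := Suc (ns ! j)]) (ennreal_seq (P \<omega>))) \<partial>M)"
    by (rule nn_integral_add) measurable
  also have "(\<integral>\<^sup>+\<omega>. (\<Sum>j<length ns. distinct_sum (ns[j := Suc (ns ! j)]) (ennreal_seq (P \<omega>))) \<partial>M) =
      (\<Sum>j<length ns. \<integral>\<^sup>+\<omega>. distinct_sum (ns[j := Suc (ns ! j)]) (ennreal_seq (P \<omega>)) \<partial>M)"
    by (rule nn_integral_sum) measurable
  also have "\<dots> = (\<Sum>j<length ns. ennreal (P_moment (ns[j := Suc (ns ! j)])))"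
    by (intro sum.cong refl ennreal_P_moment[symmetric] pos)
  also have "\<dots> = ennreal (\<Sum>j<length ns. P_moment (ns[j := Suc (ns ! j)]))"
    by (rule sum_ennreal) (rule P_moment_nonneg)
  also have "(\<integral>\<^sup>+\<omega>. distinct_sum (1 # ns) (ennreal_seq (P \<omega>)) \<partial>M) = ennreal (P_moment (1 # ns))"
    using ns by (intro ennreal_P_moment[symmetric]) simp
  finally show ?thesis
    by (simp only: ennreal_plus P_moment_nonneg sum_nonneg add.commute)
qed

lemma indep_if_X_const:
  assumes c: "AE \<omega> in M. X \<omega> = c"
  shows "indep_random_variables M borel X seq_borel Q"
  unfolding indep_random_variables_iff[OF X Q]
proof (intro ballI)
  fix S T assume ST: "S \<in> sets (borel::real measure)" "T \<in> sets seq_borel"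
  let ?A = "X -` S \<inter> space M" and ?B = "Q -` T \<inter> space M"
  have m: "?A \<in> events" "?B \<in> events" using ST by (auto intro: measurable_sets[OF X] measurable_sets[OF Q])
  show "prob (?A \<inter> ?B) = prob ?A * prob ?B"
  proof (cases "c \<in> S")
    case True
    have "prob (?A \<inter> ?B) = prob ?B"
      using c True m by (intro finite_measure_eq_AE) (auto elim!: eventually_mono)
    moreover have "prob ?A = prob (space M)"
      using c True m by (intro finite_measure_eq_AE) (auto elim!: eventually_mono)
    ultimately show ?thesis by (simp add: prob_space)
  next
    case False
    have "prob (?A \<inter> ?B) = prob {}"
      using c False m by (intro finite_measure_eq_AE) (auto elim!: eventually_mono)
    moreover have "prob ?A = prob {}"
      using c False m by (intro finite_measure_eq_AE) (auto elim!: eventually_mono)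
    ultimately show ?thesis by simp
  qed
qed

text \<open>The mass is exhausted, so one of the \<open>m\<close> equal terms is picked almost
  surely. The pick is constant, and a constant is independent of everything.\<close>

lemma uniform_case:
  fixes m :: nat
  assumes m: "3 \<le> m" and u: "AE \<omega> in M. \<forall>k<m. P \<omega> k = 1 / real m"
  shows "AE \<omega> in M. \<forall>k<m - 1. Q \<omega> k = 1 / real (m - 1)"
    and "indep_random_variables M borel X seq_borel Q"
proof -
  have eq: "AE \<omega> in M. P \<omega> = (\<lambda>k. if k < m then 1 / real m else 0)"
    using u P_ranked by eventually_elim (use m in \<open>auto intro!: uniform_ranked\<close>)
  have "(\<integral>\<^sup>+\<omega>. (\<Sum>j. ennreal_seq (P \<omega>) j) \<partial>M) = (\<integral>\<^sup>+\<omega>. 1 \<partial>M)"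
  proof (rule nn_integral_cong_AE)
    show "AE \<omega> in M. (\<Sum>j. ennreal_seq (P \<omega>) j) = 1"
      using eq
    proof eventually_elim
      case (elim \<omega>)
      have "(\<Sum>j. ennreal_seq (P \<omega>) j) = (\<Sum>j<m. ennreal (1 / real m))"
        unfolding elim by (subst suminf_finite[of "{..<m}"]) auto
      also have "\<dots> = ennreal (\<Sum>j<m. 1 / real m)" by (rule sum_ennreal) simp
      finally show ?case using m by simp
    qed
  qed
  then have "(\<integral>\<^sup>+\<omega>. (\<Sum>j. ennreal_seq (P \<omega>) j) \<partial>M) = 1" by (simp add: emeasure_space_1)
  note Xpos = X_pos[OF this]
  have J: "AE \<omega> in M. \<exists>j<m. J \<omega> = enat j \<and> P \<omega> = (\<lambda>k. if k < m then 1 / real m else 0)"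
    using Xpos eq
  proof eventually_elim
    case (elim \<omega>)
    then show ?case by (cases "J \<omega>") (auto simp: pick_def split: if_splits)
  qed
  have "AE \<omega> in M. X \<omega> = 1 / real m"
    using J by eventually_elim (auto simp: pick_def)
  then show "indep_random_variables M borel X seq_borel Q" by (rule indep_if_X_const)
  show "AE \<omega> in M. \<forall>k<m - 1. Q \<omega> k = 1 / real (m - 1)"
    using J
  proof eventually_elim
    case (elim \<omega>)
    then obtain j where j: "j < m" "J \<omega> = enat j" "P \<omega> = (\<lambda>k. if k < m then 1 / real m else 0)" by blast
    show ?case
    proof (intro allI impI)
      fix k assume k: "k < m - 1"
      have "1 / real m \<noteq> 0" "1 / real m \<noteq> 1" using m by auto
      then have "Q \<omega> k = 1 / real m / (1 - 1 / real m)"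
        using j(1) k by (auto simp: delete_renormalize_def j(2,3))
      also have "\<dots> = 1 / real (m - 1)" using m by (simp add: field_simps of_nat_diff)
      finally show "Q \<omega> k = 1 / real (m - 1)" .
    qed
  qed
qed

end

section \<open>Consequences of independence\<close>

text \<open>Summability allows only finitely many terms equal to \<open>t\<close>, and by
  monotonicity they precede the zeros; total mass 1 fixes their number.\<close>

lemma ranked_two_values:
  assumes x: "x \<in> ranked_frequencies" and t: "0 < t" and vals: "\<And>i. x i = 0 \<or> x i = t"
    and sum: "power_sums x 0 = 1"
  shows "\<exists>n. real n * t = 1 \<and> (\<forall>k<n. x k = t)"
proof -
  have x': "summable x" "decseq x" "\<And>i. 0 \<le> x i" using x by (auto simp: ranked_frequencies_def)
  have "\<forall>\<^sub>F i in sequentially. x i < t"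
    using summable_LIMSEQ_zero[OF x'(1)] t by (rule order_tendstoD(2))
  then obtain i where "x i < t" by (auto simp: eventually_sequentially)
  then have ex: "x i = 0" using vals[of i] by auto
  define n where "n = (LEAST i. x i = 0)"
  have n: "x n = 0" unfolding n_def using ex by (rule LeastI)
  have below: "x k = t" if "k < n" for k
    using vals[of k] not_less_Least[of k "\<lambda>i. x i = 0"] that by (auto simp: n_def)
  have above: "x k = 0" if "n \<le> k" for k
    using decseqD[OF x'(2) that] n x'(3)[of k] by simp
  have "x sums (\<Sum>k<n. x k)" by (rule sums_finite) (use above in \<open>auto simp: not_less\<close>)
  moreover have "(\<lambda>i. x i ^ Suc 0) sums 1" using power_sums_sums[OF x, of 0] sum by simp
  ultimately have "(\<Sum>k<n. x k) = 1" using sums_unique2 by auto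
  then have "real n * t = 1" using below by simp
  then show ?thesis using below by blast
qed

lemma (in prob_space) integral_power_sums:
  assumes Y [measurable]: "Y \<in> M \<rightarrow>\<^sub>M seq_borel" and ranked: "AE \<omega> in M. Y \<omega> \<in> ranked_frequencies"
  shows "integrable M (\<lambda>\<omega>. power_sums (Y \<omega>) m)"
    and "(\<integral>\<omega>. power_sums (Y \<omega>) m \<partial>M) = enn2real (\<integral>\<^sup>+\<omega>. distinct_sum [Suc m] (ennreal_seq (Y \<omega>)) \<partial>M)"
proof -
  have [measurable]: "(\<lambda>\<omega>. power_sums (Y \<omega>) m) \<in> borel_measurable M"
    using measurable_compose[OF measurable_compose[OF Y measurable_power_sums] measurable_component_singleton[of m]]
    by simp
  show "integrable M (\<lambda>\<omega>. power_sums (Y \<omega>) m)"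
    using ranked by (intro integrable_const_bound[of _ 1])
      (auto elim!: eventually_mono simp: power_sums_nonneg power_sums_le_1)
  have "(\<integral>\<^sup>+\<omega>. ennreal (power_sums (Y \<omega>) m) \<partial>M) = (\<integral>\<^sup>+\<omega>. distinct_sum [Suc m] (ennreal_seq (Y \<omega>)) \<partial>M)"
    using ranked by (intro nn_integral_cong_AE)
      (auto elim!: eventually_mono simp: ennreal_power_sums power_sum_def simp del: power_Suc)
  then show "(\<integral>\<omega>. power_sums (Y \<omega>) m \<partial>M) = enn2real (\<integral>\<^sup>+\<omega>. distinct_sum [Suc m] (ennreal_seq (Y \<omega>)) \<partial>M)"
    by (subst integral_eq_nn_integral) (auto simp: power_sums_nonneg)
qed

context size_biased_deletion
begin

lemma integral_power_sums_P: "(\<integral>\<omega>. power_sums (P \<omega>) m \<partial>M) = P_moment [Suc m]"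
  unfolding P_moment_def by (rule integral_power_sums(2)[OF P P_ranked])

lemma integral_power_sums_Q: "(\<integral>\<omega>. power_sums (Q \<omega>) m \<partial>M) = Q_moment [Suc m]"
  unfolding Q_moment_def by (rule integral_power_sums(2)[OF Q Q_ranked])

text \<open>At \<open>t = Q_moment [2]\<close>, once \<open>Q_moment [1] = 1\<close> is known, this
  is the log-convexity inequality.\<close>

lemma Q_moment_quadratic: "0 \<le> Q_moment [3] - 2 * t * Q_moment [2] + t ^ 2 * Q_moment [1]"
proof -
  note i = integral_power_sums(1)[OF Q Q_ranked]
  have "0 \<le> (\<integral>\<omega>. power_sums (Q \<omega>) 2 - 2 * t * power_sums (Q \<omega>) 1 + t ^ 2 * power_sums (Q \<omega>) 0 \<partial>M)"
  proof (rule integral_nonneg_AE)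
    show "AE \<omega> in M. 0 \<le> power_sums (Q \<omega>) 2 - 2 * t * power_sums (Q \<omega>) 1 + t ^ 2 * power_sums (Q \<omega>) 0"
      using Q_ranked
    proof eventually_elim
      case (elim \<omega>)
      show ?case
        by (rule sums_le[OF _ sums_zero power_sums_quadratic[OF elim]])
          (auto simp: ranked_frequencies_nonneg[OF elim])
    qed
  qed
  also have "\<dots> = Q_moment [3] - 2 * t * Q_moment [2] + t ^ 2 * Q_moment [1]"
    using i by (simp add: integral_power_sums_Q numeral_2_eq_2 numeral_3_eq_3)
  finally show ?thesis .
qed

context
  assumes regular: "\<not> (AE \<omega> in M. \<not> (0 < P \<omega> 1 \<and> P \<omega> 0 + P \<omega> 1 < 1))"
    and indep: "indep_random_variables M borel X seq_borel Q"
begin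

text \<open>The expected missing mass; nothing excludes a positive value until independence is
  exploited.\<close>

definition dust :: real where
  "dust = enn2real (\<integral>\<^sup>+\<omega>. indicator {0} (X \<omega>) \<partial>M)"

lemma ennreal_dust: "ennreal dust = (\<integral>\<^sup>+\<omega>. indicator {0} (X \<omega>) \<partial>M)"
proof -
  have "(\<integral>\<^sup>+\<omega>. indicator {0} (X \<omega>) \<partial>M) \<le> (\<integral>\<^sup>+\<omega>. 1 \<partial>M)" by (intro nn_integral_mono) (simp add: indicator_def)
  then show ?thesis unfolding dust_def by (intro ennreal_enn2real) (auto simp: emeasure_space_1 intro: le_less_trans)
qed

lemma P_moment_Cons:
  assumes ns: "\<forall>n\<in>set ns. 0 < n"
  shows "P_moment (Suc r # ns) = X_moment r (sum_list ns) * Q_moment ns"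
proof -
  let ?f = "\<lambda>x. indicator {0<..} x * ennreal x ^ r * ennreal (1 - x) ^ sum_list ns"
  have f: "?f \<in> borel_measurable borel" by measurable
  have "ennreal (P_moment (Suc r # ns)) = (\<integral>\<^sup>+\<omega>. distinct_sum (Suc r # ns) (ennreal_seq (P \<omega>)) \<partial>M)"
    using ns by (intro ennreal_P_moment) simp
  also have "\<dots> = (\<integral>\<^sup>+\<omega>. ?f (X \<omega>) * distinct_sum ns (ennreal_seq (Q \<omega>)) \<partial>M)"
    by (rule nn_integral_deletion_moment[OF ns, symmetric])
  also have "\<dots> = (\<integral>\<^sup>+\<omega>. ?f (X \<omega>) \<partial>M) * (\<integral>\<^sup>+\<omega>. distinct_sum ns (ennreal_seq (Q \<omega>)) \<partial>M)"
    by (rule nn_integral_indep_random_variables[OF indep f measurable_distinct_sum])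
  also have "\<dots> = ennreal (X_moment r (sum_list ns)) * ennreal (Q_moment ns)"
    unfolding ennreal_X_moment X_integral_def ennreal_Q_moment[OF ns] ..
  also have "\<dots> = ennreal (X_moment r (sum_list ns) * Q_moment ns)"
    by (rule ennreal_mult[symmetric]) (rule X_moment_nonneg Q_moment_nonneg)+
  finally show ?thesis
    by (subst (asm) ennreal_inj) (auto intro: P_moment_nonneg mult_nonneg_nonneg X_moment_nonneg Q_moment_nonneg)
qed

text \<open>The addition rule with missing mass: where nothing is picked, \<open>Q = P\<close>, and
  independence turns the contribution of that event into \<open>dust * Q_moment ns\<close>.\<close>

lemma P_moment_sum_dust:
  assumes ns: "\<forall>n\<in>set ns. 0 < n"
  shows "P_moment ns = dust * Q_moment ns + ((\<Sum>j<length ns. P_moment (ns[j := Suc (ns ! j)])) + P_moment (1 # ns))"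
proof -
  let ?R = "(\<Sum>j<length ns. P_moment (ns[j := Suc (ns ! j)])) + P_moment (1 # ns)"
  have R: "0 \<le> ?R" by (intro add_nonneg_nonneg sum_nonneg P_moment_nonneg)
  have d: "0 \<le> dust" by (simp add: dust_def)
  have ind: "indicator {0::real} \<in> borel_measurable borel" by (intro borel_measurable_indicator) simp
  have "ennreal (P_moment ns) = (\<integral>\<^sup>+\<omega>. indicator {0} (X \<omega>) * distinct_sum ns (ennreal_seq (Q \<omega>)) \<partial>M) +
      (\<integral>\<^sup>+\<omega>. (\<Sum>j. ennreal_seq (P \<omega>) j) * distinct_sum ns (ennreal_seq (P \<omega>)) \<partial>M)"
    unfolding ennreal_P_moment[OF ns] by (rule nn_integral_dust[OF measurable_distinct_sum, symmetric])
  also have "(\<integral>\<^sup>+\<omega>. indicator {0} (X \<omega>) * distinct_sum ns (ennreal_seq (Q \<omega>)) \<partial>M) = ennreal dust * ennreal (Q_moment ns)"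
    unfolding ennreal_dust ennreal_Q_moment[OF ns]
    by (rule nn_integral_indep_random_variables[OF indep ind measurable_distinct_sum])
  also have "\<dots> + (\<integral>\<^sup>+\<omega>. (\<Sum>j. ennreal_seq (P \<omega>) j) * distinct_sum ns (ennreal_seq (P \<omega>)) \<partial>M) =
      ennreal (dust * Q_moment ns + ?R)"
    unfolding integral_sum_P_mult[OF ns] using d R Q_moment_nonneg
    by (simp only: ennreal_mult ennreal_plus mult_nonneg_nonneg)
  finally show ?thesis
    using d R Q_moment_nonneg[of ns] P_moment_nonneg[of ns]
    by (subst (asm) ennreal_inj) (auto intro!: add_nonneg_nonneg mult_nonneg_nonneg)
qed

text \<open>On the regular event the largest frequency lies strictly between 0 and 1, so the case
  that it is picked contributes a positive amount.\<close>

lemma X_moment_pos: "0 < X_moment r s"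
proof -
  let ?\<phi> = "\<lambda>x. ennreal x ^ r * ennreal (1 - x) ^ s"
  have \<phi>: "?\<phi> \<in> borel_measurable borel" by measurable
  have m: "(\<lambda>\<omega>. \<Sum>j. ennreal (P \<omega> j) * ?\<phi> (P \<omega> j)) \<in> borel_measurable M" by measurable
  have "0 < (\<integral>\<^sup>+\<omega>. (\<Sum>j. ennreal (P \<omega> j) * ?\<phi> (P \<omega> j)) \<partial>M)"
  proof (rule nn_integral_pos[OF m _ regular])
    show "AE \<omega> in M. 0 < P \<omega> 1 \<and> P \<omega> 0 + P \<omega> 1 < 1 \<longrightarrow> 0 < (\<Sum>j. ennreal (P \<omega> j) * ?\<phi> (P \<omega> j))"
      using P_ranked
    proof eventually_elim
      case (elim \<omega>)
      show ?case
      proof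
        assume *: "0 < P \<omega> 1 \<and> P \<omega> 0 + P \<omega> 1 < 1"
        then have "0 < P \<omega> 0" "P \<omega> 0 < 1" using elim by (auto simp: ranked_frequencies_def dest: decseqD[of _ 0 1])
        then have "0 < ennreal (P \<omega> 0 * (P \<omega> 0 ^ r * (1 - P \<omega> 0) ^ s))" by simp
        also have "\<dots> = ennreal (P \<omega> 0) * ?\<phi> (P \<omega> 0)"
          using \<open>0 < P \<omega> 0\<close> \<open>P \<omega> 0 < 1\<close> by (simp add: ennreal_mult ennreal_power)
        also have "\<dots> \<le> (\<Sum>j. ennreal (P \<omega> j) * ?\<phi> (P \<omega> j))"
          unfolding suminf_split_at_ennreal[of "\<lambda>j. ennreal (P \<omega> j) * ?\<phi> (P \<omega> j)" 0]
          by (rule add_increasing2) (rule zero_le, rule order_refl)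
        finally show "0 < (\<Sum>j. ennreal (P \<omega> j) * ?\<phi> (P \<omega> j))" .
      qed
    qed
  qed
  also have "\<dots> = X_integral r s"
    using nn_integral_deletion[OF \<phi>, of "[]"] by (simp add: X_integral_def mult.assoc)
  finally show ?thesis unfolding ennreal_X_moment[symmetric] by simp
qed

text \<open>The parameter \<open>k\<close> allows two uses: two positive terms follow from
  regularity alone, a third one only after dust is excluded.\<close>

lemma P_moment_pos:
  assumes len: "length ns \<le> k" and ns: "\<forall>n\<in>set ns. 0 < n"
    and pos: "AE \<omega> in M. 0 < P \<omega> 1 \<and> P \<omega> 0 + P \<omega> 1 < 1 \<longrightarrow> (\<forall>i<k. 0 < P \<omega> i)"
  shows "0 < P_moment ns"
proof -
  have "0 < (\<integral>\<^sup>+\<omega>. distinct_sum ns (ennreal_seq (P \<omega>)) \<partial>M)"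
  proof (rule nn_integral_pos[OF _ _ regular])
    show "AE \<omega> in M. 0 < P \<omega> 1 \<and> P \<omega> 0 + P \<omega> 1 < 1 \<longrightarrow> 0 < distinct_sum ns (ennreal_seq (P \<omega>))"
      using pos
    proof eventually_elim
      case (elim \<omega>)
      then show ?case using len by (auto intro!: distinct_sum_pos[of "[0..<length ns]"])
    qed
  qed measurable
  then show ?thesis unfolding ennreal_P_moment[OF ns, symmetric] by simp
qed

text \<open>Writing \<open>a\<close>, \<open>b\<close> for \<^const>\<open>X_moment\<close> and the moments \<open>Q_moment [n]\<close>, exchanging the roles of the
  two picks gives \<open>a n 1 * b 1 = a 0 (n+1) * b (n+1)\<close>, while counting the dust gives
  \<open>a n 1 = (dust + a 0 (n+1)) * b (n+1)\<close>. Hence \<open>a 0 (n+1) * (1 - b 1)\<close> does not depend on \<open>n\<close>.\<close>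

lemma dust_eq_0: "dust = 0" and Q_moment_1: "Q_moment [1] = 1"
proof -
  have pos2: "AE \<omega> in M. 0 < P \<omega> 1 \<and> P \<omega> 0 + P \<omega> 1 < 1 \<longrightarrow> (\<forall>i<2. 0 < P \<omega> i)"
    using P_ranked by eventually_elim (auto simp: ranked_frequencies_def less_2_cases_iff dest: decseqD[of _ 0 1])
  have Q_Nil: "Q_moment [] = 1" by (simp add: Q_moment_def emeasure_space_1)
  have *: "Q_moment [1] * (dust + X_moment 0 (Suc n)) = X_moment 0 (Suc n)" for n
  proof -
    have "P_moment [1, Suc n] = P_moment [Suc n, 1]" using P_moment_move[of "[1, Suc n]" 1] by simp
    then have sym: "X_moment 0 (Suc n) * Q_moment [Suc n] = X_moment n 1 * Q_moment [1]"
      using P_moment_Cons[of "[Suc n]" 0] P_moment_Cons[of "[1]" n] by simp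
    have "0 < P_moment [1, Suc n]" by (rule P_moment_pos[OF _ _ pos2]) auto
    then have b: "0 < Q_moment [Suc n]"
      using P_moment_Cons[of "[Suc n]" 0] X_moment_pos[of 0 "Suc n"] by (simp add: zero_less_mult_iff)
    have "X_moment n 0 = dust * Q_moment [Suc n] + (X_moment (Suc n) 0 + X_moment 0 (Suc n) * Q_moment [Suc n])"
      using P_moment_sum_dust[of "[Suc n]"] P_moment_Cons[of "[]" n] P_moment_Cons[of "[]" "Suc n"]
        P_moment_Cons[of "[Suc n]" 0] Q_Nil by (simp add: lessThan_Suc)
    then have "X_moment n 1 = (dust + X_moment 0 (Suc n)) * Q_moment [Suc n]"
      using X_moment_add[of n 0] by (simp add: distrib_right)
    then have "(Q_moment [1] * (dust + X_moment 0 (Suc n))) * Q_moment [Suc n] = X_moment n 1 * Q_moment [1]"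
      by (simp only: mult_ac)
    then have "(Q_moment [1] * (dust + X_moment 0 (Suc n))) * Q_moment [Suc n] = X_moment 0 (Suc n) * Q_moment [Suc n]"
      unfolding sym .
    then show ?thesis using b by simp
  qed
  \<comment> \<open>The moments \<open>a 0 (n+1)\<close> are not constant in \<open>n\<close>, so
    the factor \<open>1 - b 1\<close> must vanish, and with it the dust.\<close>
  have "X_moment 0 1 \<noteq> X_moment 0 2" using X_moment_add[of 0 1] X_moment_pos[of 1 1] by (simp add: numeral_2_eq_2)
  moreover have "(Q_moment [1] - 1) * (X_moment 0 1 - X_moment 0 2) = 0"
    using *[of 0] *[of 1] by (simp add: numeral_2_eq_2 algebra_simps)
  ultimately show Q1: "Q_moment [1] = 1" by simp
  show "dust = 0" using *[of 0] Q1 by simp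
qed

lemma AE_sum_P: "AE \<omega> in M. power_sums (P \<omega>) 0 = 1"
proof -
  have "P_moment [] = 1" by (simp add: P_moment_def emeasure_space_1)
  moreover have "P_moment [] = dust * Q_moment [] + (0 + P_moment [1])" using P_moment_sum_dust[of "[]"] by simp
  ultimately have P1: "P_moment [Suc 0] = 1" unfolding dust_eq_0 by (metis One_nat_def add_0 mult_zero_left)
  note i = integral_power_sums(1)[OF P P_ranked, of 0]
  have int: "integrable M (\<lambda>\<omega>. 1 - power_sums (P \<omega>) 0)"
    by (intro Bochner_Integration.integrable_diff integrable_const i)
  have "(\<integral>\<omega>. 1 - power_sums (P \<omega>) 0 \<partial>M) = (\<integral>\<omega>. 1 \<partial>M) - (\<integral>\<omega>. power_sums (P \<omega>) 0 \<partial>M)"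
    by (rule Bochner_Integration.integral_diff[OF integrable_const i])
  also have "\<dots> = 0" unfolding integral_power_sums_P P1 by (simp add: prob_space)
  finally have zero: "(\<integral>\<omega>. 1 - power_sums (P \<omega>) 0 \<partial>M) = 0" .
  have nn: "AE \<omega> in M. 0 \<le> 1 - power_sums (P \<omega>) 0"
    using P_ranked by eventually_elim (simp add: power_sums_le_1)
  have "AE \<omega> in M. 1 - power_sums (P \<omega>) 0 = 0"
    by (rule iffD1[OF integral_nonneg_eq_0_iff_AE[OF int nn] zero])
  then show ?thesis by eventually_elim simp
qed

text \<open>The first two terms sum to less than 1 while the total mass is 1, so a third term must
  be positive.\<close>

lemma AE_three_pos:
  "AE \<omega> in M. 0 < P \<omega> 1 \<and> P \<omega> 0 + P \<omega> 1 < 1 \<longrightarrow> (\<forall>i<3. 0 < P \<omega> i)"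
  using P_ranked AE_sum_P
proof eventually_elim
  case (elim \<omega>)
  have x: "decseq (P \<omega>)" "\<And>i. 0 \<le> P \<omega> i" using elim(1) by (auto simp: ranked_frequencies_def)
  show ?case
  proof
    assume *: "0 < P \<omega> 1 \<and> P \<omega> 0 + P \<omega> 1 < 1"
    have "P \<omega> 2 \<noteq> 0"
    proof
      assume 2: "P \<omega> 2 = 0"
      have "P \<omega> k = 0" if "2 \<le> k" for k using decseqD[OF x(1) that] 2 x(2)[of k] by simp
      then have "P \<omega> sums (\<Sum>k<2. P \<omega> k)" by (intro sums_finite) (auto simp: not_less)
      moreover have "(\<lambda>i. P \<omega> i ^ Suc 0) sums 1" using power_sums_sums[OF elim(1), of 0] elim(2) by simp
      ultimately have "(\<Sum>k<2. P \<omega> k) = 1" using sums_unique2 by auto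
      then show False using * by (simp add: numeral_2_eq_2)
    qed
    then have "0 < P \<omega> 2" using x(2)[of 2] by simp
    then show "\<forall>i<3. 0 < P \<omega> i" using decseqD[OF x(1), of _ 2] by (auto intro: less_le_trans)
  qed
qed

lemma deletion_moments: "deletion_moments P_moment Q_moment X_moment"
proof
  show "P_moment (Suc r # ns) = X_moment r (sum_list ns) * Q_moment ns" if "\<forall>n\<in>set ns. 0 < n" for r ns
    by (rule P_moment_Cons[OF that])
  show "P_moment ns = P_moment (ns ! j # remove_nth j ns)" if "\<forall>n\<in>set ns. 0 < n" "j < length ns" for ns j
    by (rule P_moment_move[OF that])
  show "P_moment ns = (\<Sum>j<length ns. P_moment (ns[j := Suc (ns ! j)])) + P_moment (1 # ns)"
    if "\<forall>n\<in>set ns. 0 < n" for ns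
    using P_moment_sum_dust[OF that] dust_eq_0 by simp
  show "X_moment r s = X_moment (Suc r) s + X_moment r (Suc s)" for r s by (rule X_moment_add)
  show Nil: "P_moment [] = 1" "Q_moment [] = 1" by (simp_all add: P_moment_def Q_moment_def emeasure_space_1)
  show "Q_moment [1] = 1" by (rule Q_moment_1)
  have "P_moment [] = dust * Q_moment [] + (0 + P_moment [1])" using P_moment_sum_dust[of "[]"] by simp
  moreover have "P_moment [1] = X_moment 0 0 * Q_moment []" using P_moment_Cons[of "[]" 0] by simp
  ultimately show "X_moment 0 0 = 1" unfolding dust_eq_0 Nil by linarith
  show "0 \<le> P_moment ns" for ns by (rule P_moment_nonneg)
  show "0 < X_moment r s" for r s by (rule X_moment_pos)
  show "0 < P_moment [1, 1, r]" if "0 < r" for r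
    by (rule P_moment_pos[OF _ _ AE_three_pos]) (use that in auto)
  show "(\<lambda>r. X_moment r 0) \<longlonglongrightarrow> 0" by (rule X_moment_lim)
  show "Q_moment [2] ^ 2 \<le> Q_moment [3]"
    using Q_moment_quadratic[of "Q_moment [2]"] Q_moment_1 by (simp add: power2_eq_square)
qed

lemma PD_if_moments:
  assumes params: "PD_parameters \<alpha> \<theta>"
    and eq: "\<And>ns. \<forall>n\<in>set ns. 0 < n \<Longrightarrow> P_moment ns = PD_moment \<alpha> \<theta> ns"
  shows "distr M seq_borel P = PD \<alpha> \<theta>"
proof (rule ranked_measure_eqI)
  show "finite_measure (distr M seq_borel P)" by (rule finite_measure_distr) simp
  show "finite_measure (PD \<alpha> \<theta>)"
    using prob_space_PD[OF params] by (simp add: prob_space_def)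
  show "AE x in distr M seq_borel P. x \<in> ranked_frequencies"
    using P_ranked by (subst AE_distr_iff) (auto simp: space_PiM)
  show "AE x in PD \<alpha> \<theta>. x \<in> ranked_frequencies" by (rule AE_PD_ranked[OF params])
  show "(\<integral>\<^sup>+x. distinct_sum ns (ennreal_seq x) \<partial>distr M seq_borel P) = (\<integral>\<^sup>+x. distinct_sum ns (ennreal_seq x) \<partial>PD \<alpha> \<theta>)"
    if ns: "\<forall>n\<in>set ns. 0 < n" for ns
    unfolding nn_integral_PD[OF params ns] eq[OF ns, symmetric] ennreal_P_moment[OF ns]
    by (rule nn_integral_distr[OF P]) simp
qed (simp_all add: PD_def)

text \<open>With total mass 1 the prescribed moments give the sum of
  \<open>P i * (P i - t) ^ 2\<close> the expectation
  \<open>t\<^sup>2 - 2 t\<^sup>2 + t\<^sup>2 = 0\<close>, so almost surely every term is 0 or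
  \<open>t\<close>.\<close>

lemma uniform_if_moments:
  assumes t: "0 < t" and eq: "P_moment [2] = t" "P_moment [3] = t ^ 2"
  shows "\<exists>m::nat. 3 \<le> m \<and> (AE \<omega> in M. \<forall>k<m. P \<omega> k = 1 / real m)"
proof -
  note i = integral_power_sums(1)[OF P P_ranked]
  let ?h = "\<lambda>\<omega>. power_sums (P \<omega>) 2 - 2 * t * power_sums (P \<omega>) 1 + t ^ 2 * power_sums (P \<omega>) 0"
  have "(\<integral>\<omega>. power_sums (P \<omega>) 0 \<partial>M) = (\<integral>\<omega>. 1 \<partial>M)"
    by (rule integral_cong_AE[OF borel_measurable_integrable[OF i] borel_measurable_const AE_sum_P])
  then have 1: "P_moment [Suc 0] = 1" unfolding integral_power_sums_P by (simp add: prob_space)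
  have int: "integrable M ?h"
    by (intro Bochner_Integration.integrable_add Bochner_Integration.integrable_diff integrable_mult_right i)
  have "(\<integral>\<omega>. ?h \<omega> \<partial>M) = P_moment [3] - 2 * t * P_moment [2] + t ^ 2 * P_moment [Suc 0]"
    using i by (simp add: integral_power_sums_P numeral_2_eq_2 numeral_3_eq_3)
  also have "\<dots> = 0" unfolding eq 1 by (simp add: power2_eq_square)
  finally have zero: "(\<integral>\<omega>. ?h \<omega> \<partial>M) = 0" .
  have nn: "AE \<omega> in M. 0 \<le> ?h \<omega>"
    using P_ranked
  proof eventually_elim
    case (elim \<omega>)
    show ?case
      by (rule sums_le[OF _ sums_zero power_sums_quadratic[OF elim]])
        (auto simp: ranked_frequencies_nonneg[OF elim])
  qed
  have h0: "AE \<omega> in M. ?h \<omega> = 0"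
    by (rule iffD1[OF integral_nonneg_eq_0_iff_AE[OF int nn] zero])
  have ex: "AE \<omega> in M. \<exists>n. real n * t = 1 \<and> (\<forall>k<n. P \<omega> k = t)"
    using h0 P_ranked AE_sum_P
  proof eventually_elim
    case (elim \<omega>)
    have s: "(\<lambda>i. P \<omega> i * (P \<omega> i - t) ^ 2) sums 0"
      using power_sums_quadratic[OF elim(2), of t] unfolding elim(1) .
    have nn: "0 \<le> P \<omega> i * (P \<omega> i - t) ^ 2" for i using ranked_frequencies_nonneg[OF elim(2), of i] by simp
    have "P \<omega> i * (P \<omega> i - t) ^ 2 = 0" for i
      using suminf_eq_zero_iff[OF sums_summable[OF s] nn] sums_unique[OF s] by simp
    then have "P \<omega> i = 0 \<or> P \<omega> i = t" for i by simp
    then show ?case by (rule ranked_two_values[OF elim(2) t _ elim(3)])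
  qed
  \<comment> \<open>The number of terms is \<open>1 / t\<close> and hence not random, so one sample
    point in the regular event suffices to show that it is at least 3.\<close>
  have "\<exists>\<omega>. 0 < P \<omega> 1 \<and> P \<omega> 0 + P \<omega> 1 < 1 \<and> (\<forall>i<3. 0 < P \<omega> i) \<and> (\<exists>n. real n * t = 1 \<and> (\<forall>k<n. P \<omega> k = t))"
  proof (rule ccontr)
    assume neg: "\<not> ?thesis"
    have "AE \<omega> in M. \<not> (0 < P \<omega> 1 \<and> P \<omega> 0 + P \<omega> 1 < 1)"
      using ex AE_three_pos by eventually_elim (use neg in blast)
    then show False using regular by blast
  qed
  then obtain \<omega> m where \<omega>: "0 < P \<omega> 1" "P \<omega> 0 + P \<omega> 1 < 1" and m: "real m * t = 1" "\<forall>k<m. P \<omega> k = t" by blast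
  have "3 \<le> m"
  proof (rule ccontr)
    assume "\<not> 3 \<le> m"
    then consider "m = 0" | "m = 1" | "m = 2" by linarith
    then show False using m \<omega> by cases auto
  qed
  moreover have t_eq: "t = 1 / real m" using m(1) by (metis mult_zero_left nonzero_eq_divide_eq mult.commute zero_neq_one)
  have "AE \<omega> in M. \<forall>k<m. P \<omega> k = 1 / real m"
    using ex
  proof eventually_elim
    case (elim \<omega>)
    then obtain n where n: "real n * t = 1" "\<forall>k<n. P \<omega> k = t" by blast
    have "n = m" using n(1) m(1) t by (metis mult_right_cancel of_nat_eq_iff less_irrefl)
    then show ?case using n t_eq by simp
  qed
  ultimately show ?thesis by blast
qed

lemma indep_imp_PD_or_uniform:
  "(\<exists>\<alpha> \<theta>. has_PD_distribution M P \<alpha> \<theta>) \<or>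
   (\<exists>m::nat. 3 \<le> m \<and> (AE \<omega> in M. \<forall>k<m. P \<omega> k = 1 / real m))"
  using deletion_moments.moments_dichotomy[OF deletion_moments]
    PD_if_moments uniform_if_moments unfolding has_PD_distribution_def by blast

end
end

theorem corollary5:
  fixes M :: "'a measure"
    and P Q :: "'a \<Rightarrow> nat \<Rightarrow> real"
    and J :: "'a \<Rightarrow> enat"
  assumes "prob_space M"
    and "P \<in> M \<rightarrow>\<^sub>M seq_borel"
    and "AE \<omega> in M. P \<omega> \<in> ranked_frequencies"
    and "measure M {\<omega> \<in> space M. 0 < P \<omega> 1 \<and> P \<omega> 0 + P \<omega> 1 < 1} > 0"
    and "measure M {\<omega> \<in> space M. P \<omega> 0 = 1} = 0"
    and "size_biased_index M P J"
    and "Q = (\<lambda>\<omega>. delete_renormalize (P \<omega>) (J \<omega>))"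
  shows "(indep_random_variables M borel (\<lambda>\<omega>. pick (P \<omega>) (J \<omega>)) seq_borel Q \<longleftrightarrow>
           (\<exists>\<alpha> \<theta>. has_PD_distribution M P \<alpha> \<theta>) \<or>
           (\<exists>m::nat. 3 \<le> m \<and> (AE \<omega> in M. \<forall>k<m. P \<omega> k = 1 / real m))) \<and>
         (\<forall>\<alpha> \<theta>. has_PD_distribution M P \<alpha> \<theta> \<longrightarrow> has_PD_distribution M Q \<alpha> (\<theta> + \<alpha>)) \<and>
         (\<forall>m::nat. 3 \<le> m \<and> (AE \<omega> in M. \<forall>k<m. P \<omega> k = 1 / real m) \<longrightarrow>
           (AE \<omega> in M. \<forall>k<m - 1. Q \<omega> k = 1 / real (m - 1)))"
proof -
  interpret prob_space M by fact
  note [measurable] = assms(2)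
  have neq1: "AE \<omega> in M. P \<omega> 0 \<noteq> 1"
  proof -
    have "{\<omega> \<in> space M. P \<omega> 0 = 1} \<in> null_sets M"
      using assms(5) by (intro null_setsI) (auto simp: emeasure_eq_measure)
    then have "AE \<omega> in M. \<omega> \<notin> {\<omega> \<in> space M. P \<omega> 0 = 1}" by (rule AE_not_in)
    with AE_space show ?thesis by eventually_elim auto
  qed
  have regular: "\<not> (AE \<omega> in M. \<not> (0 < P \<omega> 1 \<and> P \<omega> 0 + P \<omega> 1 < 1))"
  proof
    assume "AE \<omega> in M. \<not> (0 < P \<omega> 1 \<and> P \<omega> 0 + P \<omega> 1 < 1)"
    then have "prob {\<omega> \<in> space M. 0 < P \<omega> 1 \<and> P \<omega> 0 + P \<omega> 1 < 1} = prob {}"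
      by (intro finite_measure_eq_AE) (auto elim!: eventually_mono)
    then show False using assms(4) by simp
  qed
  interpret size_biased_deletion M P J
    by unfold_locales (use assms neq1 in auto)
  show ?thesis
    unfolding assms(7)
  proof (intro conjI iffI allI impI)
    assume "indep_random_variables M borel (\<lambda>\<omega>. pick (P \<omega>) (J \<omega>)) seq_borel (\<lambda>\<omega>. delete_renormalize (P \<omega>) (J \<omega>))"
    then show "(\<exists>\<alpha> \<theta>. has_PD_distribution M P \<alpha> \<theta>) \<or>
        (\<exists>m::nat. 3 \<le> m \<and> (AE \<omega> in M. \<forall>k<m. P \<omega> k = 1 / real m))"
      by (rule indep_imp_PD_or_uniform[OF regular])
  next
    assume "(\<exists>\<alpha> \<theta>. has_PD_distribution M P \<alpha> \<theta>) \<or>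
        (\<exists>m::nat. 3 \<le> m \<and> (AE \<omega> in M. \<forall>k<m. P \<omega> k = 1 / real m))"
    then show "indep_random_variables M borel (\<lambda>\<omega>. pick (P \<omega>) (J \<omega>)) seq_borel (\<lambda>\<omega>. delete_renormalize (P \<omega>) (J \<omega>))"
      using deletion_PD(1) uniform_case(2) unfolding has_PD_distribution_def by blast
  next
    fix \<alpha> \<theta> assume "has_PD_distribution M P \<alpha> \<theta>"
    then show "has_PD_distribution M (\<lambda>\<omega>. delete_renormalize (P \<omega>) (J \<omega>)) \<alpha> (\<theta> + \<alpha>)"
      using deletion_PD(2) PD_parameters_shift unfolding has_PD_distribution_def by blast
  next
    fix m :: nat assume "3 \<le> m \<and> (AE \<omega> in M. \<forall>k<m. P \<omega> k = 1 / real m)"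
    then show "AE \<omega> in M. \<forall>k<m - 1. delete_renormalize (P \<omega>) (J \<omega>) k = 1 / real (m - 1)"
      using uniform_case(1) by blast
  qed
qed

end
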